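(* Let $q$ be a non degenerate quadratic form on a super vector space $V$ of dimension $m|2n$ over $\mathbb{C}$, let $B$ be the associated bilinear form, and let $\mathrm{vol}:\bigwedge^mV_0\to\mathbb{C}$ be one of the two opposite isomorphisms such that $\mathrm{vol}(v_1\wedge\dots\wedge v_m)^2=\det(B(v_i,v_j))$ for $v_1,\dots,v_m\in V_0$. Let $U$ be the open subscheme of $\mathbf{V}^m$ on which the function $D=\det(B(v_i,v_j))_{1\le i,j\le m}$ is invertible, and let $\Delta$ be the unique function on $U$ such that $\Delta^2=D$ and such that the restriction of $\Delta$ to $U_{\mathrm{rd}}$ is $\mathrm{vol}(v_1\wedge\dots\wedge v_m)$. Then the function $\Delta^{2n+1}$ on $U$ extends to a function on $\mathbf{V}^m$.
   Context: All objects are in the super ($\mathbb{Z}/2$-graded) world over $\mathbb{C}$. A commutative super ring is a $\mathbb{Z}/2$-graded unital ring with $ab=(-1)^{|a||b|}ba$ for homogeneous $a,b$ and $a^2=0$ for $a$ odd. A super scheme is a topological space $S$ with a sheaf of commutative super rings $\mathscr{O}=\mathscr{O}_0\oplus\mathscr{O}_1$ such that $(S,\mathscr{O}_0)$ is a scheme and $\mathscr{O}_1$ is a quasi-coherent $\mathscr{O}_0$-module. $S_{\mathrm{rd}}$ is the largest closed ordinary subscheme, defined by the ideal generated by $\mathscr{O}_1$. A "function" on a super scheme $X$ is a global section of $\mathscr{O}_X$; equivalently a rule attaching, functorially in the commutative super $\mathbb{C}$-algebra $R$, to each $R$-point of $X$ an element of $R$. For a finite dimensional super vector space $V=V_0\oplus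 V_1$, of dimension $p|r$ if $\dim V_0=p$ and $\dim V_1=r$, put $V_R=R\otimes V$; the affine super space $\mathbf{V}$ is the super scheme whose $R$-points are the even elements of $V_R$. One has $\mathbf{V}_{\mathrm{rd}}=\mathbf{V}_0$, the ordinary affine space of $V_0$. A quadratic form $q$ on $V$ is an even function on $\mathbf{V}$ homogeneous of degree $2$; its associated bilinear form is $B(x,y)=q(x+y)-q(x)-q(y)$, which comes from a (super) symmetric morphism $V\otimes V\to\mathbb{C}$; $q$ is non degenerate if $B$ is a self-duality of $V$. The $B(v_i,v_j)$ are viewed as even functions on $\mathbf{V}^m$ (with generic point $(v_1,\dots,v_m)$), and $\mathrm{vol}(v_1\wedge\dots\wedge v_m)$ as a function on $\mathbf{V}_0^m\supset U_{\mathrm{rd}}$. (The existence and uniqueness of $\Delta$ is a prior result of the paper.) *)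

theory Defs
  imports Complex_Main "Jordan_Normal_Form.Determinant" "HOL-Algebra.AbelCoset" "HOL-Algebra.Module"
begin

section \<open>Commutative super algebras over the complex numbers\<close>

record 'a superalg = "(complex, 'a) module" +
  even_part :: "'a set"
  odd_part :: "'a set"

locale comm_superalgebra = ring R for R :: "'a superalg" (structure) +
  assumes smult_closed: "a \<in> carrier R \<Longrightarrow> c \<odot> a \<in> carrier R"
    and smult_add_left: "a \<in> carrier R \<Longrightarrow> (c + d) \<odot> a = c \<odot> a \<oplus> d \<odot> a"
    and smult_add_right: "a \<in> carrier R \<Longrightarrow> b \<in> carrier R \<Longrightarrow> c \<odot> (a \<oplus> b) = c \<odot> a \<oplus> c \<odot> b"
    and smult_smult: "a \<in> carrier R \<Longrightarrow> (c * d) \<odot> a = c \<odot> (d \<odot> a)"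
    and smult_one: "a \<in> carrier R \<Longrightarrow> 1 \<odot> a = a"
    and smult_mult_left: "a \<in> carrier R \<Longrightarrow> b \<in> carrier R \<Longrightarrow> (c \<odot> a) \<otimes> b = c \<odot> (a \<otimes> b)"
    and smult_mult_right: "a \<in> carrier R \<Longrightarrow> b \<in> carrier R \<Longrightarrow> a \<otimes> (c \<odot> b) = c \<odot> (a \<otimes> b)"
    and even_subgroup: "additive_subgroup (even_part R) R"
    and odd_subgroup: "additive_subgroup (odd_part R) R"
    and smult_even: "a \<in> even_part R \<Longrightarrow> c \<odot> a \<in> even_part R"
    and smult_odd: "a \<in> odd_part R \<Longrightarrow> c \<odot> a \<in> odd_part R"
    and even_odd_inter: "even_part R \<inter> odd_part R = {\<zero>}"
    and even_odd_sum: "a \<in> carrier R \<Longrightarrow> \<exists>b\<in>even_part R. \<exists>c\<in>odd_part R. a = b \<oplus> c"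
    and one_even: "\<one> \<in> even_part R"
    and even_even: "a \<in> even_part R \<Longrightarrow> b \<in> even_part R \<Longrightarrow> a \<otimes> b \<in> even_part R"
    and even_odd: "a \<in> even_part R \<Longrightarrow> b \<in> odd_part R \<Longrightarrow> a \<otimes> b \<in> odd_part R"
    and odd_even: "a \<in> odd_part R \<Longrightarrow> b \<in> even_part R \<Longrightarrow> a \<otimes> b \<in> odd_part R"
    and odd_odd: "a \<in> odd_part R \<Longrightarrow> b \<in> odd_part R \<Longrightarrow> a \<otimes> b \<in> even_part R"
    and even_comm: "a \<in> even_part R \<Longrightarrow> b \<in> carrier R \<Longrightarrow> a \<otimes> b = b \<otimes> a"
    and odd_anticomm: "a \<in> odd_part R \<Longrightarrow> b \<in> odd_part R \<Longrightarrow> a \<otimes> b = \<ominus> (b \<otimes> a)"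
    and odd_square: "a \<in> odd_part R \<Longrightarrow> a \<otimes> a = \<zero>"

definition superalg_hom :: "'a superalg \<Rightarrow> 'a superalg \<Rightarrow> ('a \<Rightarrow> 'a) set" where
  "superalg_hom R S =
     {h \<in> ring_hom R S. (\<forall>c. \<forall>a\<in>carrier R. h (c \<odot>\<^bsub>R\<^esub> a) = c \<odot>\<^bsub>S\<^esub> h a) \<and>
        h ` even_part R \<subseteq> even_part S \<and> h ` odd_part R \<subseteq> odd_part S}"

text \<open>The ordinary commutative ring \<open>R\<^sub>0\<close>. Products of even elements are taken here, because
  \<open>finprod\<close> needs a commutative monoid.\<close>

definition even_ring :: "'a superalg \<Rightarrow> 'a superalg" where
  "even_ring R = R\<lparr>carrier := even_part R\<rparr>"


section \<open>Functions on a super scheme\<close>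

text \<open>
  A super scheme enters through its points functor: \<open>X R\<close> is the set of its \<open>R\<close>-points, and
  \<open>act h\<close> is the map \<open>X R \<rightarrow> X S\<close> induced by a homomorphism \<open>h : R \<rightarrow> S\<close>. A function on it is a
  rule attaching, functorially in \<open>R\<close>, an element of \<open>R\<close> to each \<open>R\<close>-point.

  The algebras range over all those with carrier inside the type \<open>'a\<close>, which plays the role of a
  universe and stays a free type variable. As soon as \<open>'a\<close> has at least the cardinality of the
  continuum it contains a copy of every finitely generated super algebra, and in particular of the
  coordinate rings of the affine super schemes below, so by Yoneda these functions are exactly the
  global sections of the structure sheaf.
\<close>

definition superfunction ::
  "('a superalg \<Rightarrow> 'p set) \<Rightarrow> (('a \<Rightarrow> 'a) \<Rightarrow> 'p \<Rightarrow> 'p) \<Rightarrow> ('a superalg \<Rightarrow> 'p \<Rightarrow> 'a) \<Rightarrow> bool" where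
  "superfunction X act f \<longleftrightarrow>
     (\<forall>R. comm_superalgebra R \<longrightarrow> (\<forall>x\<in>X R. f R x \<in> carrier R)) \<and>
     (\<forall>R S. comm_superalgebra R \<longrightarrow> comm_superalgebra S \<longrightarrow>
        (\<forall>h\<in>superalg_hom R S. \<forall>x\<in>X R. f S (act h x) = h (f R x)))"

definition even_function ::
  "('a superalg \<Rightarrow> 'p set) \<Rightarrow> (('a \<Rightarrow> 'a) \<Rightarrow> 'p \<Rightarrow> 'p) \<Rightarrow> ('a superalg \<Rightarrow> 'p \<Rightarrow> 'a) \<Rightarrow> bool" where
  "even_function X act f \<longleftrightarrow> superfunction X act f \<and>
     (\<forall>R. comm_superalgebra R \<longrightarrow> (\<forall>x\<in>X R. f R x \<in> even_part R))"

definition odd_function ::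
  "('a superalg \<Rightarrow> 'p set) \<Rightarrow> (('a \<Rightarrow> 'a) \<Rightarrow> 'p \<Rightarrow> 'p) \<Rightarrow> ('a superalg \<Rightarrow> 'p \<Rightarrow> 'a) \<Rightarrow> bool" where
  "odd_function X act f \<longleftrightarrow> superfunction X act f \<and>
     (\<forall>R. comm_superalgebra R \<longrightarrow> (\<forall>x\<in>X R. f R x \<in> odd_part R))"

text \<open>\<open>X\<^sub>r\<^sub>d\<close>, the closed subscheme on which the ideal generated by \<open>\<O>\<^sub>1\<close> vanishes. Since only
  global odd functions are used, this is the right notion for affine \<open>X\<close> (the only case needed).\<close>

definition rd_points ::
  "('a superalg \<Rightarrow> 'p set) \<Rightarrow> (('a \<Rightarrow> 'a) \<Rightarrow> 'p \<Rightarrow> 'p) \<Rightarrow> 'a superalg \<Rightarrow> 'p set" where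
  "rd_points X act R = {x \<in> X R. \<forall>f. odd_function X act f \<longrightarrow> f R x = \<zero>\<^bsub>R\<^esub>}"


section \<open>Super vector spaces and their affine super spaces\<close>

locale super_vector_space = vector_space scale
  for scale :: "complex \<Rightarrow> 'v::ab_group_add \<Rightarrow> 'v" +
  fixes V0 V1 :: "'v set"
  assumes subspace_V0: "subspace V0" and subspace_V1: "subspace V1"
    and V0_V1_inter: "V0 \<inter> V1 = {0}"
    and V0_V1_sum: "\<exists>a\<in>V0. \<exists>b\<in>V1. v = a + b"

locale homogeneous_basis = super_vector_space scale V0 V1
  for scale :: "complex \<Rightarrow> 'v::ab_group_add \<Rightarrow> 'v" and V0 V1 :: "'v set" +
  fixes E0 E1 :: "'v set"
  assumes finite_E0: "finite E0" and finite_E1: "finite E1"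
    and independent_E0: "independent E0" and span_E0: "span E0 = V0"
    and independent_E1: "independent E1" and span_E1: "span E1 = V1"

text \<open>With respect to a homogeneous basis \<open>E0 \<union> E1\<close> of \<open>V\<close>, the \<open>R\<close>-module \<open>R \<otimes> V\<close> is free on the
  elements \<open>1 \<otimes> e\<close>; the element \<open>\<Sum>e. x e \<otimes> e\<close> is represented by its coordinate family \<open>x\<close>
  (extended by \<open>undefined\<close>). It is even iff \<open>x e\<close> has the parity of \<open>e\<close>.\<close>

definition affine_points :: "'v set \<Rightarrow> 'v set \<Rightarrow> 'a superalg \<Rightarrow> ('v \<Rightarrow> 'a) set" where
  "affine_points E0 E1 R =
     {x \<in> (E0 \<union> E1) \<rightarrow>\<^sub>E carrier R. (\<forall>e\<in>E0. x e \<in> even_part R) \<and> (\<forall>e\<in>E1. x e \<in> odd_part R)}"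

definition affine_act :: "'v set \<Rightarrow> 'v set \<Rightarrow> ('a \<Rightarrow> 'a) \<Rightarrow> ('v \<Rightarrow> 'a) \<Rightarrow> ('v \<Rightarrow> 'a)" where
  "affine_act E0 E1 h x = (\<lambda>e\<in>E0 \<union> E1. h (x e))"

definition affine_add :: "'v set \<Rightarrow> 'v set \<Rightarrow> 'a superalg \<Rightarrow> ('v \<Rightarrow> 'a) \<Rightarrow> ('v \<Rightarrow> 'a) \<Rightarrow> ('v \<Rightarrow> 'a)" where
  "affine_add E0 E1 R x y = (\<lambda>e\<in>E0 \<union> E1. x e \<oplus>\<^bsub>R\<^esub> y e)"

definition affine_scale :: "'v set \<Rightarrow> 'v set \<Rightarrow> 'a superalg \<Rightarrow> 'a \<Rightarrow> ('v \<Rightarrow> 'a) \<Rightarrow> ('v \<Rightarrow> 'a)" where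
  "affine_scale E0 E1 R r x = (\<lambda>e\<in>E0 \<union> E1. r \<otimes>\<^bsub>R\<^esub> x e)"

text \<open>The \<open>m\<close>-th power of the affine super space; the vectors of a tuple are indexed by
  \<open>{..<m}\<close>.\<close>

definition power_points :: "'v set \<Rightarrow> 'v set \<Rightarrow> nat \<Rightarrow> 'a superalg \<Rightarrow> (nat \<Rightarrow> 'v \<Rightarrow> 'a) set" where
  "power_points E0 E1 m R = {..<m} \<rightarrow>\<^sub>E affine_points E0 E1 R"

definition power_act ::
  "'v set \<Rightarrow> 'v set \<Rightarrow> nat \<Rightarrow> ('a \<Rightarrow> 'a) \<Rightarrow> (nat \<Rightarrow> 'v \<Rightarrow> 'a) \<Rightarrow> (nat \<Rightarrow> 'v \<Rightarrow> 'a)" where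
  "power_act E0 E1 m h v = (\<lambda>i\<in>{..<m}. affine_act E0 E1 h (v i))"


section \<open>Quadratic forms\<close>

definition quadratic_form ::
  "'v set \<Rightarrow> 'v set \<Rightarrow> ('a superalg \<Rightarrow> ('v \<Rightarrow> 'a) \<Rightarrow> 'a) \<Rightarrow> bool" where
  "quadratic_form E0 E1 q \<longleftrightarrow>
     even_function (affine_points E0 E1) (affine_act E0 E1) q \<and>
     (\<forall>R. comm_superalgebra R \<longrightarrow> (\<forall>r\<in>even_part R. \<forall>x\<in>affine_points E0 E1 R.
        q R (affine_scale E0 E1 R r x) = r \<otimes>\<^bsub>R\<^esub> r \<otimes>\<^bsub>R\<^esub> q R x))"

definition polar ::
  "'v set \<Rightarrow> 'v set \<Rightarrow> ('a superalg \<Rightarrow> ('v \<Rightarrow> 'a) \<Rightarrow> 'a) \<Rightarrow> 'a superalg \<Rightarrow> ('v \<Rightarrow> 'a) \<Rightarrow> ('v \<Rightarrow> 'a) \<Rightarrow> 'a" where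
  "polar E0 E1 q R x y = q R (affine_add E0 E1 R x y) \<ominus>\<^bsub>R\<^esub> q R x \<ominus>\<^bsub>R\<^esub> q R y"

text \<open>A (necessarily even) super symmetric morphism \<open>V \<otimes> V \<rightarrow> \<complex>\<close>.\<close>

definition super_symmetric_form ::
  "(complex \<Rightarrow> 'v::ab_group_add \<Rightarrow> 'v) \<Rightarrow> 'v set \<Rightarrow> 'v set \<Rightarrow> ('v \<Rightarrow> 'v \<Rightarrow> complex) \<Rightarrow> bool" where
  "super_symmetric_form scale V0 V1 b \<longleftrightarrow>
     (\<forall>x. Vector_Spaces.linear scale (*) (b x)) \<and>
     (\<forall>y. Vector_Spaces.linear scale (*) (\<lambda>x. b x y)) \<and>
     (\<forall>x\<in>V0. \<forall>y\<in>V1. b x y = 0 \<and> b y x = 0) \<and>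
     (\<forall>x\<in>V0. \<forall>y\<in>V0. b x y = b y x) \<and>
     (\<forall>x\<in>V1. \<forall>y\<in>V1. b x y = - b y x)"

text \<open>The \<open>R\<close>-bilinear extension, \<open>(r \<otimes> e, s \<otimes> f) \<mapsto> (-1)\<^bsup>|e||s|\<^esup> r s b(e, f)\<close>, on even elements
  of \<open>R \<otimes> V\<close>, so that \<open>|s| = |f|\<close>.\<close>

definition form_extension ::
  "'v set \<Rightarrow> 'v set \<Rightarrow> ('v \<Rightarrow> 'v \<Rightarrow> complex) \<Rightarrow> 'a superalg \<Rightarrow> ('v \<Rightarrow> 'a) \<Rightarrow> ('v \<Rightarrow> 'a) \<Rightarrow> 'a" where
  "form_extension E0 E1 b R x y =
     (\<Oplus>\<^bsub>R\<^esub>e\<in>E0 \<union> E1. \<Oplus>\<^bsub>R\<^esub>f\<in>E0 \<union> E1.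
        (if e \<in> E1 \<and> f \<in> E1 then - b e f else b e f) \<odot>\<^bsub>R\<^esub> (x e \<otimes>\<^bsub>R\<^esub> y f))"

definition associated_form ::
  "(complex \<Rightarrow> 'v::ab_group_add \<Rightarrow> 'v) \<Rightarrow> 'v set \<Rightarrow> 'v set \<Rightarrow> 'v set \<Rightarrow> 'v set \<Rightarrow>
   ('a superalg \<Rightarrow> ('v \<Rightarrow> 'a) \<Rightarrow> 'a) \<Rightarrow> ('v \<Rightarrow> 'v \<Rightarrow> complex) \<Rightarrow> bool" where
  "associated_form scale V0 V1 E0 E1 q b \<longleftrightarrow> super_symmetric_form scale V0 V1 b \<and>
     (\<forall>R. comm_superalgebra R \<longrightarrow>
        (\<forall>x\<in>affine_points E0 E1 R. \<forall>y\<in>affine_points E0 E1 R.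
           polar E0 E1 q R x y = form_extension E0 E1 b R x y))"

definition self_duality ::
  "(complex \<Rightarrow> 'v::ab_group_add \<Rightarrow> 'v) \<Rightarrow> ('v \<Rightarrow> 'v \<Rightarrow> complex) \<Rightarrow> bool" where
  "self_duality scale b \<longleftrightarrow> bij_betw b UNIV {\<phi>. Vector_Spaces.linear scale (*) \<phi>}"


section \<open>The function D, the open subscheme U, and vol\<close>

definition super_det :: "'a superalg \<Rightarrow> nat \<Rightarrow> (nat \<Rightarrow> nat \<Rightarrow> 'a) \<Rightarrow> 'a" where
  "super_det R m A =
     (\<Oplus>\<^bsub>R\<^esub>p\<in>{p. p permutes {..<m}}.
        of_int (sign p) \<odot>\<^bsub>R\<^esub> (\<Otimes>\<^bsub>even_ring R\<^esub>i\<in>{..<m}. A i (p i)))"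

definition gram ::
  "'v set \<Rightarrow> 'v set \<Rightarrow> nat \<Rightarrow> ('a superalg \<Rightarrow> ('v \<Rightarrow> 'a) \<Rightarrow> 'a) \<Rightarrow> 'a superalg \<Rightarrow> (nat \<Rightarrow> 'v \<Rightarrow> 'a) \<Rightarrow> 'a" where
  "gram E0 E1 m q R v = super_det R m (\<lambda>i j. polar E0 E1 q R (v i) (v j))"

definition gram_open ::
  "'v set \<Rightarrow> 'v set \<Rightarrow> nat \<Rightarrow> ('a superalg \<Rightarrow> ('v \<Rightarrow> 'a) \<Rightarrow> 'a) \<Rightarrow> 'a superalg \<Rightarrow> (nat \<Rightarrow> 'v \<Rightarrow> 'a) set" where
  "gram_open E0 E1 m q R = {v \<in> power_points E0 E1 m R. gram E0 E1 m q R v \<in> Units R}"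

text \<open>Linear maps \<open>\<And>\<^sup>m V0 \<rightarrow> \<complex>\<close> are given, by the universal property of the exterior power, as
  alternating multilinear maps \<open>(v\<^sub>1, \<dots>, v\<^sub>m) \<mapsto> vol (v\<^sub>1 \<and> \<dots> \<and> v\<^sub>m)\<close>. When \<open>dim V0 = m\<close> the source
  is a line, and such a map is an isomorphism iff it is not zero.\<close>

definition alternating_map ::
  "(complex \<Rightarrow> 'v::ab_group_add \<Rightarrow> 'v) \<Rightarrow> 'v set \<Rightarrow> nat \<Rightarrow> ((nat \<Rightarrow> 'v) \<Rightarrow> complex) \<Rightarrow> bool" where
  "alternating_map scale V0 m vol \<longleftrightarrow>
     (\<forall>v\<in>{..<m} \<rightarrow>\<^sub>E V0. \<forall>i<m. \<forall>x\<in>V0. \<forall>y\<in>V0.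
        vol (v(i := x + y)) = vol (v(i := x)) + vol (v(i := y))) \<and>
     (\<forall>v\<in>{..<m} \<rightarrow>\<^sub>E V0. \<forall>i<m. \<forall>x\<in>V0. \<forall>c.
        vol (v(i := scale c x)) = c * vol (v(i := x))) \<and>
     (\<forall>v\<in>{..<m} \<rightarrow>\<^sub>E V0. \<forall>i<m. \<forall>j<m. i \<noteq> j \<longrightarrow> v i = v j \<longrightarrow> vol v = 0)"

definition normalized_volume ::
  "(complex \<Rightarrow> 'v::ab_group_add \<Rightarrow> 'v) \<Rightarrow> 'v set \<Rightarrow> nat \<Rightarrow> ('v \<Rightarrow> 'v \<Rightarrow> complex) \<Rightarrow>
   ((nat \<Rightarrow> 'v) \<Rightarrow> complex) \<Rightarrow> bool" where
  "normalized_volume scale V0 m b vol \<longleftrightarrow>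
     alternating_map scale V0 m vol \<and> (\<exists>v\<in>{..<m} \<rightarrow>\<^sub>E V0. vol v \<noteq> 0) \<and>
     (\<forall>v\<in>{..<m} \<rightarrow>\<^sub>E V0. (vol v)\<^sup>2 = det (mat m m (\<lambda>(i, j). b (v i) (v j))))"

text \<open>\<open>vol (v\<^sub>1 \<and> \<dots> \<and> v\<^sub>m)\<close> as a function on \<open>\<^bold>V\<^sub>0\<^sup>m\<close>: the \<open>R\<close>-multilinear extension, evaluated on
  \<open>v\<^sub>i = \<Sum>e\<in>E0. v i e \<otimes> e\<close>.\<close>

definition volume_extension ::
  "'v set \<Rightarrow> nat \<Rightarrow> ((nat \<Rightarrow> 'v) \<Rightarrow> complex) \<Rightarrow> 'a superalg \<Rightarrow> (nat \<Rightarrow> 'v \<Rightarrow> 'a) \<Rightarrow> 'a" where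
  "volume_extension E0 m vol R v =
     (\<Oplus>\<^bsub>R\<^esub>f\<in>({..<m} \<rightarrow>\<^sub>E E0). vol f \<odot>\<^bsub>R\<^esub> (\<Otimes>\<^bsub>even_ring R\<^esub>i\<in>{..<m}. v i (f i)))"

definition root_of_gram ::
  "'v set \<Rightarrow> 'v set \<Rightarrow> nat \<Rightarrow> ('a superalg \<Rightarrow> ('v \<Rightarrow> 'a) \<Rightarrow> 'a) \<Rightarrow> ((nat \<Rightarrow> 'v) \<Rightarrow> complex) \<Rightarrow>
   ('a superalg \<Rightarrow> (nat \<Rightarrow> 'v \<Rightarrow> 'a) \<Rightarrow> 'a) \<Rightarrow> bool" where
  "root_of_gram E0 E1 m q vol \<Delta> \<longleftrightarrow>
     superfunction (gram_open E0 E1 m q) (power_act E0 E1 m) \<Delta> \<and>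
     (\<forall>R. comm_superalgebra R \<longrightarrow>
        (\<forall>v\<in>gram_open E0 E1 m q R. \<Delta> R v \<otimes>\<^bsub>R\<^esub> \<Delta> R v = gram E0 E1 m q R v)) \<and>
     (\<forall>R. comm_superalgebra R \<longrightarrow>
        (\<forall>v\<in>rd_points (gram_open E0 E1 m q) (power_act E0 E1 m) R.
           \<Delta> R v = volume_extension E0 m vol R v))"

end

theory Submission
  imports Defs "HOL-Library.Poly_Mapping" "HOL-Library.Multiset" "HOL-Algebra.RingHom"
begin

text \<open>
  Write a point of \<open>\<^bold>V\<^sup>m\<close> as a pair \<open>(X, \<theta>)\<close> of an even \<open>m \<times> m\<close> matrix and an odd \<open>m \<times> 2n\<close> matrix. The
  Gram matrix is \<open>X Q X\<^sup>T + \<theta> J \<theta>\<^sup>T\<close>, so that \<open>det X\<close> is invertible on \<open>U\<close>; with \<open>\<theta> = X Y\<close> one gets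
  \<open>D = (det X)\<^sup>2 det (Q + Y J Y\<^sup>T)\<close>. The second factor is \<open>det Q\<close> times \<open>1 +\<close> a nilpotent polynomial in
  \<open>Y\<close>, hence \<open>\<Delta> = c det X s(Y)\<close> for a constant \<open>c\<close> and a polynomial \<open>s\<close> with \<open>s(0) = 1\<close>: both sides
  square to \<open>D\<close>, and they agree modulo nilpotent and odd elements, that is, after passing to the
  quotient of \<open>R\<close> by these, which yields a point of \<open>U\<^sub>r\<^sub>d\<close>.

  By Cramer's rule \<open>det X\<close> times a product of any number of entries of a single column of \<open>Y\<close> is a
  polynomial in \<open>X\<close> and \<open>\<theta>\<close>, because the minors of \<open>X\<^sup>-\<^sup>1\<close> have only \<open>det X\<close> as denominator. As \<open>Y\<close>
  has \<open>2n\<close> columns, \<open>(det X)\<^sup>2\<^sup>n\<close> times any polynomial in \<open>Y\<close> is a polynomial in \<open>X\<close> and \<open>\<theta>\<close>; this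
  applies to \<open>\<Delta>\<^sup>2\<^sup>n\<^sup>+\<^sup>1 = c\<^sup>2\<^sup>n\<^sup>+\<^sup>1 det X (det X)\<^sup>2\<^sup>n s(Y)\<^sup>2\<^sup>n\<^sup>+\<^sup>1\<close>.
\<close>

section \<open>Commutative super algebras\<close>

text \<open>The extension must be one rule for all R at once, while Y and the inverse of det X exist
  only over a given R, at a point of U. Hence every formula is an element of a free algebra over the
  complex numbers, chosen before R, and only its evaluation mentions R; functoriality is then
  automatic, since homomorphisms commute with evaluation. Words are needed because odd coordinates
  do not commute. Determinants have even entries, so their identities can be evaluated from
  polynomials in commuting variables. A formal square root s exists because Y has finitely many
  entries: a word in odd letters longer than their number repeats a letter and is zero, so a
  truncated series for the square root of 1 + x gives an exact root. \<Delta> itself is given only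
  by its square and its values on reduced points. That determines it over every R: two square roots
  that agree modulo nilpotent and odd elements, one of them even and invertible, are equal, because
  2 is invertible.\<close>

context comm_superalgebra
begin

lemma even_closed: "a \<in> even_part R \<Longrightarrow> a \<in> carrier R"
  using additive_subgroup.a_subset[OF even_subgroup] by blast

lemma odd_closed: "a \<in> odd_part R \<Longrightarrow> a \<in> carrier R"
  using additive_subgroup.a_subset[OF odd_subgroup] by blast

lemma even_add: "a \<in> even_part R \<Longrightarrow> b \<in> even_part R \<Longrightarrow> a \<oplus> b \<in> even_part R"
  using additive_subgroup.a_closed[OF even_subgroup] .

lemma odd_add: "a \<in> odd_part R \<Longrightarrow> b \<in> odd_part R \<Longrightarrow> a \<oplus> b \<in> odd_part R"
  using additive_subgroup.a_closed[OF odd_subgroup] .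

lemma even_zero: "\<zero> \<in> even_part R"
  using additive_subgroup.zero_closed[OF even_subgroup] .

lemma odd_zero: "\<zero> \<in> odd_part R"
  using additive_subgroup.zero_closed[OF odd_subgroup] .

lemma smult_zero_right: "c \<odot> \<zero> = \<zero>"
proof -
  have "c \<odot> \<zero> \<oplus> c \<odot> \<zero> = c \<odot> \<zero>"
    using smult_add_right[of \<zero> \<zero> c] by simp
  then show ?thesis
    using add.l_cancel_one smult_closed by (metis zero_closed)
qed

lemma smult_zero_left: "a \<in> carrier R \<Longrightarrow> 0 \<odot> a = \<zero>"
proof -
  assume a: "a \<in> carrier R"
  have "0 \<odot> a \<oplus> 0 \<odot> a = 0 \<odot> a"
    using smult_add_left[of a 0 0] a by simp
  then show ?thesis
    using add.l_cancel_one smult_closed a by metis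
qed

lemma smult_minus_one: "a \<in> carrier R \<Longrightarrow> (- 1) \<odot> a = \<ominus> a"
proof -
  assume a: "a \<in> carrier R"
  have "(- 1) \<odot> a \<oplus> a = \<zero>"
    using smult_add_left[of a "-1" 1] a by (simp add: smult_one smult_zero_left)
  then show ?thesis
    using a by (simp add: minus_equality smult_closed)
qed

lemma smult_finsum:
  "f \<in> A \<rightarrow> carrier R \<Longrightarrow> c \<odot> (\<Oplus>x\<in>A. f x) = (\<Oplus>x\<in>A. c \<odot> f x)"
proof (induction A rule: infinite_finite_induct)
  case (insert x F)
  then show ?case
    by (simp add: Pi_def smult_add_right smult_closed)
qed (auto simp: smult_zero_right)

lemma even_finsum: "f \<in> A \<rightarrow> even_part R \<Longrightarrow> (\<Oplus>x\<in>A. f x) \<in> even_part R"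
proof (induction A rule: infinite_finite_induct)
  case (insert x F)
  then show ?case
    by (auto simp: Pi_def even_closed even_add)
qed (auto simp: even_zero)

lemma odd_finsum: "f \<in> A \<rightarrow> odd_part R \<Longrightarrow> (\<Oplus>x\<in>A. f x) \<in> odd_part R"
proof (induction A rule: infinite_finite_induct)
  case (insert x F)
  then show ?case
    by (auto simp: Pi_def odd_closed odd_add)
qed (auto simp: odd_zero)

lemma even_uminus: "a \<in> even_part R \<Longrightarrow> \<ominus> a \<in> even_part R"
  using smult_even[of a "-1"] by (simp add: smult_minus_one even_closed)

lemma odd_uminus: "a \<in> odd_part R \<Longrightarrow> \<ominus> a \<in> odd_part R"
  using smult_odd[of a "-1"] by (simp add: smult_minus_one odd_closed)

lemma parity_unique:
  assumes "a \<in> even_part R" "a' \<in> even_part R" "b \<in> odd_part R" "b' \<in> odd_part R"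
    and eq: "a \<oplus> b = a' \<oplus> b'"
  shows "a = a'" "b = b'"
proof -
  note c = assms(1,2)[THEN even_closed] assms(3,4)[THEN odd_closed]
  have "a \<oplus> \<ominus> a' = b' \<oplus> \<ominus> b"
  proof -
    have "a \<oplus> \<ominus> a' = (a \<oplus> b) \<oplus> (\<ominus> b \<oplus> \<ominus> a')"
      using c by (simp add: a_assoc r_neg2)
    also have "\<dots> = (a' \<oplus> \<ominus> a') \<oplus> (b' \<oplus> \<ominus> b)"
      unfolding eq using c by (simp add: a_ac)
    also have "\<dots> = b' \<oplus> \<ominus> b"
      using c by (simp add: r_neg)
    finally show ?thesis .
  qed
  moreover have "a \<oplus> \<ominus> a' \<in> even_part R" "b' \<oplus> \<ominus> b \<in> odd_part R"
    using assms by (simp_all add: even_add even_uminus odd_add odd_uminus)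
  ultimately have "a \<oplus> \<ominus> a' = \<zero>"
    using even_odd_inter by auto
  then show "a = a'"
    using c by (metis minus_equality minus_minus a_inv_closed)
  then show "b = b'"
    using eq c by simp
qed

end

section \<open>Evaluation of monoid algebras\<close>

text \<open>The linear extension of \<open>\<mu>\<close> to the monoid algebra. \<open>p\<close>
  does not mention \<open>R\<close>, so a single \<open>p\<close> can be evaluated in all super
  algebras.\<close>

definition alg_eval :: "'a superalg \<Rightarrow> ('m \<Rightarrow> 'a) \<Rightarrow> ('m \<Rightarrow>\<^sub>0 complex) \<Rightarrow> 'a" where
  "alg_eval R \<mu> p =
     (\<Oplus>\<^bsub>R\<^esub>m\<in>Poly_Mapping.keys p. Poly_Mapping.lookup p m \<odot>\<^bsub>R\<^esub> \<mu> m)"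

abbreviation const :: "complex \<Rightarrow> 'm::zero \<Rightarrow>\<^sub>0 complex" where
  "const c \<equiv> Poly_Mapping.single 0 c"

text \<open>Two monoids will be used: words, for products with odd factors, and multisets, for
  products of even factors. The monoid is written additively but need not be commutative.\<close>

locale monoid_eval = comm_superalgebra R for R :: "'a superalg" (structure) +
  fixes \<mu> :: "'m::monoid_add \<Rightarrow> 'a"
  assumes mu_closed [simp]: "\<mu> x \<in> carrier R"
    and mu_zero [simp]: "\<mu> 0 = \<one>"
    and mu_plus: "\<mu> (x + y) = \<mu> x \<otimes> \<mu> y"
begin

abbreviation ev :: "('m \<Rightarrow>\<^sub>0 complex) \<Rightarrow> 'a" where
  "ev \<equiv> alg_eval R \<mu>"

lemma ev_closed [simp]: "ev p \<in> carrier R"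
  unfolding alg_eval_def by (intro finsum_closed) (auto simp: smult_closed)

lemma ev_superset:
  assumes "finite A" "Poly_Mapping.keys p \<subseteq> A"
  shows "ev p = (\<Oplus>m\<in>A. Poly_Mapping.lookup p m \<odot> \<mu> m)"
  unfolding alg_eval_def using assms
  by (intro add.finprod_mono_neutral_cong_left)
     (auto simp: smult_closed smult_zero_left in_keys_iff)

lemma ev_zero [simp]: "ev 0 = \<zero>"
  by (simp add: alg_eval_def)

lemma ev_single [simp]: "ev (Poly_Mapping.single m c) = c \<odot> \<mu> m"
  by (subst ev_superset[of "{m}"]) (auto simp: smult_closed)

lemma ev_add [simp]: "ev (p + q) = ev p \<oplus> ev q"
proof -
  let ?A = "Poly_Mapping.keys p \<union> Poly_Mapping.keys q"
  have "ev (p + q) = (\<Oplus>m\<in>?A. Poly_Mapping.lookup (p + q) m \<odot> \<mu> m)"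
    using keys_add[of p q] by (intro ev_superset) auto
  also have "\<dots> = (\<Oplus>m\<in>?A. Poly_Mapping.lookup p m \<odot> \<mu> m \<oplus> Poly_Mapping.lookup q m \<odot> \<mu> m)"
    by (simp add: lookup_add smult_add_left)
  also have "\<dots> = (\<Oplus>m\<in>?A. Poly_Mapping.lookup p m \<odot> \<mu> m) \<oplus> (\<Oplus>m\<in>?A. Poly_Mapping.lookup q m \<odot> \<mu> m)"
    by (intro finsum_addf) (auto simp: smult_closed)
  also have "\<dots> = ev p \<oplus> ev q"
    by (simp add: ev_superset[of ?A])
  finally show ?thesis .
qed

lemma ev_sum: "ev (\<Sum>x\<in>A. f x) = (\<Oplus>x\<in>A. ev (f x))"
  by (induction A rule: infinite_finite_induct) auto

end

text \<open>Updating at a new key is the addition of a monomial. No condition on the support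
  survives in the induction step, so additive statements reduce to monomials.\<close>

lemma poly_mapping_add_induct [case_names zero add]:
  fixes p :: "'m \<Rightarrow>\<^sub>0 'c::comm_monoid_add"
  assumes "P 0" and "\<And>m c p. P p \<Longrightarrow> P (Poly_Mapping.single m c + p)"
  shows "P p"
proof (induction p rule: update_induct)
  case const
  show ?case by (fact assms(1))
next
  case (update f a b)
  have "Poly_Mapping.update a b f = Poly_Mapping.single a b + f"
    using update.hyps
    by (intro poly_mapping_eqI) (auto simp: lookup_update lookup_add lookup_single in_keys_iff when_def)
  then show ?case using assms(2)[OF update.IH] by simp
qed

context monoid_eval
begin

lemma ev_mult [simp]: "ev (p * q) = ev p \<otimes> ev q"
proof (induction p rule: poly_mapping_add_induct)
  case (add m c p)
  have "ev (Poly_Mapping.single m c * q) = (c \<odot> \<mu> m) \<otimes> ev q"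
  proof (induction q rule: poly_mapping_add_induct)
    case (add k d q)
    then show ?case
      by (simp add: algebra_simps mult_single mu_plus r_distr smult_closed smult_mult_left
          smult_mult_right flip: smult_smult)
  qed (simp add: smult_closed)
  with add show ?case
    by (simp add: algebra_simps l_distr smult_closed)
qed simp

lemma ev_one [simp]: "ev 1 = \<one>"
  using ev_single[of 0 1] by (simp add: smult_one)

lemma ev_const: "ev (const c) = c \<odot> \<one>"
  by simp

lemma ev_const_mult [simp]: "ev (const c * p) = c \<odot> ev p"
  by (simp add: smult_mult_left)

lemma ev_uminus [simp]: "ev (- p) = \<ominus> ev p"
proof -
  have "ev (- p) \<oplus> ev p = ev (- p + p)"
    by (simp only: ev_add)
  then show ?thesis
    by (simp add: minus_equality)
qed

lemma ev_diff [simp]: "ev (p - q) = ev p \<ominus> ev q"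
  unfolding diff_conv_add_uminus ev_add ev_uminus by (simp add: a_minus_def)

lemma ev_power [simp]: "ev (p ^ k) = ev p [^] k"
  by (induction k) (simp_all del: power_Suc add: power_Suc2)

end

text \<open>Lists under concatenation form the free monoid, written additively because \<open>poly_mapping\<close>
  takes its exponents from an additive monoid; the associated monoid algebra is the free algebra.\<close>

instantiation list :: (type) monoid_add
begin

definition zero_list :: "'a list" where "0 = []"

definition plus_list :: "'a list \<Rightarrow> 'a list \<Rightarrow> 'a list" where "xs + ys = xs @ ys"

instance
  by standard (simp_all add: zero_list_def plus_list_def)

end

section \<open>Ordered products and formal determinants\<close>

lemma permutes_less_iff: "p permutes {..<m} \<Longrightarrow> p i < m \<longleftrightarrow> i < (m :: nat)"
  using permutes_in_image[of p "{..<m}" i] by simp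

text \<open>An ordered product: \<open>R\<close> is not commutative, so the order of odd factors has
  to be recorded by a list.\<close>

definition mprod :: "'a superalg \<Rightarrow> 'a list \<Rightarrow> 'a" where
  "mprod R xs = foldr (\<otimes>\<^bsub>R\<^esub>) xs \<one>\<^bsub>R\<^esub>"

definition word_val :: "'a superalg \<Rightarrow> ('l \<Rightarrow> 'a) \<Rightarrow> 'l list \<Rightarrow> 'a" where
  "word_val R \<rho> w = mprod R (map \<rho> w)"

abbreviation letter :: "'l \<Rightarrow> 'l list \<Rightarrow>\<^sub>0 complex" where
  "letter l \<equiv> Poly_Mapping.single [l] 1"

context comm_superalgebra
begin

lemma mprod_Nil [simp]: "mprod R [] = \<one>"
  and mprod_Cons [simp]: "mprod R (x # xs) = x \<otimes> mprod R xs"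
  by (simp_all add: mprod_def)

lemma mprod_closed: "set xs \<subseteq> carrier R \<Longrightarrow> mprod R xs \<in> carrier R"
  by (induction xs) auto

lemma mprod_append:
  "set xs \<subseteq> carrier R \<Longrightarrow> set ys \<subseteq> carrier R \<Longrightarrow> mprod R (xs @ ys) = mprod R xs \<otimes> mprod R ys"
  by (induction xs) (auto simp: mprod_closed m_assoc)

lemma mprod_even: "set xs \<subseteq> even_part R \<Longrightarrow> mprod R xs \<in> even_part R"
  by (induction xs) (auto simp: one_even even_even)

lemma comm_monoid_even_ring: "comm_monoid (even_ring R)"
  by unfold_locales
     (auto simp: even_ring_def even_even one_even m_assoc even_closed intro: even_comm)

text \<open>Connects the products of even elements in the definitions with ordered products, which
  can be combined with odd factors.\<close>

lemma finprod_even_ring: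
  assumes "\<And>i. i < m \<Longrightarrow> f i \<in> even_part R"
  shows "(\<Otimes>\<^bsub>even_ring R\<^esub>i\<in>{..<m}. f i) = mprod R (map f [0..<m])"
  using assms
proof (induction m)
  case 0
  interpret E: comm_monoid "even_ring R" by (rule comm_monoid_even_ring)
  show ?case using E.finprod_empty[of f] by (simp add: even_ring_def)
next
  case (Suc m)
  interpret E: comm_monoid "even_ring R" by (rule comm_monoid_even_ring)
  have f: "set (map f [0..<m]) \<subseteq> even_part R"
    using Suc.prems by auto
  have c: "carrier (even_ring R) = even_part R" "mult (even_ring R) = mult R"
    by (simp_all add: even_ring_def)
  have "(\<Otimes>\<^bsub>even_ring R\<^esub>i\<in>{..<Suc m}. f i) = f m \<otimes> (\<Otimes>\<^bsub>even_ring R\<^esub>i\<in>{..<m}. f i)"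
    using Suc.prems by (simp add: lessThan_Suc c Pi_def)
  also have "\<dots> = f m \<otimes> mprod R (map f [0..<m])"
    using Suc by simp
  also have "\<dots> = mprod R (map f [0..<m]) \<otimes> f m"
    using Suc.prems f by (intro even_comm even_closed mprod_even) auto
  also have "\<dots> = mprod R (map f [0..<Suc m])"
    using Suc.prems f by (auto simp: mprod_append even_closed subset_iff)
  finally show ?case .
qed

lemma super_det_mprod:
  assumes "\<And>i j. i < m \<Longrightarrow> j < m \<Longrightarrow> A i j \<in> even_part R"
  shows "super_det R m A =
    (\<Oplus>p\<in>{p. p permutes {..<m}}. of_int (sign p) \<odot> mprod R (map (\<lambda>i. A i (p i)) [0..<m]))"
proof -
  have "p i < m" if "p permutes {..<m}" "i < m" for p i
    using that by (simp add: permutes_less_iff)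
  then show ?thesis
    unfolding super_det_def using assms
    by (intro finsum_cong')
       (auto simp: finprod_even_ring intro!: smult_even mprod_even even_closed)
qed

lemma super_det_even:
  assumes "\<And>i j. i < m \<Longrightarrow> j < m \<Longrightarrow> A i j \<in> even_part R"
  shows "super_det R m A \<in> even_part R"
proof -
  have "p i < m" if "p permutes {..<m}" "i < m" for p i
    using that by (simp add: permutes_less_iff)
  moreover have "super_det R m A = (\<Oplus>p\<in>{p. p permutes {..<m}}.
      of_int (sign p) \<odot> mprod R (map (\<lambda>i. A i (p i)) [0..<m]))"
    by (rule super_det_mprod) (rule assms)
  ultimately show ?thesis
    using assms by (auto intro!: even_finsum smult_even mprod_even)
qed

lemma super_det_cong:
  assumes "\<And>i j. i < m \<Longrightarrow> j < m \<Longrightarrow> A i j = B i j"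
    and "\<And>i j. i < m \<Longrightarrow> j < m \<Longrightarrow> A i j \<in> even_part R"
  shows "super_det R m A = super_det R m B"
proof -
  have p: "p i < m" if "p permutes {..<m}" "i < m" for p i
    using that by (simp add: permutes_less_iff)
  have B: "B i j \<in> even_part R" if "i < m" "j < m" for i j
    using assms that by metis
  have "mprod R (map (\<lambda>i. A i (p i)) [0..<m]) = mprod R (map (\<lambda>i. B i (p i)) [0..<m])"
    if "p permutes {..<m}" for p
    using assms(1) p[OF that] by (intro arg_cong[of _ _ "mprod R"]) auto
  then show ?thesis
    using p B assms(2)
    by (subst (1 2) super_det_mprod)
       (auto intro!: finsum_cong' smult_even mprod_even even_closed)
qed

end

text \<open>The Leibniz formula with factors in row order, so that it makes sense over the
  noncommutative word algebra; for commuting exponents it is the usual determinant.\<close>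

definition alg_det :: "nat \<Rightarrow> (nat \<Rightarrow> nat \<Rightarrow> 'm \<Rightarrow>\<^sub>0 complex) \<Rightarrow> 'm::monoid_add \<Rightarrow>\<^sub>0 complex" where
  "alg_det m a = (\<Sum>p | p permutes {..<m}.
     const (of_int (sign p)) * prod_list (map (\<lambda>i. a i (p i)) [0..<m]))"

lemma alg_det_eq_det:
  fixes a :: "nat \<Rightarrow> nat \<Rightarrow> 'm::comm_monoid_add \<Rightarrow>\<^sub>0 complex"
  shows "alg_det m a = det (mat m m (\<lambda>(i, j). a i j))"
proof -
  have p: "p i < m" if "p permutes {..<m}" "i < m" for p i
    using that by (simp add: permutes_less_iff)
  have "const (of_int (sign p)) = (signof p :: 'm \<Rightarrow>\<^sub>0 complex)" for p :: "nat \<Rightarrow> nat"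
    by (simp add: sign_def single_uminus)
  moreover have "prod_list (map (\<lambda>i. a i (p i)) [0..<m]) =
      (\<Prod>i = 0..<m. mat m m (\<lambda>(i, j). a i j) $$ (i, p i))" if "p permutes {..<m}" for p
    using p[OF that] by (simp flip: prod.distinct_set_conv_list)
  ultimately show ?thesis
    by (simp add: alg_det_def det_def atLeast0LessThan)
qed

context monoid_eval
begin

lemma ev_prod_list: "ev (prod_list ps) = mprod R (map ev ps)"
  by (induction ps) auto

text \<open>Only the values of the entries have to be even; the formal entries need not commute.
  This is what allows the matrix Q + Y J Y^T to be written in odd letters.\<close>

lemma ev_alg_det:
  assumes "\<And>i j. i < m \<Longrightarrow> j < m \<Longrightarrow> ev (a i j) \<in> even_part R"
  shows "ev (alg_det m a) = super_det R m (\<lambda>i j. ev (a i j))"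
  by (simp add: alg_det_def super_det_mprod assms ev_sum ev_prod_list o_def
      del: single_of_int ev_mult)

text \<open>All monomials except the constant one evaluate into the ideal. With the radical as
  \<open>J\<close> and odd letters this gives that s(Y) is congruent to s(0).\<close>

lemma ev_ideal:
  assumes J: "ideal J R" and smult_J: "\<And>c x. x \<in> J \<Longrightarrow> c \<odot> x \<in> J"
    and \<mu>: "\<And>m. m \<noteq> 0 \<Longrightarrow> \<mu> m \<in> J"
  shows "ev p \<ominus> Poly_Mapping.lookup p 0 \<odot> \<one> \<in> J"
proof -
  interpret ideal J R by (fact J)
  define p' where "p' = p - const (Poly_Mapping.lookup p 0)"
  have "Poly_Mapping.lookup p' 0 = 0"
    by (simp add: p'_def lookup_minus)
  then have "0 \<notin> Poly_Mapping.keys p'"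
    by (simp add: in_keys_iff)
  have fin: "finsum R f A \<in> J" if "\<And>x. x \<in> A \<Longrightarrow> f x \<in> J" for f and A :: "'b set"
    using that
  proof (induction A rule: infinite_finite_induct)
    case (insert x F)
    then show ?case by (subst finsum_insert) (auto intro!: a_Hcarr)
  qed auto
  have "ev p' \<in> J"
    unfolding alg_eval_def using \<open>0 \<notin> _\<close> by (intro fin smult_J \<mu>) auto
  then show ?thesis
    by (simp add: p'_def ev_const mu_zero)
qed

end

locale word_eval = comm_superalgebra R for R :: "'a superalg" (structure) +
  fixes \<rho> :: "'l \<Rightarrow> 'a"
  assumes letter_closed [simp]: "\<rho> l \<in> carrier R"
begin

sublocale monoid_eval R "word_val R \<rho>"
proof
  show "word_val R \<rho> x \<in> carrier R" for x
    by (auto simp: word_val_def intro!: mprod_closed)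
  show "word_val R \<rho> 0 = \<one>"
    by (simp add: word_val_def zero_list_def)
  show "word_val R \<rho> (x + y) = word_val R \<rho> x \<otimes> word_val R \<rho> y" for x y
    by (auto simp: word_val_def plus_list_def intro!: mprod_append)
qed

lemma word_val_Nil [simp]: "word_val R \<rho> [] = \<one>"
  and word_val_Cons [simp]: "word_val R \<rho> (l # w) = \<rho> l \<otimes> word_val R \<rho> w"
  by (simp_all add: word_val_def)

lemma word_val_append [simp]: "word_val R \<rho> (u @ w) = word_val R \<rho> u \<otimes> word_val R \<rho> w"
  using mu_plus[of u w] by (simp add: plus_list_def)

lemma ev_letter [simp]: "ev (letter l) = \<rho> l"
  by (simp add: smult_one)

end

lemma superalg_homD:
  assumes "h \<in> superalg_hom R S"
  shows "h \<in> ring_hom R S" "a \<in> carrier R \<Longrightarrow> h (c \<odot>\<^bsub>R\<^esub> a) = c \<odot>\<^bsub>S\<^esub> h a"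
    "a \<in> even_part R \<Longrightarrow> h a \<in> even_part S" "a \<in> odd_part R \<Longrightarrow> h a \<in> odd_part S"
  using assms by (auto simp: superalg_hom_def)

text \<open>The source of functoriality: any rule given by evaluating a fixed element of the free
  algebra commutes with homomorphisms.\<close>

lemma word_eval_natural:
  assumes R: "comm_superalgebra R" and S: "comm_superalgebra S" and h: "h \<in> superalg_hom R S"
    and \<rho>: "\<And>l. \<rho> l \<in> carrier R"
  shows "h (alg_eval R (word_val R \<rho>) p) = alg_eval S (word_val S (\<lambda>l. h (\<rho> l))) p"
proof -
  note hom = superalg_homD[OF h]
  interpret R: word_eval R \<rho>
    using R \<rho> by (simp add: word_eval_def word_eval_axioms_def)
  interpret S: word_eval S "\<lambda>l. h (\<rho> l)"
    using S \<rho> ring_hom_closed[OF hom(1)] by (simp add: word_eval_def word_eval_axioms_def)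
  interpret h: ring_hom_ring R S h
    by (rule ring_hom_ringI2) (fact R.ring_axioms S.ring_axioms hom(1))+
  have word: "h (word_val R \<rho> w) = word_val S (\<lambda>l. h (\<rho> l)) w" for w
    by (induction w) simp_all
  show ?thesis
  proof (induction p rule: poly_mapping_add_induct)
    case (add w c p)
    then show ?case by (simp add: hom(2) word R.smult_closed)
  qed simp
qed

section \<open>The even part as an image of a polynomial ring\<close>

context comm_superalgebra
begin

text \<open>The guards make the folded function left-commutative on all arguments, including those
  outside the even part, as a fold over multisets requires. Letters that are not even count as
  \<open>\<one>\<close>.\<close>

definition cval :: "'a multiset \<Rightarrow> 'a" where
  "cval M = fold_mset (\<lambda>x a. (if x \<in> even_part R then x else \<one>) \<otimes>
     (if a \<in> even_part R then a else \<one>)) \<one> M"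

lemma cval_empty: "cval {#} = \<one>"
  by (simp add: cval_def)

lemma cval_even_add_mset:
  "cval M \<in> even_part R \<and> cval (add_mset x M) = (if x \<in> even_part R then x else \<one>) \<otimes> cval M"
proof -
  have lcomm: "a \<otimes> (b \<otimes> c) = b \<otimes> (a \<otimes> c)"
    if "a \<in> even_part R" "b \<in> even_part R" "c \<in> even_part R" for a b c
    using that even_comm[of a b] by (simp add: even_closed flip: m_assoc)
  interpret comp_fun_commute "\<lambda>x a. (if x \<in> even_part R then x else \<one>) \<otimes>
     (if a \<in> even_part R then a else \<one>)"
    by unfold_locales
       (auto simp: fun_eq_iff one_even even_even even_closed
         intro: lcomm even_comm)
  have even: "cval M \<in> even_part R" for M
    by (induction M) (auto simp: cval_def one_even even_even)
  show ?thesis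
    using even[of M] by (simp add: cval_def)
qed

lemma cval_add: "cval (M + N) = cval M \<otimes> cval N"
  using cval_even_add_mset
  by (induction M) (auto simp: cval_empty even_closed m_assoc one_even)

text \<open>The even part of a super algebra is a quotient of a polynomial ring, which is a genuine type
  of class \<open>comm_ring_1\<close>; this makes the library of determinants available.\<close>

sublocale cev: monoid_eval R cval
  by unfold_locales (use cval_even_add_mset in \<open>auto simp: cval_empty cval_add even_closed\<close>)

abbreviation cvar :: "'a \<Rightarrow> 'a multiset \<Rightarrow>\<^sub>0 complex" where
  "cvar a \<equiv> Poly_Mapping.single {#a#} 1"

lemma cev_even: "cev.ev p \<in> even_part R"
  unfolding alg_eval_def using cval_even_add_mset by (intro even_finsum) (auto intro!: smult_even)

lemma cev_var [simp]: "a \<in> even_part R \<Longrightarrow> cev.ev (cvar a) = a"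
  using cval_even_add_mset[of "{#}" a] by (simp add: cval_empty smult_one even_closed)

declare cev.ev_single [simp del]

text \<open>The transfer principle for determinants: an identity in the polynomial ring becomes,
  after evaluation, an identity for \<open>super_det\<close>.\<close>

lemma cev_det: "cev.ev (det (mat m m (\<lambda>(i, j). a i j))) = super_det R m (\<lambda>i j. cev.ev (a i j))"
  using cev.ev_alg_det[of m a] by (simp add: alg_det_eq_det cev_even)

section \<open>Even nilpotents and the radical\<close>

definition even_nil :: "'a set" where
  "even_nil = {a \<in> even_part R. \<exists>k::nat. a [^] k = \<zero>}"

lemma even_nilI: "a \<in> even_part R \<Longrightarrow> a [^] (k::nat) = \<zero> \<Longrightarrow> a \<in> even_nil"
  by (auto simp: even_nil_def)

lemma even_nilD: "a \<in> even_nil \<Longrightarrow> a \<in> even_part R"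
  by (simp add: even_nil_def)

lemma even_nil_zero: "\<zero> \<in> even_nil"
  by (rule even_nilI[of _ 1]) (auto simp: even_zero)

lemma cev_power_zero: "cev.ev p [^] k = \<zero> \<Longrightarrow> k \<le> i \<Longrightarrow> cev.ev (p ^ i) = \<zero>"
  using cev.ev_mult[of "p ^ k" "p ^ (i - k)"] by (simp flip: power_add)

text \<open>In the binomial expansion with exponent \<open>k + l\<close>, each term contains at
  least the \<open>k\<close>-th power of \<open>a\<close> or at least the \<open>l\<close>-th power
  of \<open>b\<close>.\<close>

lemma even_nil_add:
  assumes "a \<in> even_nil" "b \<in> even_nil"
  shows "a \<oplus> b \<in> even_nil"
proof -
  obtain k l :: nat where k: "a [^] k = \<zero>" and l: "b [^] l = \<zero>"
    and even: "a \<in> even_part R" "b \<in> even_part R"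
    using assms by (auto simp: even_nil_def)
  let ?p = "cvar a" and ?q = "cvar b"
  have "cev.ev (of_nat ((k + l) choose i) * ?p ^ i * ?q ^ (k + l - i)) = \<zero>" for i
  proof (cases "k \<le> i")
    case True
    then have "cev.ev (?p ^ i) = \<zero>"
      using k even by (intro cev_power_zero) auto
    then show ?thesis by (simp del: cev.ev_power)
  next
    case False
    then have "cev.ev (?q ^ (k + l - i)) = \<zero>"
      using l even by (intro cev_power_zero[of _ l]) auto
    then show ?thesis by (simp del: cev.ev_power)
  qed
  then have "cev.ev ((?p + ?q) ^ (k + l)) = \<zero>"
    unfolding binomial_ring cev.ev_sum by (simp del: cev.ev_mult cev.ev_power)
  then have "(a \<oplus> b) [^] (k + l) = \<zero>"
    using even by simp
  then show ?thesis
    using even by (intro even_nilI even_add)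
qed

lemma even_nil_mult:
  assumes "a \<in> even_part R" "b \<in> even_nil"
  shows "a \<otimes> b \<in> even_nil"
proof -
  obtain k :: nat where k: "b [^] k = \<zero>" and even: "b \<in> even_part R"
    using assms by (auto simp: even_nil_def)
  have "cev.ev ((cvar a * cvar b) ^ k) = \<zero>"
    unfolding power_mult_distrib using k even by simp
  then have "(a \<otimes> b) [^] k = \<zero>"
    using even assms by simp
  then show ?thesis
    using even assms by (intro even_nilI even_even)
qed

lemma even_nil_smult: "a \<in> even_nil \<Longrightarrow> c \<odot> a \<in> even_nil"
  using even_nil_mult[of "c \<odot> \<one>" a]
  by (simp add: smult_mult_left smult_even one_even even_nilD even_closed)

lemma odd_odd_nil:
  assumes "a \<in> odd_part R" "b \<in> odd_part R"
  shows "a \<otimes> b \<in> even_nil"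
proof (rule even_nilI)
  show "a \<otimes> b \<in> even_part R"
    using assms by (rule odd_odd)
  note c = assms[THEN odd_closed]
  have "(a \<otimes> b) \<otimes> (a \<otimes> b) = a \<otimes> (b \<otimes> a) \<otimes> b"
    using c by (simp add: m_assoc)
  also have "\<dots> = a \<otimes> (\<ominus> (a \<otimes> b)) \<otimes> b"
    using odd_anticomm[OF assms(2,1)] by simp
  also have "\<dots> = \<ominus> ((a \<otimes> a) \<otimes> (b \<otimes> b))"
    using c by (simp add: r_minus l_minus m_assoc)
  also have "\<dots> = \<zero>"
    using assms c by (simp add: odd_square)
  finally show "(a \<otimes> b) [^] (2::nat) = \<zero>"
    using c by (simp add: numeral_2_eq_2)
qed

text \<open>The inverse is the geometric series, which stops at the order of nilpotency.\<close>

lemma even_nil_unit: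
  assumes "a \<in> even_nil"
  shows "\<exists>u\<in>even_part R. (\<one> \<ominus> a) \<otimes> u = \<one>"
proof -
  obtain k :: nat where k: "a [^] k = \<zero>" and even: "a \<in> even_part R"
    using assms by (auto simp: even_nil_def)
  let ?u = "\<Sum>i<k. cvar a ^ i"
  have "cev.ev ((1 - cvar a) * ?u) = cev.ev (1 - cvar a ^ k)"
    by (simp only: one_diff_power_eq)
  then have "(\<one> \<ominus> a) \<otimes> cev.ev ?u = \<one>"
    using k even by (simp add: a_minus_def)
  then show ?thesis
    using cev_even by blast
qed

text \<open>Dividing by it yields an ordinary ring: odd elements are included entirely, and the
  product of two of them is already an even nilpotent. Points of U over the quotient therefore lie
  in U_rd.\<close>

definition super_radical :: "'a set" where
  "super_radical = {t \<oplus> u | t u. t \<in> even_nil \<and> u \<in> odd_part R}"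

lemma super_radicalI: "t \<in> even_nil \<Longrightarrow> u \<in> odd_part R \<Longrightarrow> t \<oplus> u \<in> super_radical"
  by (auto simp: super_radical_def)

lemma super_radicalE:
  assumes "a \<in> super_radical"
  obtains t u where "a = t \<oplus> u" "t \<in> even_nil" "u \<in> odd_part R"
  using assms by (auto simp: super_radical_def)

lemma odd_super_radical: "a \<in> odd_part R \<Longrightarrow> a \<in> super_radical"
  using super_radicalI[OF even_nil_zero, of a] by (simp add: odd_closed)

lemma super_radical_smult: "a \<in> super_radical \<Longrightarrow> c \<odot> a \<in> super_radical"
  by (elim super_radicalE)
     (auto simp: smult_add_right even_nilD even_closed odd_closed
       intro!: super_radicalI even_nil_smult smult_odd)

lemma super_radical_mult:
  assumes a: "a \<in> super_radical" and x: "x \<in> carrier R"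
  shows "a \<otimes> x \<in> super_radical" "x \<otimes> a \<in> super_radical"
proof -
  obtain t u where a: "a = t \<oplus> u" and t: "t \<in> even_nil" and u: "u \<in> odd_part R"
    using a by (rule super_radicalE)
  obtain e f where x: "x = e \<oplus> f" and e: "e \<in> even_part R" and f: "f \<in> odd_part R"
    using even_odd_sum[OF x] by blast
  note c = t[THEN even_nilD, THEN even_closed] u[THEN odd_closed] e[THEN even_closed] f[THEN odd_closed]
  have "a \<otimes> x = (e \<otimes> t \<oplus> u \<otimes> f) \<oplus> (u \<otimes> e \<oplus> t \<otimes> f)"
    unfolding a x using c even_comm[OF e, of t]
    by (simp add: l_distr r_distr a_ac)
  then show "a \<otimes> x \<in> super_radical"
    using odd_even[OF u e] even_odd[OF even_nilD[OF t] f] odd_odd_nil[OF u f] even_nil_mult[OF e t]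
    by (simp add: super_radicalI even_nil_add odd_add)
  have "x \<otimes> a = (e \<otimes> t \<oplus> f \<otimes> u) \<oplus> (e \<otimes> u \<oplus> f \<otimes> t)"
    unfolding a x using c by (simp add: l_distr r_distr a_ac)
  then show "x \<otimes> a \<in> super_radical"
    using even_odd[OF e u] odd_even[OF f even_nilD[OF t]] odd_odd_nil[OF f u] even_nil_mult[OF e t]
    by (simp add: super_radicalI even_nil_add odd_add)
qed

lemma ideal_super_radical: "ideal super_radical R"
proof (rule idealI)
  show "subgroup super_radical (add_monoid R)"
  proof (rule add.subgroupI)
    show "super_radical \<subseteq> carrier R"
      by (auto elim!: super_radicalE simp: even_nilD even_closed odd_closed)
    show "super_radical \<noteq> {}"
      using odd_super_radical odd_zero by blast
    show "\<ominus> a \<in> super_radical" if "a \<in> super_radical" for a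
      using super_radical_smult[OF that, of "-1"] \<open>super_radical \<subseteq> carrier R\<close> that
      by (auto simp: smult_minus_one)
    show "a \<oplus> b \<in> super_radical" if "a \<in> super_radical" and b_rad: "b \<in> super_radical" for a b
    proof -
      obtain t u where a: "a = t \<oplus> u" and t: "t \<in> even_nil" and u: "u \<in> odd_part R"
        using \<open>a \<in> super_radical\<close> by (rule super_radicalE)
      obtain t' u' where b: "b = t' \<oplus> u'" and t': "t' \<in> even_nil" and u': "u' \<in> odd_part R"
        using b_rad by (rule super_radicalE)
      note c = t[THEN even_nilD, THEN even_closed] u[THEN odd_closed]
        t'[THEN even_nilD, THEN even_closed] u'[THEN odd_closed]
      have "a \<oplus> b = (t \<oplus> t') \<oplus> (u \<oplus> u')"
        unfolding a b using c by (simp add: a_ac)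
      then show ?thesis
        using t u t' u' by (simp add: super_radicalI even_nil_add odd_add)
    qed
  qed
qed (use ring_axioms super_radical_mult in auto)

text \<open>The difference \<open>d = x - y\<close> satisfies \<open>d = z d\<^sup>2\<close> with \<open>z = - 1 / (2 y)\<close>; comparing parities, its even
  part \<open>t\<close> satisfies \<open>t = z t\<^sup>2\<close> and its odd part is a multiple of \<open>t\<close>.\<close>

lemma sqrt_unique:
  assumes x: "x \<in> carrier R" and y: "y \<in> even_part R"
    and v: "v \<in> even_part R" "y \<otimes> v = \<one>"
    and eq: "x \<otimes> x = y \<otimes> y" and rad: "x \<ominus> y \<in> super_radical"
  shows "x = y"
proof -
  obtain t u where d: "x \<ominus> y = t \<oplus> u" and t: "t \<in> even_nil" and u: "u \<in> odd_part R"
    using rad by (rule super_radicalE)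
  note te = even_nilD[OF t]
  note c = x y[THEN even_closed] v(1)[THEN even_closed] te[THEN even_closed] u[THEN odd_closed]
  define z where "z = (- 1 / 2) \<odot> v"
  have z: "z \<in> even_part R" and zc: "z \<in> carrier R"
    using v by (auto simp: z_def smult_even even_closed)
  have x_eq: "x = y \<oplus> (t \<oplus> u)"
    using c by (simp add: a_minus_def a_ac r_neg r_neg2 flip: d)
  have ut: "u \<otimes> t = t \<otimes> u"
    using even_comm[OF te c(5)] by simp
  have yt: "(t \<oplus> u) \<otimes> y = y \<otimes> (t \<oplus> u)"
    using even_comm[OF y, of "t \<oplus> u"] c by simp
  define w where "w = y \<otimes> (t \<oplus> u)"
  have wc: "w \<in> carrier R" using c by (simp add: w_def)
  have sq: "(t \<oplus> u) \<otimes> (t \<oplus> u) = t \<otimes> t \<oplus> 2 \<odot> (t \<otimes> u)"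
  proof -
    have "(t \<oplus> u) \<otimes> (t \<oplus> u) = t \<otimes> t \<oplus> (t \<otimes> u \<oplus> t \<otimes> u)"
      using c by (simp add: l_distr r_distr ut odd_square[OF u] a_ac)
    then show ?thesis
      using smult_add_left[of "t \<otimes> u" 1 1] c by (simp add: smult_one)
  qed
  have "y \<otimes> y = y \<otimes> y \<oplus> (2 \<odot> w \<oplus> (t \<oplus> u) \<otimes> (t \<oplus> u))"
  proof -
    have "x \<otimes> x = y \<otimes> y \<oplus> (w \<oplus> w \<oplus> (t \<oplus> u) \<otimes> (t \<oplus> u))"
      unfolding x_eq using c yt
      by (simp add: l_distr[of y "t \<oplus> u"] r_distr[of y "t \<oplus> u"] r_distr[of _ y "t \<oplus> u"] w_def a_assoc)
    then show ?thesis
      using smult_add_left[of w 1 1] wc eq by (simp add: smult_one)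
  qed
  then have w0: "2 \<odot> w \<oplus> (t \<otimes> t \<oplus> 2 \<odot> (t \<otimes> u)) = \<zero>"
    unfolding sq using c wc by (simp add: smult_closed add.l_cancel_one)
  have "t \<oplus> u = z \<otimes> (t \<otimes> t \<oplus> 2 \<odot> (t \<otimes> u))"
  proof -
    have "t \<otimes> t \<oplus> 2 \<odot> (t \<otimes> u) = \<ominus> (2 \<odot> w)"
      using w0 c wc by (metis add.m_comm minus_equality smult_closed add.m_closed m_closed)
    then have "t \<otimes> t \<oplus> 2 \<odot> (t \<otimes> u) = (- 2) \<odot> w"
      using wc by (simp add: smult_closed flip: smult_minus_one smult_smult)
    moreover have "z \<otimes> ((- 2) \<odot> w) = ((- 1 / 2) * (- 2)) \<odot> (v \<otimes> w)"
      using wc c by (simp add: z_def smult_mult_left smult_mult_right smult_closed flip: smult_smult)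
    ultimately have "z \<otimes> (t \<otimes> t \<oplus> 2 \<odot> (t \<otimes> u)) = v \<otimes> w"
      using wc c by (simp add: smult_one)
    also have "\<dots> = (v \<otimes> y) \<otimes> (t \<oplus> u)"
      using c by (simp add: w_def m_assoc)
    also have "\<dots> = t \<oplus> u"
      using v(2) even_comm[OF v(1), of y] c by simp
    finally show ?thesis by simp
  qed
  also have "\<dots> = z \<otimes> (t \<otimes> t) \<oplus> z \<otimes> (2 \<odot> (t \<otimes> u))"
    using zc c by (simp add: r_distr smult_closed)
  finally have *: "t \<oplus> u = z \<otimes> (t \<otimes> t) \<oplus> z \<otimes> (2 \<odot> (t \<otimes> u))" .
  have t_eq: "t = z \<otimes> (t \<otimes> t)" and u_eq: "u = z \<otimes> (2 \<odot> (t \<otimes> u))"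
    using parity_unique[OF te _ u _ *] z te u
    by (simp_all add: even_even even_odd smult_odd)
  have nil: "(z \<otimes> t) [^] k = \<zero>" if "t [^] k = \<zero>" for k :: nat
  proof -
    have "cev.ev ((cvar z * cvar t) ^ k) = \<zero>"
      unfolding power_mult_distrib using that te z by (simp add: even_closed)
    then show ?thesis
      using te z by simp
  qed
  obtain k :: nat where k: "t [^] k = \<zero>"
    using t by (auto simp: even_nil_def)
  have t_eq': "(z \<otimes> t) \<otimes> t = t"
    by (subst (3) t_eq) (use zc c in \<open>simp add: m_assoc\<close>)
  \<comment> \<open>Iterating t = (z t) t shows t = (z t)^j t, which is zero once j reaches the
    order of nilpotency.\<close>
  have pow: "(z \<otimes> t) [^] j \<otimes> t = t" for j :: nat
  proof (induction j)
    case (Suc j)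
    have "(z \<otimes> t) [^] Suc j \<otimes> t = (z \<otimes> t) [^] j \<otimes> ((z \<otimes> t) \<otimes> t)"
      using zc c by (simp add: m_assoc)
    then show ?case using Suc by (simp only: t_eq')
  qed (use c in simp)
  have "t = \<zero>"
    using pow[of k] nil[OF k] c by simp
  have "u = \<zero>"
    by (subst u_eq) (use \<open>t = \<zero>\<close> zc c in \<open>simp add: smult_zero_right\<close>)
  with \<open>t = \<zero>\<close> show ?thesis
    using x_eq c by simp
qed

end

section \<open>The reduction of a super algebra\<close>

context comm_superalgebra
begin

text \<open>The quotient by the radical is realized on a set of representatives, so that its carrier
  lives in the same type.\<close>

definition rep :: "'a \<Rightarrow> 'a" where
  "rep a = (SOME b. b \<in> carrier R \<and> b \<ominus> a \<in> super_radical)"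

definition reduction :: "'a superalg" where
  "reduction = \<lparr>carrier = rep ` carrier R, mult = (\<lambda>x y. rep (x \<otimes> y)), one = rep \<one>,
     zero = rep \<zero>, add = (\<lambda>x y. rep (x \<oplus> y)), module.smult = (\<lambda>c x. rep (c \<odot> x)),
     even_part = rep ` carrier R, odd_part = {rep \<zero>}\<rparr>"

lemma rep_spec: "a \<in> carrier R \<Longrightarrow> rep a \<in> carrier R \<and> rep a \<ominus> a \<in> super_radical"
  unfolding rep_def
  by (rule someI[of _ a]) (use odd_super_radical[OF odd_zero] in \<open>simp add: a_minus_def r_neg\<close>)

lemma super_radical_add:
  "a \<in> super_radical \<Longrightarrow> b \<in> super_radical \<Longrightarrow> a \<oplus> b \<in> super_radical"
  using additive_subgroup.a_closed[OF ideal.axioms(1)[OF ideal_super_radical]] .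

lemma super_radical_uminus: "a \<in> super_radical \<Longrightarrow> \<ominus> a \<in> super_radical"
  using additive_subgroup.a_inv_closed[OF ideal.axioms(1)[OF ideal_super_radical]] .

lemma rep_eq_iff:
  assumes "a \<in> carrier R" "b \<in> carrier R"
  shows "rep a = rep b \<longleftrightarrow> a \<ominus> b \<in> super_radical"
proof
  assume "rep a = rep b"
  then have "\<ominus> (rep a \<ominus> a) \<oplus> (rep a \<ominus> b) \<in> super_radical"
    using rep_spec assms by (metis super_radical_add super_radical_uminus)
  also have "\<ominus> (rep a \<ominus> a) \<oplus> (rep a \<ominus> b) = a \<ominus> b"
  proof -
    have "\<ominus> (rep a \<ominus> a) = a \<ominus> rep a"
      using rep_spec[OF assms(1)] assms by (simp add: a_minus_def minus_add a_comm)
    then show ?thesis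
      using rep_spec[OF assms(1)] assms by (simp add: a_minus_def a_assoc r_neg1)
  qed
  finally show "a \<ominus> b \<in> super_radical" .
next
  assume ab: "a \<ominus> b \<in> super_radical"
  \<comment> \<open>The predicates inside the two choices agree, so \<open>SOME\<close> returns the
    same representative for both cosets.\<close>
  have "c \<ominus> a \<in> super_radical \<longleftrightarrow> c \<ominus> b \<in> super_radical" if c: "c \<in> carrier R" for c
  proof -
    have "c \<ominus> b = (c \<ominus> a) \<oplus> (a \<ominus> b)"
      using assms c by (simp add: a_minus_def a_assoc r_neg1)
    moreover have "\<ominus> (a \<ominus> b) = b \<ominus> a"
      using assms by (simp add: a_minus_def minus_add a_comm)
    then have "c \<ominus> a = (c \<ominus> b) \<oplus> \<ominus> (a \<ominus> b)"
      using assms c by (simp add: a_minus_def a_assoc r_neg1)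
    ultimately show ?thesis
      using super_radical_add super_radical_uminus ab by metis
  qed
  then show "rep a = rep b"
    unfolding rep_def by meson
qed

lemma rep_rep [simp]: "a \<in> carrier R \<Longrightarrow> rep (rep a) = rep a"
  using rep_spec by (simp add: rep_eq_iff)

lemma rep_closed [simp]: "a \<in> carrier R \<Longrightarrow> rep a \<in> carrier R"
  using rep_spec by simp

lemma rep_add:
  assumes "a \<in> carrier R" "b \<in> carrier R"
  shows "rep (rep a \<oplus> rep b) = rep (a \<oplus> b)"
proof -
  have "(rep a \<oplus> rep b) \<ominus> (a \<oplus> b) = (rep a \<ominus> a) \<oplus> (rep b \<ominus> b)"
    using assms by (simp add: a_minus_def minus_add a_ac)
  then show ?thesis
    using assms rep_spec super_radical_add by (simp add: rep_eq_iff)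
qed

lemma rep_mult:
  assumes "a \<in> carrier R" "b \<in> carrier R"
  shows "rep (rep a \<otimes> rep b) = rep (a \<otimes> b)"
proof -
  have "(rep a \<otimes> rep b) \<ominus> (a \<otimes> b) = (rep a \<ominus> a) \<otimes> rep b \<oplus> a \<otimes> (rep b \<ominus> b)"
    using assms by (simp add: a_minus_def l_distr r_distr l_minus r_minus a_assoc r_neg1)
  then show ?thesis
    using assms rep_spec super_radical_add super_radical_mult by (simp add: rep_eq_iff)
qed

lemma rep_smult:
  assumes "a \<in> carrier R"
  shows "rep (c \<odot> rep a) = rep (c \<odot> a)"
proof -
  have "(c \<odot> rep a) \<ominus> (c \<odot> a) = c \<odot> (rep a \<ominus> a)"
    using assms
    by (simp add: a_minus_def smult_add_right smult_closed mult.commute flip: smult_minus_one smult_smult)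
  then show ?thesis
    using assms rep_spec super_radical_smult by (simp add: rep_eq_iff smult_closed)
qed

lemma reduction_simps:
  "carrier reduction = rep ` carrier R" "even_part reduction = rep ` carrier R"
  "odd_part reduction = {rep \<zero>}" "\<one>\<^bsub>reduction\<^esub> = rep \<one>" "\<zero>\<^bsub>reduction\<^esub> = rep \<zero>"
  "a \<in> carrier R \<Longrightarrow> b \<in> carrier R \<Longrightarrow> rep a \<otimes>\<^bsub>reduction\<^esub> rep b = rep (a \<otimes> b)"
  "a \<in> carrier R \<Longrightarrow> b \<in> carrier R \<Longrightarrow> rep a \<oplus>\<^bsub>reduction\<^esub> rep b = rep (a \<oplus> b)"
  "a \<in> carrier R \<Longrightarrow> c \<odot>\<^bsub>reduction\<^esub> rep a = rep (c \<odot> a)"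
  by (simp_all add: reduction_def rep_mult rep_add rep_smult)

text \<open>Only the even component of a factor survives in the quotient, and even elements are
  central.\<close>

lemma rep_mult_comm:
  assumes "a \<in> carrier R" "b \<in> carrier R"
  shows "rep (a \<otimes> b) = rep (b \<otimes> a)"
proof -
  obtain e f where a: "a = e \<oplus> f" and e: "e \<in> even_part R" and f: "f \<in> odd_part R"
    using even_odd_sum[OF assms(1)] by blast
  have f0: "rep f = rep \<zero>"
    using odd_super_radical[OF f] f by (simp add: rep_eq_iff odd_closed a_minus_def)
  have "rep a = rep e"
    using rep_add[of e f] rep_add[of e \<zero>] e f f0 a by (simp add: even_closed odd_closed)
  then show ?thesis
    using rep_mult[of a b] rep_mult[of e b] rep_mult[of b a] rep_mult[of b e] assms e
      even_comm[OF e, of b] by (simp add: even_closed)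
qed

lemma ring_reduction: "ring reduction"
proof (rule ringI)
  show "abelian_group reduction"
  proof (rule abelian_groupI)
    show "\<exists>y\<in>carrier reduction. y \<oplus>\<^bsub>reduction\<^esub> x = \<zero>\<^bsub>reduction\<^esub>" if x: "x \<in> carrier reduction" for x
    proof -
      obtain a where "a \<in> carrier R" "x = rep a"
        using x by (auto simp: reduction_simps)
      then show ?thesis
        by (intro bexI[of _ "rep (\<ominus> a)"]) (auto simp: reduction_simps l_neg)
    qed
  qed (auto simp: reduction_simps a_ac)
  show "Group.monoid reduction"
    by (rule monoidI) (auto simp: reduction_simps m_assoc)
qed (auto simp: reduction_simps l_distr r_distr)

lemma comm_superalgebra_reduction: "comm_superalgebra reduction"
proof -
  interpret S: ring reduction by (rule ring_reduction)
  have "additive_subgroup (even_part reduction) reduction"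
    "additive_subgroup (odd_part reduction) reduction"
    using S.add.subgroup_self S.add.triv_subgroup
    by (auto simp: reduction_simps intro: additive_subgroup.intro)
  then show ?thesis
    by (intro comm_superalgebra.intro comm_superalgebra_axioms.intro ring_reduction)
       (auto simp: reduction_simps smult_closed smult_add_left smult_add_right smult_smult smult_one
          smult_mult_left smult_mult_right smult_zero_right rep_mult_comm
          S.minus_zero[unfolded reduction_simps(5)])
qed

lemma rep_hom: "rep \<in> superalg_hom R reduction"
  by (auto simp: superalg_hom_def reduction_simps even_closed rep_eq_iff odd_closed a_minus_def
      odd_super_radical intro!: ring_hom_memI)

end

section \<open>Words in odd letters\<close>

locale odd_eval = comm_superalgebra R for R :: "'a superalg" (structure) +
  fixes \<rho> :: "'l \<Rightarrow> 'a"
  assumes letter_odd: "\<rho> l \<in> odd_part R"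
begin

sublocale word_eval
  by unfold_locales (use letter_odd odd_closed in auto)

lemma word_val_comm_odd:
  assumes y: "y \<in> odd_part R"
  shows "word_val R \<rho> w \<otimes> y = (- 1) ^ length w \<odot> (y \<otimes> word_val R \<rho> w)"
proof (induction w)
  case (Cons l w)
  note yc = odd_closed[OF y]
  have "word_val R \<rho> (l # w) \<otimes> y = \<rho> l \<otimes> (word_val R \<rho> w \<otimes> y)"
    using yc by (simp add: m_assoc)
  also have "\<dots> = (- 1) ^ length w \<odot> ((\<rho> l \<otimes> y) \<otimes> word_val R \<rho> w)"
    using yc by (simp add: Cons smult_mult_right m_assoc)
  also have "\<rho> l \<otimes> y = (- 1) \<odot> (y \<otimes> \<rho> l)"
    using odd_anticomm[OF letter_odd[of l] y] yc by (simp add: smult_minus_one)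
  finally show ?case
    using yc by (simp add: smult_mult_left m_assoc mult.commute flip: smult_smult)
qed (use y in \<open>simp add: smult_one odd_closed\<close>)

lemma word_val_not_distinct:
  assumes "\<not> distinct w"
  shows "word_val R \<rho> w = \<zero>"
proof -
  obtain xs ys zs l where w: "w = xs @ [l] @ ys @ [l] @ zs"
    using not_distinct_decomp[OF assms] by blast
  have "\<rho> l \<otimes> (word_val R \<rho> ys \<otimes> \<rho> l) = (- 1) ^ length ys \<odot> ((\<rho> l \<otimes> \<rho> l) \<otimes> word_val R \<rho> ys)"
    using word_val_comm_odd[OF letter_odd, of ys l] by (simp add: smult_mult_right m_assoc)
  also have "\<dots> = \<zero>"
    using odd_square[OF letter_odd] by (simp add: smult_zero_right)
  finally have "\<rho> l \<otimes> (word_val R \<rho> ys \<otimes> \<rho> l) \<otimes> word_val R \<rho> zs = \<zero>"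
    by simp
  then show ?thesis
    unfolding w by (simp add: m_assoc)
qed

text \<open>Moving a letter past \<open>ys\<close> costs the sign \<open>(- 1) ^ length ys\<close>,
  and this happens twice; only the sign from interchanging \<open>a\<close> and \<open>b\<close>
  themselves remains.\<close>

lemma word_val_exchange:
  "word_val R \<rho> (xs @ [a] @ ys @ [b] @ zs) = (- 1) \<odot> word_val R \<rho> (xs @ [b] @ ys @ [a] @ zs)"
proof -
  let ?n = "length ys"
  have "\<rho> a \<otimes> (word_val R \<rho> ys \<otimes> \<rho> b) = (- 1) ^ ?n \<odot> ((\<rho> a \<otimes> \<rho> b) \<otimes> word_val R \<rho> ys)"
    using word_val_comm_odd[OF letter_odd, of ys b] by (simp add: smult_mult_right m_assoc)
  also have "\<rho> a \<otimes> \<rho> b = (- 1) \<odot> (\<rho> b \<otimes> \<rho> a)"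
    using odd_anticomm[OF letter_odd[of a] letter_odd[of b]] by (simp add: smult_minus_one)
  also have "(- 1) ^ ?n \<odot> ((- 1) \<odot> (\<rho> b \<otimes> \<rho> a) \<otimes> word_val R \<rho> ys) =
      (- 1) \<odot> (\<rho> b \<otimes> ((- 1) ^ ?n \<odot> (\<rho> a \<otimes> word_val R \<rho> ys)))"
    by (simp add: smult_mult_left smult_mult_right smult_closed m_assoc mult.commute
        flip: smult_smult)
  also have "(- 1) ^ ?n \<odot> (\<rho> a \<otimes> word_val R \<rho> ys) = word_val R \<rho> ys \<otimes> \<rho> a"
    using word_val_comm_odd[OF letter_odd, of ys a] by simp
  finally have *: "\<rho> a \<otimes> (word_val R \<rho> ys \<otimes> \<rho> b) = (- 1) \<odot> (\<rho> b \<otimes> (word_val R \<rho> ys \<otimes> \<rho> a))" .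
  have "word_val R \<rho> (xs @ [a] @ ys @ [b] @ zs) =
      word_val R \<rho> xs \<otimes> ((\<rho> a \<otimes> (word_val R \<rho> ys \<otimes> \<rho> b)) \<otimes> word_val R \<rho> zs)"
    by (simp add: m_assoc)
  also have "\<dots> = (- 1) \<odot> word_val R \<rho> (xs @ [b] @ ys @ [a] @ zs)"
    unfolding * by (simp add: smult_mult_left smult_mult_right m_assoc)
  finally show ?thesis .
qed

lemma word_val_transpose:
  assumes "distinct w" "a \<in> set w" "b \<in> set w" "a \<noteq> b"
  shows "word_val R \<rho> (map (Transposition.transpose a b) w) = (- 1) \<odot> word_val R \<rho> w"
proof -
  have map_id: "map (Transposition.transpose a b) xs = xs" if "a \<notin> set xs" "b \<notin> set xs" for xs
    using that by (intro map_idI) (auto simp: Transposition.transpose_def)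
  obtain us vs where w: "w = us @ a # vs" "a \<notin> set us"
    using split_list_first[OF assms(2)] by blast
  show ?thesis
  proof (cases "b \<in> set us")
    case True
    then obtain xs ys where us: "us = xs @ b # ys"
      by (auto dest: split_list)
    have w: "w = xs @ [b] @ ys @ [a] @ vs"
      using w us by simp
    then have *: "map (Transposition.transpose a b) w = xs @ [a] @ ys @ [b] @ vs"
      using assms(1) by (auto simp: map_id)
    show ?thesis
      unfolding * unfolding w by (rule word_val_exchange)
  next
    case False
    then have "b \<in> set vs"
      using w assms by auto
    then obtain ys zs where vs: "vs = ys @ b # zs"
      by (auto dest: split_list)
    have w: "w = us @ [a] @ ys @ [b] @ zs"
      using w vs by simp
    then have *: "map (Transposition.transpose a b) w = us @ [b] @ ys @ [a] @ zs"
      using assms(1) by (auto simp: map_id)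
    show ?thesis
      unfolding * unfolding w by (rule word_val_exchange)
  qed
qed

lemma word_val_permute:
  assumes "distinct w" "p permutes set w"
  shows "word_val R \<rho> (map p w) = of_int (sign p) \<odot> word_val R \<rho> w"
  using assms(2) finite_set[of w]
proof (induction rule: permutes_induct)
  case (swap a b p)
  have "distinct (map p w)" "set (map p w) = set w"
    using assms(1) permutes_image[OF swap.hyps(4)] permutes_inj_on[OF swap.hyps(4)]
    by (auto simp: distinct_map)
  then have "word_val R \<rho> (map (Transposition.transpose a b) (map p w)) =
      (- 1) \<odot> word_val R \<rho> (map p w)"
    using swap by (intro word_val_transpose) auto
  moreover have "sign (Transposition.transpose a b \<circ> p) = - sign p"
    using swap permutation_permutes[of p]
    by (subst sign_compose) (auto simp: sign_swap_id permutation_swap_id intro: permutes_imp_permutation)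
  ultimately show ?case
    using swap.IH by (simp add: o_def flip: smult_smult)
qed (simp add: smult_one)

text \<open>By the pigeonhole principle such a word repeats an odd letter or contains a letter of
  value zero. The bound does not depend on \<open>R\<close> and fixes the order of truncation of the
  square root.\<close>

lemma word_val_long:
  assumes "finite L" "\<And>l. l \<notin> L \<Longrightarrow> \<rho> l = \<zero>" "card L < length w"
  shows "word_val R \<rho> w = \<zero>"
proof (cases "set w \<subseteq> L")
  case True
  then have "\<not> distinct w"
    using assms card_mono[of L "set w"] distinct_card[of w] by auto
  then show ?thesis by (rule word_val_not_distinct)
next
  case False
  then obtain l where "l \<in> set w" "\<rho> l = \<zero>"
    using assms(2) by blast
  then show ?thesis
    by (auto dest!: split_list)
qed

lemma word_val_super_radical:
  assumes "w \<noteq> []"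
  shows "word_val R \<rho> w \<in> super_radical"
proof -
  obtain l u where "w = l # u"
    using assms by (cases w) auto
  then show ?thesis
    using super_radical_mult(1)[OF odd_super_radical[OF letter_odd]] by simp
qed

end

text \<open>The sign counts how often a letter outside \<open>P\<close> passes a letter in
  \<open>P\<close>. It depends on the word alone, which is why \<open>\<epsilon>\<close> is chosen
  before \<open>R\<close> and \<open>\<rho>\<close>.\<close>

lemma word_val_partition:
  "\<exists>\<epsilon>. \<forall>(R :: 'a superalg) \<rho>. odd_eval R \<rho> \<longrightarrow>
     word_val R \<rho> w = \<epsilon> \<odot>\<^bsub>R\<^esub> (word_val R \<rho> (filter P w) \<otimes>\<^bsub>R\<^esub> word_val R \<rho> (filter (\<lambda>l. \<not> P l) w))"
proof (induction w)
  case Nil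
  have "word_val R \<rho> [] = 1 \<odot>\<^bsub>R\<^esub> (word_val R \<rho> [] \<otimes>\<^bsub>R\<^esub> word_val R \<rho> [])"
    if "odd_eval R \<rho>" for R :: "'a superalg" and \<rho>
  proof -
    interpret odd_eval R \<rho> by fact
    show ?thesis by (simp add: smult_one)
  qed
  then show ?case by (intro exI[of _ 1]) auto
next
  case (Cons l w)
  let ?u = "filter P w" and ?v = "filter (\<lambda>l. \<not> P l) w"
  obtain \<epsilon> where \<epsilon>: "word_val R \<rho> w = \<epsilon> \<odot>\<^bsub>R\<^esub> (word_val R \<rho> ?u \<otimes>\<^bsub>R\<^esub> word_val R \<rho> ?v)"
    if "odd_eval R \<rho>" for R :: "'a superalg" and \<rho>
    using Cons by auto
  have "word_val R \<rho> (l # w) = ((if P l then 1 else (- 1) ^ length ?u) * \<epsilon>) \<odot>\<^bsub>R\<^esub>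
      (word_val R \<rho> (filter P (l # w)) \<otimes>\<^bsub>R\<^esub> word_val R \<rho> (filter (\<lambda>l. \<not> P l) (l # w)))"
    if "odd_eval R \<rho>" for R :: "'a superalg" and \<rho>
  proof -
    interpret odd_eval R \<rho> by fact
    have sq: "(- 1) ^ n * ((- 1) ^ n * c) = (c :: complex)" for n c
      by (simp flip: mult.assoc power_mult_distrib)
    have "word_val R \<rho> ?u \<otimes>\<^bsub>R\<^esub> (\<rho> l \<otimes>\<^bsub>R\<^esub> word_val R \<rho> ?v) =
        (- 1) ^ length ?u \<odot>\<^bsub>R\<^esub> (\<rho> l \<otimes>\<^bsub>R\<^esub> (word_val R \<rho> ?u \<otimes>\<^bsub>R\<^esub> word_val R \<rho> ?v))"
      using word_val_comm_odd[OF letter_odd, of ?u l]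
      by (simp add: smult_mult_left m_assoc flip: m_assoc[of "word_val R \<rho> ?u" "\<rho> l"])
    then show ?thesis
      using \<epsilon>[OF that] by (auto simp: smult_mult_right m_assoc smult_closed sq mult.assoc mult.left_commute
          simp flip: smult_smult)
  qed
  then show ?case by blast
qed

text \<open>Distributivity without commutativity: the factors keep the order of \<open>ks\<close>,
  and the choice of a summand in each factor becomes a function.\<close>

lemma prod_list_sum_PiE:
  fixes f :: "'i \<Rightarrow> 'k \<Rightarrow> 'c::semiring_1"
  assumes "distinct ks" "finite A"
  shows "prod_list (map (\<lambda>i. \<Sum>k\<in>A. f i k) ks) =
    (\<Sum>l\<in>set ks \<rightarrow>\<^sub>E A. prod_list (map (\<lambda>i. f i (l i)) ks))"
  using assms(1)
proof (induction ks)
  case (Cons a ks)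
  have a: "a \<notin> set ks" using Cons.prems by simp
  have "prod_list (map (\<lambda>i. \<Sum>k\<in>A. f i k) (a # ks)) =
      (\<Sum>(k, l)\<in>A \<times> (set ks \<rightarrow>\<^sub>E A). f a k * prod_list (map (\<lambda>i. f i (l i)) ks))"
    using Cons by (simp add: sum_product sum.cartesian_product)
  also have "\<dots> = (\<Sum>l\<in>set (a # ks) \<rightarrow>\<^sub>E A. prod_list (map (\<lambda>i. f i (l i)) (a # ks)))"
  proof (rule sum.reindex_bij_witness[of _ "\<lambda>l. (l a, l(a := undefined))" "\<lambda>(k, l). l(a := k)"], goal_cases)
    case (5 x)
    then show ?case
      using a by (auto intro!: arg_cong2[of _ _ _ _ "(*)"] arg_cong[of _ _ prod_list])
  qed (use a in \<open>auto simp: PiE_iff extensional_def fun_eq_iff split: if_splits\<close>)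
  finally show ?case .
qed simp

section \<open>Determinants with even entries and Cramer's rule\<close>

context comm_superalgebra
begin

lemma cval_mset: "set xs \<subseteq> even_part R \<Longrightarrow> cval (mset xs) = mprod R xs"
  using cval_even_add_mset by (induction xs) (auto simp: cval_empty)

lemma mprod_mset_cong:
  "set xs \<subseteq> even_part R \<Longrightarrow> mset xs = mset ys \<Longrightarrow> mprod R xs = mprod R ys"
  using cval_mset by (metis mset_eq_setD)

text \<open>The factors \<open>b i\<close> may be odd: only the even factors move, and the order of
  the \<open>b i\<close> is kept.\<close>

lemma mprod_mult:
  assumes "\<And>i. i \<in> set ks \<Longrightarrow> a i \<in> even_part R" "\<And>i. i \<in> set ks \<Longrightarrow> b i \<in> carrier R"
  shows "mprod R (map (\<lambda>i. a i \<otimes> b i) ks) = mprod R (map a ks) \<otimes> mprod R (map b ks)"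
  using assms
proof (induction ks)
  case (Cons k ks)
  have c: "a k \<in> carrier R" "b k \<in> carrier R" "mprod R (map a ks) \<in> even_part R"
      "mprod R (map a ks) \<in> carrier R"
    using Cons.prems by (auto intro!: mprod_even even_closed)
  have c': "mprod R (map b ks) \<in> carrier R"
    using Cons.prems by (auto intro!: mprod_closed)
  note c = c c'
  have "mprod R (map (\<lambda>i. a i \<otimes> b i) (k # ks)) = a k \<otimes> (b k \<otimes> mprod R (map a ks)) \<otimes> mprod R (map b ks)"
    using Cons c by (simp add: m_assoc)
  also have "b k \<otimes> mprod R (map a ks) = mprod R (map a ks) \<otimes> b k"
    using even_comm[OF c(3,2)] by simp
  finally show ?case
    using c by (simp add: m_assoc)
qed simp

text \<open>The tautological evaluation, in which the letters are elements of \<open>R\<close>. It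
  moves computations with sums and products into a ring type, without commuting odd elements;
  letters outside the carrier are sent to zero.\<close>

sublocale wev: word_eval R "\<lambda>a. if a \<in> carrier R then a else \<zero>"
  by unfold_locales auto

lemma wev_letter [simp]: "a \<in> carrier R \<Longrightarrow> wev.ev (letter a) = a"
  using wev.ev_letter[of a] by (simp del: wev.ev_letter)

declare wev.ev_single [simp del]

lemma finsum_swap:
  assumes "finite A" "finite B" "\<And>a b. a \<in> A \<Longrightarrow> b \<in> B \<Longrightarrow> f a b \<in> carrier R"
  shows "(\<Oplus>a\<in>A. \<Oplus>b\<in>B. f a b) = (\<Oplus>b\<in>B. \<Oplus>a\<in>A. f a b)"
  using assms(1,3)
proof (induction A)
  case (insert a A)
  then have "(\<Oplus>b\<in>B. f a b \<oplus> (\<Oplus>a\<in>A. f a b)) = (\<Oplus>b\<in>B. f a b) \<oplus> (\<Oplus>b\<in>B. \<Oplus>a\<in>A. f a b)"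
    by (intro finsum_addf) (auto intro!: finsum_closed)
  moreover have "(\<Oplus>b\<in>B. \<Oplus>a\<in>insert a A. f a b) = (\<Oplus>b\<in>B. f a b \<oplus> (\<Oplus>a\<in>A. f a b))"
    using insert by (intro finsum_cong') (auto intro!: finsum_closed finsum_insert)
  ultimately show ?case
    using insert by (auto simp: Pi_def finsum_insert intro!: finsum_closed)
qed (use assms in \<open>simp\<close>)

text \<open>The pattern of this and the next two proofs: replace the entries by variables
  \<open>cvar\<close>, apply the fact about \<open>det\<close> over a commutative ring, and
  evaluate.\<close>

lemma super_det_transpose:
  assumes "\<And>i j. i < m \<Longrightarrow> j < m \<Longrightarrow> B i j \<in> even_part R"
  shows "super_det R m (\<lambda>i j. B j i) = super_det R m B"
proof -
  let ?M = "mat m m (\<lambda>(i, j). cvar (B i j))"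
  have "mat m m (\<lambda>(i, j). cvar (B j i)) = transpose_mat ?M"
    by (rule eq_matI) auto
  then have "det (mat m m (\<lambda>(i, j). cvar (B j i))) = det ?M"
    using det_transpose[of ?M m] by simp
  from arg_cong[OF this, of cev.ev] show ?thesis
    unfolding cev_det using assms
    by (subst (asm) (1 2) super_det_cong) (auto simp: cev_even)
qed

lemma super_det_reindex_rows:
  assumes "\<And>i j. i < m \<Longrightarrow> j < m \<Longrightarrow> B i j \<in> even_part R" and p: "p permutes {..<m}"
  shows "super_det R m (\<lambda>i j. B (p i) j) = of_int (sign p) \<odot> super_det R m B"
proof -
  have pm: "p i < m" if "i < m" for i
    using p that permutes_in_image by fastforce
  let ?M = "mat m m (\<lambda>(i, j). cvar (B i j))"
  have "mat m m (\<lambda>(i, j). cvar (B (p i) j)) = mat m m (\<lambda>(i, j). ?M $$ (p i, j))"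
    using pm by (intro eq_matI) auto
  then have "det (mat m m (\<lambda>(i, j). cvar (B (p i) j))) = signof p * det ?M"
    using det_permute_rows[of ?M m p] p by (simp add: atLeast0LessThan)
  also have "signof p = (const (of_int (sign p)) :: 'a multiset \<Rightarrow>\<^sub>0 complex)"
    by (simp add: sign_def single_uminus)
  finally have "cev.ev (det (mat m m (\<lambda>(i, j). cvar (B (p i) j)))) = of_int (sign p) \<odot> cev.ev (det ?M)"
    by (simp del: single_of_int cev.ev_mult)
  then show ?thesis
    unfolding cev_det using assms pm
    by (subst (asm) (1 2) super_det_cong) (auto simp: cev_even)
qed

lemma super_det_repeated_row:
  assumes "\<And>i j. i < m \<Longrightarrow> j < m \<Longrightarrow> B i j \<in> even_part R"
    and "i < m" "k < m" "i \<noteq> k" "\<And>j. j < m \<Longrightarrow> B i j = B k j"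
  shows "super_det R m B = \<zero>"
proof -
  let ?M = "mat m m (\<lambda>(i, j). cvar (B i j))"
  have "det ?M = 0"
    using assms by (intro det_identical_rows[of _ m i k]) (auto intro!: eq_vecI)
  from arg_cong[OF this, of cev.ev] show ?thesis
    unfolding cev_det using assms
    by (subst (asm) super_det_cong) (auto simp: cev_even)
qed

text \<open>Cramer's rule for products of unknowns: in the expansion of the left-hand side, the term in
  which the factor \<open>\<theta> (p i)\<close> contributes \<open>X (p i) (l i) \<otimes> Y (l i)\<close> is the determinant of \<open>X\<close> with
  its columns \<open>i \<in> set ks\<close> replaced by the columns \<open>l i\<close>. It vanishes unless \<open>l\<close> permutes
  \<open>set ks\<close>, and then the sign of \<open>l\<close> appears twice.\<close>

lemma super_cramer:
  assumes Y: "odd_eval R Y"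
    and X: "\<And>i j. i < m \<Longrightarrow> j < m \<Longrightarrow> X i j \<in> even_part R"
    and \<theta>: "\<And>i. i < m \<Longrightarrow> \<theta> i = (\<Oplus>k\<in>{..<m}. X i k \<otimes> Y k)"
    and ks: "distinct ks" "set ks \<subseteq> {..<m}"
  shows "(\<Oplus>p\<in>{p. p permutes {..<m}}. of_int (sign p) \<odot>
      (mprod R (map (\<lambda>j. X (p j) j) (filter (\<lambda>j. j \<notin> set ks) [0..<m])) \<otimes>
       mprod R (map (\<lambda>i. \<theta> (p i)) ks))) =
    fact (length ks) \<odot> (super_det R m X \<otimes> word_val R Y ks)"
proof -
  interpret Y: odd_eval R Y by (fact Y)
  define js where "js = filter (\<lambda>j. j \<notin> set ks) [0..<m]"
  define ext where "ext l = (\<lambda>j. if j \<in> set ks then l j else j)" for l :: "nat \<Rightarrow> nat"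
  define L where "L = set ks \<rightarrow>\<^sub>E {..<m}"
  define S where "S = {p. p permutes {..<m}}"
  have finL: "finite L" and finS: "finite S"
    by (auto simp: L_def S_def finite_PiE finite_permutations)
  have pm: "p i < m" if "p \<in> S" "i < m" for p i
    using that permutes_in_image unfolding S_def by fastforce
  have Lm: "l i < m" if "l \<in> L" "i \<in> set ks" for l i
    using that by (auto simp: L_def)
  have extm: "ext l i < m" if "l \<in> L" "i < m" for l i
    using that Lm by (auto simp: ext_def)
  have Xc: "X i j \<in> carrier R" if "i < m" "j < m" for i j
    using X[OF that] even_closed by blast
  have ksm: "i < m" if "i \<in> set ks" for i
    using that ks by auto
  have det_ext: "super_det R m (\<lambda>j i. X i (ext l j)) \<in> even_part R" if "l \<in> L" for l
    using that X extm by (intro super_det_even) auto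
  \<comment> \<open>Distributing the product over \<open>ks\<close> introduces a choice
    \<open>l\<close> of one summation index per factor. The even entries are then gathered in front
    of the odd word, whose order is kept.\<close>
  have expand: "mprod R (map (\<lambda>j. X (p j) j) js) \<otimes> mprod R (map (\<lambda>i. \<theta> (p i)) ks) =
      (\<Oplus>l\<in>L. mprod R (map (\<lambda>j. X (p j) (ext l j)) [0..<m]) \<otimes> word_val R Y (map l ks))" if p: "p \<in> S" for p
  proof -
    let ?x = "\<lambda>i k. letter (X i k)" and ?y = "\<lambda>k. letter (Y k)"
    have js: "set (map (\<lambda>j. X (p j) j) js) \<subseteq> even_part R"
      using X pm[OF p] by (auto simp: js_def)
    have "mprod R (map (\<lambda>i. \<theta> (p i)) ks) = wev.ev (prod_list (map (\<lambda>i. \<Sum>k<m. ?x (p i) k * ?y k) ks))"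
      unfolding wev.ev_prod_list map_map
      using \<theta> Xc pm[OF p] ksm
      by (intro arg_cong[of _ _ "mprod R"] map_cong) (auto simp: wev.ev_sum intro!: finsum_cong')
    also have "\<dots> = wev.ev (\<Sum>l\<in>L. prod_list (map (\<lambda>i. ?x (p i) (l i) * ?y (l i)) ks))"
      using ks unfolding L_def by (subst prod_list_sum_PiE) auto
    also have "\<dots> = (\<Oplus>l\<in>L. mprod R (map (\<lambda>i. X (p i) (l i) \<otimes> Y (l i)) ks))"
      unfolding wev.ev_sum wev.ev_prod_list map_map
      using Xc pm[OF p] ksm Lm
      by (intro finsum_cong' arg_cong[of _ _ "mprod R"] map_cong) (auto intro!: mprod_closed)
    also have "mprod R (map (\<lambda>j. X (p j) j) js) \<otimes> \<dots> =
        (\<Oplus>l\<in>L. mprod R (map (\<lambda>j. X (p j) j) js) \<otimes> mprod R (map (\<lambda>i. X (p i) (l i) \<otimes> Y (l i)) ks))"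
      using js Xc pm[OF p] ksm Lm finL
      by (intro finsum_rdistr) (auto simp: js_def intro!: mprod_closed)
    also have "\<dots> = (\<Oplus>l\<in>L. mprod R (map (\<lambda>j. X (p j) (ext l j)) [0..<m]) \<otimes> word_val R Y (map l ks))"
    proof (rule finsum_cong')
      fix l assume l: "l \<in> L"
      have e: "set (map (\<lambda>i. X (p i) (l i)) ks) \<subseteq> even_part R"
        using X pm[OF p] ksm Lm[OF l] by auto
      have "mprod R (map (\<lambda>i. X (p i) (l i) \<otimes> Y (l i)) ks) =
          mprod R (map (\<lambda>i. X (p i) (l i)) ks) \<otimes> word_val R Y (map l ks)"
        using X pm[OF p] ksm Lm[OF l] by (subst mprod_mult) (auto simp: word_val_def o_def)
      then have "mprod R (map (\<lambda>j. X (p j) j) js) \<otimes> mprod R (map (\<lambda>i. X (p i) (l i) \<otimes> Y (l i)) ks) =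
          (mprod R (map (\<lambda>j. X (p j) j) js) \<otimes> mprod R (map (\<lambda>i. X (p i) (l i)) ks)) \<otimes> word_val R Y (map l ks)"
        using js e mprod_even[OF js] mprod_even[OF e] by (simp add: m_assoc even_closed)
      also have "mprod R (map (\<lambda>j. X (p j) j) js) \<otimes> mprod R (map (\<lambda>i. X (p i) (l i)) ks) =
          mprod R (map (\<lambda>j. X (p j) j) js @ map (\<lambda>i. X (p i) (l i)) ks)"
        using js e even_closed by (subst mprod_append) auto
      also have "map (\<lambda>j. X (p j) j) js @ map (\<lambda>i. X (p i) (l i)) ks =
          map (\<lambda>j. X (p j) (ext l j)) (js @ ks)"
        by (auto simp: ext_def js_def)
      also have "mprod R \<dots> = mprod R (map (\<lambda>j. X (p j) (ext l j)) [0..<m])"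
      proof (rule mprod_mset_cong)
        have "distinct (js @ ks)" "set (js @ ks) = set [0..<m]"
          using ks by (auto simp: js_def)
        then have "mset (js @ ks) = mset [0..<m]"
          by (metis distinct_upt set_eq_iff_mset_eq_distinct)
        then show "mset (map (\<lambda>j. X (p j) (ext l j)) (js @ ks)) = mset (map (\<lambda>j. X (p j) (ext l j)) [0..<m])"
          by (metis mset_map)
      qed (use X pm[OF p] extm[OF l] ksm in \<open>auto simp: js_def\<close>)
      finally show "mprod R (map (\<lambda>j. X (p j) j) js) \<otimes> mprod R (map (\<lambda>i. X (p i) (l i) \<otimes> Y (l i)) ks) =
          mprod R (map (\<lambda>j. X (p j) (ext l j)) [0..<m]) \<otimes> word_val R Y (map l ks)" .
    qed (use Xc pm[OF p] extm in \<open>auto intro!: mprod_closed m_closed\<close>)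
    finally show ?thesis .
  qed
  have prodc: "mprod R (map (\<lambda>j. X (p j) (ext l j)) [0..<m]) \<in> carrier R" if "p \<in> S" "l \<in> L" for p l
    using Xc pm[OF that(1)] extm[OF that(2)] by (auto intro!: mprod_closed)
  have "(\<Oplus>p\<in>S. of_int (sign p) \<odot>
      (mprod R (map (\<lambda>j. X (p j) j) js) \<otimes> mprod R (map (\<lambda>i. \<theta> (p i)) ks))) =
    (\<Oplus>p\<in>S. \<Oplus>l\<in>L. of_int (sign p) \<odot>
      (mprod R (map (\<lambda>j. X (p j) (ext l j)) [0..<m]) \<otimes> word_val R Y (map l ks)))"
    using prodc by (intro finsum_cong') (auto simp: expand smult_finsum smult_closed intro!: finsum_closed)
  also have "\<dots> = (\<Oplus>l\<in>L. \<Oplus>p\<in>S. of_int (sign p) \<odot>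
      (mprod R (map (\<lambda>j. X (p j) (ext l j)) [0..<m]) \<otimes> word_val R Y (map l ks)))"
    using prodc finL finS by (intro finsum_swap) (auto simp: smult_closed)
  also have "\<dots> = (\<Oplus>l\<in>L. super_det R m (\<lambda>j i. X i (ext l j)) \<otimes> word_val R Y (map l ks))"
  proof (rule finsum_cong')
    fix l assume l: "l \<in> L"
    have "super_det R m (\<lambda>j i. X i (ext l j)) =
        (\<Oplus>p\<in>S. of_int (sign p) \<odot> mprod R (map (\<lambda>j. X (p j) (ext l j)) [0..<m]))"
      unfolding S_def using X extm[OF l] by (intro super_det_mprod) auto
    then show "(\<Oplus>p\<in>S. of_int (sign p) \<odot>
        (mprod R (map (\<lambda>j. X (p j) (ext l j)) [0..<m]) \<otimes> word_val R Y (map l ks))) =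
      super_det R m (\<lambda>j i. X i (ext l j)) \<otimes> word_val R Y (map l ks)"
      using prodc[OF _ l] finS
      by (auto simp: finsum_ldistr smult_closed smult_mult_left intro!: finsum_cong')
  qed (use det_ext even_closed in auto)
  also have "\<dots> = (\<Oplus>l\<in>(\<lambda>p. restrict p (set ks)) ` {p. p permutes set ks}.
      super_det R m (\<lambda>j i. X i (ext l j)) \<otimes> word_val R Y (map l ks))"
  proof (rule add.finprod_mono_neutral_cong_right)
    show "(\<lambda>p. restrict p (set ks)) ` {p. p permutes set ks} \<subseteq> L"
      using ksm by (auto simp: L_def permutes_in_image)
    show "super_det R m (\<lambda>j i. X i (ext l j)) \<otimes> word_val R Y (map l ks) = \<zero>"
      if l_diff: "l \<in> L - (\<lambda>p. restrict p (set ks)) ` {p. p permutes set ks}" for l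
    proof -
      from l_diff have l: "l \<in> L" and notin: "l \<notin> (\<lambda>p. restrict p (set ks)) ` {p. p permutes set ks}"
        by auto
      \<comment> \<open>A repeated value of \<open>l\<close> repeats an odd letter. A value outside
        \<open>set ks\<close> makes two columns equal, since \<open>ext l\<close> fixes that
        position. Otherwise \<open>l\<close> is the restriction of a permutation of
        \<open>set ks\<close>, which is excluded here.\<close>
      consider "\<not> inj_on l (set ks)" | i where "i \<in> set ks" "l i \<notin> set ks"
        | "inj_on l (set ks)" "l ` set ks \<subseteq> set ks"
        by blast
      then show "super_det R m (\<lambda>j i. X i (ext l j)) \<otimes> word_val R Y (map l ks) = \<zero>"
      proof cases
        case 1
        then have "word_val R Y (map l ks) = \<zero>"
          by (intro Y.word_val_not_distinct) (auto simp: distinct_map)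
        then show ?thesis
          using det_ext[OF l] even_closed by simp
      next
        case (2 i)
        have "super_det R m (\<lambda>j i. X i (ext l j)) = \<zero>"
          using X extm[OF l] 2 ksm Lm[OF l]
          by (intro super_det_repeated_row[of m _ i "l i"]) (auto simp: ext_def)
        then show ?thesis by simp
      next
        case 3
        then have "bij_betw l (set ks) (set ks)"
          by (simp add: bij_betw_def endo_inj_surj)
        then have "ext l permutes set ks"
          by (intro bij_imp_permutes) (auto simp: ext_def cong: bij_betw_cong)
        moreover have "l = restrict (ext l) (set ks)"
          using l by (auto simp: L_def ext_def PiE_def extensional_def restrict_def)
        ultimately show ?thesis
          using notin by blast
      qed
    qed
  qed (use finL det_ext even_closed in auto)
  also have "\<dots> = (\<Oplus>p\<in>{p. p permutes set ks}. super_det R m (\<lambda>j i. X i (ext (restrict p (set ks)) j)) \<otimes>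
      word_val R Y (map (restrict p (set ks)) ks))"
  proof (rule add.finprod_reindex)
    show "inj_on (\<lambda>p. restrict p (set ks)) {p. p permutes set ks}"
    proof (rule inj_onI)
      fix p q assume pq: "p \<in> {p. p permutes set ks}" "q \<in> {p. p permutes set ks}"
        "restrict p (set ks) = restrict q (set ks)"
      show "p = q"
      proof
        show "p x = q x" for x
          using pq(1,2) fun_cong[OF pq(3), of x]
          by (cases "x \<in> set ks") (simp_all add: permutes_not_in)
      qed
    qed
    show "(\<lambda>l. super_det R m (\<lambda>j i. X i (ext l j)) \<otimes> word_val R Y (map l ks))
        \<in> (\<lambda>p. restrict p (set ks)) ` {p. p permutes set ks} \<rightarrow> carrier R"
      using det_ext[THEN even_closed] ksm by (auto simp: L_def permutes_in_image intro!: m_closed)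
  qed
  also have "\<dots> = (\<Oplus>p\<in>{p. p permutes set ks}. super_det R m X \<otimes> word_val R Y ks)"
  proof (rule finsum_cong')
    fix p assume "p \<in> {p. p permutes set ks}"
    then have p: "p permutes set ks" by simp
    then have pm: "p permutes {..<m}"
      using ks permutes_subset by blast
    have "ext (restrict p (set ks)) = p"
      using p by (auto simp: ext_def permutes_def)
    then have "super_det R m (\<lambda>j i. X i (ext (restrict p (set ks)) j)) = of_int (sign p) \<odot> super_det R m X"
      using super_det_reindex_rows[of m "\<lambda>i j. X j i", OF _ pm] super_det_transpose[of m X] X by simp
    moreover have "word_val R Y (map (restrict p (set ks)) ks) = of_int (sign p) \<odot> word_val R Y ks"
      using Y.word_val_permute[OF ks(1) p] by (simp cong: map_cong)
    moreover have "of_int (sign p) * of_int (sign p) = (1 :: complex)"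
      by (simp add: sign_def)
    ultimately show "super_det R m (\<lambda>j i. X i (ext (restrict p (set ks)) j)) \<otimes>
        word_val R Y (map (restrict p (set ks)) ks) = super_det R m X \<otimes> word_val R Y ks"
      using super_det_even[of m X] X even_closed
      by (simp add: smult_mult_left smult_mult_right smult_closed smult_one flip: smult_smult)
  qed (use super_det_even[of m X] X even_closed in auto)
  \<comment> \<open>The surviving terms are all equal, one for each permutation of
    \<open>set ks\<close>.\<close>
  also have "\<dots> = fact (length ks) \<odot> (super_det R m X \<otimes> word_val R Y ks)"
  proof -
    have const: "(\<Oplus>x\<in>A. a) = of_nat (card A) \<odot> a" if "finite A" "a \<in> carrier R" for A :: "(nat \<Rightarrow> nat) set" and a
      using that by (induction A) (auto simp: smult_zero_left smult_add_left smult_one)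
    have "card {p. p permutes set ks} = fact (length ks)"
      using card_permutations[of "set ks" "length ks"] ks by (simp add: distinct_card)
    then show ?thesis
      using super_det_even[of m X] X even_closed finite_permutations[of "set ks"] by (simp add: const)
  qed
  finally show ?thesis
    by (simp add: S_def js_def)
qed

end

text \<open>Both sides evaluate one formal determinant in the letters \<open>(i, j)\<close>, and
  evaluation commutes with homomorphisms.\<close>

lemma super_det_natural:
  assumes R: "comm_superalgebra R" and S: "comm_superalgebra S" and h: "h \<in> superalg_hom R S"
    and A: "\<And>i j. i < m \<Longrightarrow> j < m \<Longrightarrow> A i j \<in> even_part R"
  shows "h (super_det R m A) = super_det S m (\<lambda>i j. h (A i j))"
proof -
  interpret R: comm_superalgebra R by (fact R)
  interpret S: comm_superalgebra S by (fact S)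
  note hom = superalg_homD[OF h]
  define \<rho> where "\<rho> = (\<lambda>(i, j). if i < m \<and> j < m then A i j else \<zero>\<^bsub>R\<^esub>)"
  have \<rho>: "\<rho> l \<in> even_part R" for l
    using A R.even_zero by (auto simp: \<rho>_def split: prod.splits)
  interpret Re: word_eval R \<rho>
    by unfold_locales (use \<rho> R.even_closed in auto)
  interpret Se: word_eval S "\<lambda>l. h (\<rho> l)"
    by unfold_locales (use \<rho> hom(3) S.even_closed in auto)
  let ?p = "alg_det m (\<lambda>i j. letter (i, j))"
  have "Re.ev ?p = super_det R m (\<lambda>i j. \<rho> (i, j))"
    using \<rho> by (subst Re.ev_alg_det) (auto simp: R.smult_one)
  moreover have "Se.ev ?p = super_det S m (\<lambda>i j. h (\<rho> (i, j)))"
    using \<rho> hom(3) by (subst Se.ev_alg_det) (auto simp: S.smult_one)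
  moreover have "h (Re.ev ?p) = Se.ev ?p"
    by (rule word_eval_natural[OF R S h Re.letter_closed])
  moreover have "super_det R m (\<lambda>i j. \<rho> (i, j)) = super_det R m A"
    using A by (intro R.super_det_cong) (auto simp: \<rho>_def)
  moreover have "super_det S m (\<lambda>i j. h (\<rho> (i, j))) = super_det S m (\<lambda>i j. h (A i j))"
    using A hom(3) by (intro S.super_det_cong) (auto simp: \<rho>_def)
  ultimately show ?thesis by simp
qed

lemma comm_ring_hom_const: "comm_ring_hom (const :: complex \<Rightarrow> 'm::comm_monoid_add \<Rightarrow>\<^sub>0 complex)"
  by unfold_locales (simp_all add: single_add mult_single)

section \<open>Invertibility and determinants modulo nilpotents\<close>

context comm_superalgebra
begin

lemma add_diff_cancel:
  assumes "a \<in> carrier R" "b \<in> carrier R"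
  shows "(a \<oplus> b) \<ominus> a = b" "a \<oplus> (b \<ominus> a) = b"
  using assms by (simp_all add: a_minus_def a_comm[of a] a_assoc r_neg l_neg)

lemma super_det_const:
  "super_det R m (\<lambda>i j. Q i j \<odot> \<one>) = det (mat m m (\<lambda>(i, j). Q i j)) \<odot> \<one>"
proof -
  interpret c: comm_ring_hom "const :: complex \<Rightarrow> 'a multiset \<Rightarrow>\<^sub>0 complex"
    by (rule comm_ring_hom_const)
  have "mat m m (\<lambda>(i, j). const (Q i j) :: 'a multiset \<Rightarrow>\<^sub>0 complex) =
      map_mat const (mat m m (\<lambda>(i, j). Q i j))"
    by (rule eq_matI) auto
  then have "det (mat m m (\<lambda>(i, j). const (Q i j) :: 'a multiset \<Rightarrow>\<^sub>0 complex)) =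
      const (det (mat m m (\<lambda>(i, j). Q i j)))"
    by (simp only: c.hom_det)
  from arg_cong[OF this, of cev.ev] show ?thesis
    unfolding cev_det by (simp add: cev.ev_const)
qed

lemma super_det_congruence:
  assumes X: "\<And>i j. i < m \<Longrightarrow> j < m \<Longrightarrow> X i j \<in> even_part R"
    and P: "\<And>i j. i < m \<Longrightarrow> j < m \<Longrightarrow> P i j \<in> even_part R"
  shows "super_det R m (\<lambda>i j. \<Oplus>k\<in>{..<m}. \<Oplus>l\<in>{..<m}. X i k \<otimes> P k l \<otimes> X j l) =
    super_det R m X \<otimes> super_det R m P \<otimes> super_det R m X"
proof -
  let ?X = "mat m m (\<lambda>(i, j). cvar (X i j))" and ?P = "mat m m (\<lambda>(i, j). cvar (P i j))"
  have "(?X * ?P * transpose_mat ?X) $$ (i, j) =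
      (\<Sum>k<m. \<Sum>l<m. cvar (X i k) * cvar (P k l) * cvar (X j l))" if "i < m" "j < m" for i j
    using that
    by (subst sum.swap) (simp add: scalar_prod_def sum_distrib_right atLeast0LessThan)
  then have "mat m m (\<lambda>(i, j). \<Sum>k<m. \<Sum>l<m. cvar (X i k) * cvar (P k l) * cvar (X j l)) =
      ?X * ?P * transpose_mat ?X"
    by (intro eq_matI) auto
  then have "det (mat m m (\<lambda>(i, j). \<Sum>k<m. \<Sum>l<m. cvar (X i k) * cvar (P k l) * cvar (X j l))) =
      det ?X * det ?P * det ?X"
    by (simp add: det_mult[of _ m] det_transpose[of _ m] mult_carrier_mat[of _ m m])
  from arg_cong[OF this, of cev.ev]
  have "super_det R m (\<lambda>i j. cev.ev (\<Sum>k<m. \<Sum>l<m. cvar (X i k) * cvar (P k l) * cvar (X j l))) =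
    super_det R m (\<lambda>i j. cev.ev (cvar (X i j))) \<otimes> super_det R m (\<lambda>i j. cev.ev (cvar (P i j))) \<otimes>
      super_det R m (\<lambda>i j. cev.ev (cvar (X i j)))"
    by (simp only: cev.ev_mult cev_det)
  moreover have entry: "cev.ev (\<Sum>k<m. \<Sum>l<m. cvar (X i k) * cvar (P k l) * cvar (X j l)) =
      (\<Oplus>k\<in>{..<m}. \<Oplus>l\<in>{..<m}. X i k \<otimes> P k l \<otimes> X j l)" if "i < m" "j < m" for i j
    unfolding cev.ev_sum using X P that even_closed
    by (intro finsum_cong') (auto intro!: finsum_closed)
  have "super_det R m (\<lambda>i j. cev.ev (\<Sum>k<m. \<Sum>l<m. cvar (X i k) * cvar (P k l) * cvar (X j l))) =
      super_det R m (\<lambda>i j. \<Oplus>k\<in>{..<m}. \<Oplus>l\<in>{..<m}. X i k \<otimes> P k l \<otimes> X j l)"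
    by (intro super_det_cong entry cev_even)
  moreover have "super_det R m (\<lambda>i j. cev.ev (cvar (X i j))) = super_det R m X"
    "super_det R m (\<lambda>i j. cev.ev (cvar (P i j))) = super_det R m P"
    using X P by (auto intro!: super_det_cong simp: cev_even)
  ultimately show ?thesis by simp
qed

lemma super_det_inverse:
  assumes X: "\<And>i j. i < m \<Longrightarrow> j < m \<Longrightarrow> X i j \<in> even_part R"
    and d: "d \<in> even_part R" "super_det R m X \<otimes> d = \<one>"
  obtains Z where "\<And>i j. Z i j \<in> even_part R"
    "\<And>i j. i < m \<Longrightarrow> j < m \<Longrightarrow> (\<Oplus>k\<in>{..<m}. X i k \<otimes> Z k j) = (if i = j then \<one> else \<zero>)"
proof
  let ?X = "mat m m (\<lambda>(i, j). cvar (X i j))"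
  \<comment> \<open>The adjugate matrix multiplied by the inverse \<open>d\<close> of the
    determinant.\<close>
  let ?Z = "\<lambda>i j. cev.ev (cvar d * adj_mat ?X $$ (i, j))"
  show "?Z i j \<in> even_part R" for i j
    by (rule cev_even)
  have adj: "adj_mat ?X \<in> carrier_mat m m" "?X * adj_mat ?X = det ?X \<cdot>\<^sub>m 1\<^sub>m m"
    using adj_mat[of ?X m] by auto
  show "(\<Oplus>k\<in>{..<m}. X i k \<otimes> ?Z k j) = (if i = j then \<one> else \<zero>)" if ij: "i < m" "j < m" for i j
  proof -
    have "(\<Oplus>k\<in>{..<m}. X i k \<otimes> ?Z k j) =
        cev.ev (\<Sum>k<m. cvar (X i k) * (cvar d * adj_mat ?X $$ (k, j)))"
      unfolding cev.ev_sum using X ij even_closed d by (intro finsum_cong') auto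
    also have "(\<Sum>k<m. cvar (X i k) * (cvar d * adj_mat ?X $$ (k, j))) =
        cvar d * (?X * adj_mat ?X) $$ (i, j)"
      using adj(1) ij
      by (simp add: scalar_prod_def sum_distrib_left atLeast0LessThan mult.left_commute)
    also have "\<dots> = cvar d * det ?X * (if i = j then 1 else 0)"
      unfolding adj(2) using ij by simp
    also have "cev.ev \<dots> = super_det R m X \<otimes> d \<otimes> (if i = j then \<one> else \<zero>)"
    proof -
      have "cev.ev (det ?X) = super_det R m X"
        unfolding cev_det using X by (auto intro!: super_det_cong simp: cev_even)
      moreover have "d \<otimes> super_det R m X = super_det R m X \<otimes> d"
        using d super_det_even[of m X] X even_closed by (intro even_comm) auto
      ultimately show ?thesis
        using d by auto
    qed
    finally show ?thesis
      using d by simp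
  qed
qed

lemma even_super_radical:
  assumes "a \<in> even_part R" "a \<in> super_radical"
  shows "a \<in> even_nil"
proof -
  obtain t u where a: "a = t \<oplus> u" "t \<in> even_nil" "u \<in> odd_part R"
    using assms(2) by (rule super_radicalE)
  then have "a = t"
    using parity_unique(1)[of a t \<zero> u] assms(1) even_nilD odd_zero even_closed by simp
  with a show ?thesis by simp
qed

text \<open>Comparing even components in a x = 1 shows that the even component of an inverse is
  itself an inverse.\<close>

lemma even_inverse:
  assumes "a \<in> even_part R" "a \<in> Units R"
  obtains d where "d \<in> even_part R" "a \<otimes> d = \<one>"
proof -
  obtain x where x: "x \<in> carrier R" "a \<otimes> x = \<one>"
    using assms(2) by (auto simp: Units_def)
  obtain e f where ef: "x = e \<oplus> f" "e \<in> even_part R" "f \<in> odd_part R"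
    using even_odd_sum[OF x(1)] by blast
  have "a \<otimes> e \<oplus> a \<otimes> f = \<one> \<oplus> \<zero>"
    using x ef assms even_closed odd_closed by (simp add: r_distr)
  then have "a \<otimes> e = \<one>"
    using parity_unique(1)[of "a \<otimes> e" \<one> "a \<otimes> f" \<zero>] assms ef
    by (simp add: even_even even_odd one_even odd_zero)
  with ef show ?thesis using that by blast
qed

text \<open>The two matrices have the same image in \<open>reduction\<close>, and
  \<open>super_det\<close> is natural; no expansion of the determinant is needed. An even element of
  the radical is nilpotent.\<close>

lemma super_det_perturb:
  assumes A: "\<And>i j. i < m \<Longrightarrow> j < m \<Longrightarrow> A i j \<in> even_part R"
    and N: "\<And>i j. i < m \<Longrightarrow> j < m \<Longrightarrow> N i j \<in> even_nil"
  shows "super_det R m (\<lambda>i j. A i j \<oplus> N i j) \<ominus> super_det R m A \<in> even_nil"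
proof -
  note hom = comm_superalgebra_axioms comm_superalgebra_reduction rep_hom
  interpret S: comm_superalgebra reduction by (rule comm_superalgebra_reduction)
  have AN: "A i j \<oplus> N i j \<in> even_part R" if "i < m" "j < m" for i j
    using A N that even_nilD even_add by blast
  have nil: "a \<in> super_radical" if "a \<in> even_nil" for a
    using super_radicalI[OF that odd_zero] even_nilD[OF that] by (simp add: even_closed)
  have "rep (A i j \<oplus> N i j) = rep (A i j)" if ij: "i < m" "j < m" for i j
  proof -
    have "(A i j \<oplus> N i j) \<ominus> A i j = N i j"
      using A[OF ij] even_nilD[OF N[OF ij]] by (simp add: even_closed add_diff_cancel)
    then show ?thesis
      using nil[OF N[OF ij]] A[OF ij] AN[OF ij] by (subst rep_eq_iff) (auto intro: even_closed)
  qed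
  then have "super_det reduction m (\<lambda>i j. rep (A i j \<oplus> N i j)) = super_det reduction m (\<lambda>i j. rep (A i j))"
    using A AN superalg_homD(3)[OF rep_hom] by (intro S.super_det_cong) auto
  then have "rep (super_det R m (\<lambda>i j. A i j \<oplus> N i j)) = rep (super_det R m A)"
    using super_det_natural[OF hom, of m A] super_det_natural[OF hom, of m "\<lambda>i j. A i j \<oplus> N i j"] A AN
    by simp
  then have "super_det R m (\<lambda>i j. A i j \<oplus> N i j) \<ominus> super_det R m A \<in> super_radical"
    using super_det_even[of m A] super_det_even[of m "\<lambda>i j. A i j \<oplus> N i j"] A AN
    by (subst (asm) rep_eq_iff) (auto intro: even_closed)
  moreover have "super_det R m (\<lambda>i j. A i j \<oplus> N i j) \<ominus> super_det R m A \<in> even_part R"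
    unfolding a_minus_def using super_det_even[of m A] super_det_even[of m "\<lambda>i j. A i j \<oplus> N i j"] A AN
    by (auto intro!: even_add even_uminus)
  ultimately show ?thesis
    by (intro even_super_radical)
qed

text \<open>Up to an even nilpotent t the given unit D equals x (q x), with x = det X and q = det Q.
  Multiplying by the inverse u of D gives x (q x u) = 1 - u t, and the right-hand side is
  invertible.\<close>

lemma super_det_coordinates_unit:
  assumes X: "\<And>i j. i < m \<Longrightarrow> j < m \<Longrightarrow> X i j \<in> even_part R"
    and N: "\<And>i j. i < m \<Longrightarrow> j < m \<Longrightarrow> N i j \<in> even_nil"
    and unit: "super_det R m (\<lambda>i j. (\<Oplus>k\<in>{..<m}. \<Oplus>l\<in>{..<m}. X i k \<otimes> (Q k l \<odot> \<one>) \<otimes> X j l) \<oplus> N i j) \<in> Units R"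
  obtains d where "d \<in> even_part R" "super_det R m X \<otimes> d = \<one>"
proof -
  let ?G0 = "\<lambda>i j. \<Oplus>k\<in>{..<m}. \<Oplus>l\<in>{..<m}. X i k \<otimes> (Q k l \<odot> \<one>) \<otimes> X j l"
  let ?D = "super_det R m (\<lambda>i j. ?G0 i j \<oplus> N i j)" and ?x = "super_det R m X"
  let ?q = "det (mat m m (\<lambda>(i, j). Q i j))"
  have G0: "?G0 i j \<in> even_part R" if "i < m" "j < m" for i j
    using X that by (intro even_finsum Pi_I) (auto intro!: even_even smult_even one_even)
  have D: "?D \<in> even_part R"
    using G0 even_nilD[OF N] by (intro super_det_even even_add) auto
  obtain u where u: "u \<in> even_part R" "?D \<otimes> u = \<one>"
    using even_inverse[OF D unit] by blast
  have x: "?x \<in> even_part R"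
    using X by (intro super_det_even)
  have D0: "super_det R m ?G0 = ?x \<otimes> (?q \<odot> ?x)"
    using X x by (subst super_det_congruence)
      (auto simp: super_det_const smult_even one_even smult_mult_left smult_mult_right even_closed)
  define t where "t = ?D \<ominus> ?x \<otimes> (?q \<odot> ?x)"
  have t: "t \<in> even_nil"
    unfolding t_def D0[symmetric] using G0 N by (intro super_det_perturb)
  note c = x[THEN even_closed] u(1)[THEN even_closed] D[THEN even_closed] even_closed[OF even_nilD[OF t]]
  have "?D = ?x \<otimes> (?q \<odot> ?x) \<oplus> t"
    using c by (simp add: t_def smult_closed add_diff_cancel)
  then have one: "?x \<otimes> ((?q \<odot> ?x) \<otimes> u) \<oplus> u \<otimes> t = \<one>"
    using u c even_comm[OF u(1), of t] by (simp add: l_distr m_assoc smult_closed)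
  have eq: "?x \<otimes> ((?q \<odot> ?x) \<otimes> u) = \<one> \<ominus> u \<otimes> t"
    unfolding one[symmetric] using c by (simp add: a_minus_def a_assoc r_neg smult_closed)
  obtain v where v: "v \<in> even_part R" "(\<one> \<ominus> u \<otimes> t) \<otimes> v = \<one>"
    using even_nil_unit[OF even_nil_mult[OF u(1) t]] by blast
  have "?x \<otimes> ((?q \<odot> ?x) \<otimes> u \<otimes> v) = \<one>"
    using v eq c by (simp add: even_closed smult_closed flip: m_assoc)
  moreover have "(?q \<odot> ?x) \<otimes> u \<otimes> v \<in> even_part R"
    using x u v by (intro even_even smult_even)
  ultimately show ?thesis using that by blast
qed

end

section \<open>Square roots in word algebras\<close>

lemma sqrt_poly:
  "\<exists>p r :: complex poly. p * p = [:1, 1:] + monom 1 (Suc K) * r \<and> coeff p 0 = 1"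
proof (induction K)
  case 0
  have "(1 :: complex poly) * 1 = [:1, 1:] + monom 1 (Suc 0) * [:-1:]"
    by (simp add: monom_Suc monom_0 one_pCons)
  then show ?case
    by (intro exI[of _ 1] exI[of _ "[:-1:]"]) simp
next
  case (Suc K)
  then obtain p r :: "complex poly" where pr: "p * p = [:1, 1:] + monom 1 (Suc K) * r" "coeff p 0 = 1"
    by blast
  \<comment> \<open>As \<open>p\<close> has constant coefficient 1, subtracting
    \<open>?c / 2\<close> times x^(K + 1) from it changes the square by \<open>- ?c\<close> in
    degree K + 1. This cancels the lowest term of the error; the factor \<open>r'\<close> that
    remains is divisible by x.\<close>
  let ?c = "coeff r 0"
  define r' where "r' = r - smult ?c p + monom (?c\<^sup>2 / 4) (Suc K)"
  define p' where "p' = p - monom (?c / 2) (Suc K)"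
  have "coeff r' 0 = 0"
    using pr(2) by (simp add: r'_def)
  then obtain r'' where r'': "r' = monom 1 1 * r''"
    using poly_eq_iff[of r' 0] by (cases r') (auto simp: monom_Suc monom_0)
  have "p' * p' = p * p - smult ?c (monom 1 (Suc K) * p) + monom (?c\<^sup>2 / 4) (Suc K + Suc K)"
  proof -
    have "monom (?c / 2) (Suc K) = smult (?c / 2) (monom 1 (Suc K))"
      by (simp add: smult_monom)
    moreover have "monom (?c\<^sup>2 / 4) (Suc K + Suc K) = smult (?c\<^sup>2 / 4) (monom 1 (Suc K) * monom 1 (Suc K))"
      by (simp add: smult_monom mult_monom)
    moreover have "smult (?c / 2) (monom 1 (Suc K) * p) + smult (?c / 2) (monom 1 (Suc K) * p) =
        smult ?c (monom 1 (Suc K) * p)"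
      by (simp flip: smult_add_left)
    ultimately show ?thesis
      by (simp add: p'_def algebra_simps power2_eq_square)
  qed
  also have "\<dots> = [:1, 1:] + monom 1 (Suc K) * r'"
    by (simp add: pr(1) r'_def algebra_simps mult_monom)
  also have "monom 1 (Suc K) * r' = monom 1 (Suc (Suc K)) * r''"
    unfolding r'' by (simp add: mult_monom flip: mult.assoc)
  finally show ?case
    using pr(2) by (intro exI[of _ p'] exI[of _ r'']) (simp add: p'_def)
qed

lemma const_commute:
  fixes p :: "'m::monoid_add \<Rightarrow>\<^sub>0 complex"
  shows "p * const c = const c * p"
  by (induction p rule: poly_mapping_add_induct) (simp_all add: algebra_simps mult_single)

text \<open>Substitution of \<open>w\<close> for the variable by Horner's rule. It is multiplicative
  in a noncommutative algebra because only \<open>w\<close> and central constants occur.\<close>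

definition alg_poly :: "('m::monoid_add \<Rightarrow>\<^sub>0 complex) \<Rightarrow> complex poly \<Rightarrow> 'm \<Rightarrow>\<^sub>0 complex" where
  "alg_poly w p = fold_coeffs (\<lambda>a b. const a + w * b) p 0"

lemma alg_poly_0 [simp]: "alg_poly w 0 = 0"
  by (simp add: alg_poly_def)

lemma alg_poly_pCons [simp]: "alg_poly w (pCons a p) = const a + w * alg_poly w p"
  by (cases "p = 0 \<and> a = 0") (auto simp: alg_poly_def)

lemma alg_poly_add: "alg_poly w (p + q) = alg_poly w p + alg_poly w q"
  by (induction p q rule: poly_induct2) (auto simp: single_add algebra_simps)

lemma alg_poly_smult: "alg_poly w (Polynomial.smult a p) = const a * alg_poly w p"
proof (induction p)
  case (pCons b p)
  have "w * (const a * alg_poly w p) = const a * (w * alg_poly w p)"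
    using const_commute[of w a] by (metis mult.assoc)
  with pCons show ?case
    by (simp add: distrib_left mult_single)
qed simp

lemma alg_poly_mult: "alg_poly w (p * q) = alg_poly w p * alg_poly w q"
  by (induction p) (auto simp: alg_poly_add alg_poly_smult distrib_right mult.assoc)

lemma alg_poly_monom: "alg_poly w (monom 1 k) = w ^ k"
  by (induction k) (auto simp: monom_0 monom_Suc)

lemma (in monoid_eval) ev_alg_poly_even:
  assumes "ev w \<in> even_part R"
  shows "ev (alg_poly w p) \<in> even_part R"
  using assms by (induction p) (auto simp: even_zero intro!: even_add even_even smult_even one_even)

text \<open>Taking the constant term is multiplicative because a concatenation is empty only if both
  parts are.\<close>

lemma lookup_mult_Nil:
  fixes p q :: "'l list \<Rightarrow>\<^sub>0 complex"
  shows "Poly_Mapping.lookup (p * q) 0 = Poly_Mapping.lookup p 0 * Poly_Mapping.lookup q 0"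
proof (induction p rule: poly_mapping_add_induct)
  case (add u c p)
  have "Poly_Mapping.lookup (Poly_Mapping.single u c * q) 0 =
      Poly_Mapping.lookup (Poly_Mapping.single u c) 0 * Poly_Mapping.lookup q 0"
    by (induction q rule: poly_mapping_add_induct)
       (auto simp: algebra_simps mult_single lookup_add lookup_single when_def zero_list_def plus_list_def)
  with add show ?case
    by (simp add: algebra_simps lookup_add)
qed simp

lemma lookup_prod_list_Nil:
  fixes ps :: "('l list \<Rightarrow>\<^sub>0 complex) list"
  shows "Poly_Mapping.lookup (prod_list ps) 0 = prod_list (map (\<lambda>p. Poly_Mapping.lookup p 0) ps)"
  by (induction ps) (auto simp: lookup_mult_Nil lookup_one)

lemma lookup_sum: "Poly_Mapping.lookup (\<Sum>x\<in>A. f x) k = (\<Sum>x\<in>A. Poly_Mapping.lookup (f x) k)"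
  by (induction A rule: infinite_finite_induct) (auto simp: lookup_add)

lemma lookup_alg_det_Nil:
  fixes a :: "nat \<Rightarrow> nat \<Rightarrow> 'l list \<Rightarrow>\<^sub>0 complex"
  shows "Poly_Mapping.lookup (alg_det m a) 0 = det (mat m m (\<lambda>(i, j). Poly_Mapping.lookup (a i j) 0))"
proof -
  have p: "p i < m" if "p permutes {..<m}" "i < m" for p i
    using that by (simp add: permutes_less_iff)
  have "prod_list (map (\<lambda>i. Poly_Mapping.lookup (a i (p i)) 0) [0..<m]) =
      (\<Prod>i = 0..<m. mat m m (\<lambda>(i, j). Poly_Mapping.lookup (a i j) 0) $$ (i, p i))"
    if "p permutes {..<m}" for p
    using p[OF that] by (simp flip: prod.distinct_set_conv_list)
  then show ?thesis
    by (simp add: alg_det_def det_def atLeast0LessThan lookup_sum lookup_mult_Nil lookup_prod_list_Nil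
        o_def del: single_of_int)
qed

text \<open>Without a constant term, each factor \<open>w\<close> contributes at least one letter to
  every word.\<close>

lemma keys_power_length:
  fixes w :: "'l list \<Rightarrow>\<^sub>0 complex"
  assumes "Poly_Mapping.lookup w 0 = 0" "u \<in> Poly_Mapping.keys (w ^ k * p)"
  shows "k \<le> length u"
  using assms(2)
proof (induction k arbitrary: u)
  case (Suc k)
  then obtain a b where ab: "u = a + b" "a \<in> Poly_Mapping.keys w" "b \<in> Poly_Mapping.keys (w ^ k * p)"
    using keys_mult[of w "w ^ k * p"] by (auto simp: mult.assoc)
  have "a \<noteq> []"
    using assms(1) ab(2) by (auto simp: in_keys_iff zero_list_def)
  then show ?case
    using Suc.IH[OF ab(3)] ab(1) by (cases a) (auto simp: plus_list_def)
qed simp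

lemma lookup_alg_poly_Nil:
  fixes w :: "'l list \<Rightarrow>\<^sub>0 complex"
  assumes "Poly_Mapping.lookup w 0 = 0"
  shows "Poly_Mapping.lookup (alg_poly w p) 0 = coeff p 0"
  using assms by (cases p) (simp add: lookup_add lookup_mult_Nil)

lemma (in odd_eval) ev_long_words:
  assumes "finite L" "\<And>l. l \<notin> L \<Longrightarrow> \<rho> l = \<zero>" "\<And>u. u \<in> Poly_Mapping.keys p \<Longrightarrow> card L < length u"
  shows "ev p = \<zero>"
  unfolding alg_eval_def using assms
  by (intro add.finprod_one_eqI) (auto simp: word_val_long smult_zero_right)

text \<open>Substitute \<open>w\<close> into a polynomial square root of 1 + x with an error of
  order \<open>card L + 1\<close>. The error then consists of words longer than
  \<open>card L\<close>, which vanish in odd letters supported on \<open>L\<close>, so the root is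
  exact. The same \<open>s\<close> serves all \<open>R\<close> and \<open>\<rho>\<close>.\<close>

lemma word_sqrt:
  fixes w :: "'l list \<Rightarrow>\<^sub>0 complex"
  assumes "Poly_Mapping.lookup w 0 = 0" "finite L"
  obtains s where "Poly_Mapping.lookup s 0 = 1"
    and "\<And>(R :: 'a superalg) \<rho>. odd_eval R \<rho> \<Longrightarrow> (\<And>l. l \<notin> L \<Longrightarrow> \<rho> l = \<zero>\<^bsub>R\<^esub>) \<Longrightarrow>
      alg_eval R (word_val R \<rho>) w \<in> even_part R \<Longrightarrow>
      alg_eval R (word_val R \<rho>) s \<in> even_part R \<and>
      alg_eval R (word_val R \<rho>) s \<otimes>\<^bsub>R\<^esub> alg_eval R (word_val R \<rho>) s =
        \<one>\<^bsub>R\<^esub> \<oplus>\<^bsub>R\<^esub> alg_eval R (word_val R \<rho>) w"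
proof -
  obtain p r :: "complex poly" where pr: "p * p = [:1, 1:] + monom 1 (Suc (card L)) * r" "coeff p 0 = 1"
    using sqrt_poly by blast
  let ?s = "alg_poly w p"
  have s: "?s * ?s = 1 + w + w ^ Suc (card L) * alg_poly w r"
    unfolding alg_poly_mult[symmetric] pr(1) alg_poly_add by (simp add: alg_poly_mult alg_poly_monom del: power_Suc)
  show thesis
  proof (rule that[of ?s])
    show "Poly_Mapping.lookup ?s 0 = 1"
      using assms pr(2) by (simp add: lookup_alg_poly_Nil)
    fix R :: "'a superalg" and \<rho>
    assume "odd_eval R \<rho>" and L: "\<And>l. l \<notin> L \<Longrightarrow> \<rho> l = \<zero>\<^bsub>R\<^esub>"
      and w: "alg_eval R (word_val R \<rho>) w \<in> even_part R"
    interpret odd_eval R \<rho> by fact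
    have "ev (w ^ Suc (card L) * alg_poly w r) = \<zero>\<^bsub>R\<^esub>"
      using keys_power_length[OF assms(1), of _ "Suc (card L)" "alg_poly w r"] assms(2) L
      by (intro ev_long_words[of L]) (auto simp: Suc_le_eq)
    then have "ev (?s * ?s) = \<one>\<^bsub>R\<^esub> \<oplus>\<^bsub>R\<^esub> ev w"
      unfolding s by (simp del: ev_mult)
    then show "ev ?s \<in> even_part R \<and> ev ?s \<otimes>\<^bsub>R\<^esub> ev ?s = \<one>\<^bsub>R\<^esub> \<oplus>\<^bsub>R\<^esub> ev w"
      using ev_alg_poly_even[OF w] by simp
  qed
qed

section \<open>Words in the solution of a linear system\<close>

text \<open>The even and odd coordinates of a tuple as values of letters \<open>(i, e)\<close>. The
  value zero off the index range provides the value in the carrier that an evaluation needs for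
  every letter.\<close>

definition coord ::
  "'v set \<Rightarrow> 'v set \<Rightarrow> nat \<Rightarrow> 'a superalg \<Rightarrow> (nat \<Rightarrow> 'v \<Rightarrow> 'a) \<Rightarrow> nat \<times> 'v \<Rightarrow> 'a" where
  "coord E0 E1 m R v = (\<lambda>(i, e). if i < m \<and> e \<in> E0 \<union> E1 then v i e else \<zero>\<^bsub>R\<^esub>)"

locale enumerated_basis =
  fixes E0 E1 :: "'v set" and m :: nat and en :: "nat \<Rightarrow> 'v"
  assumes enum: "bij_betw en {..<m} E0"
    and finite_E1: "finite E1"
    and disjoint: "E0 \<inter> E1 = {}"
begin

lemma en_in: "i < m \<Longrightarrow> en i \<in> E0"
  using enum by (auto simp: bij_betw_def)

definition frame_det :: "'a superalg \<Rightarrow> (nat \<Rightarrow> 'v \<Rightarrow> 'a) \<Rightarrow> 'a" where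
  "frame_det R v = super_det R m (\<lambda>i k. v i (en k))"

text \<open>The relation \<theta> = X Y, stated without inverting X. The vanishing of
  \<open>Y\<close> outside \<open>{..<m} \<times> E1\<close> leaves only finitely many odd
  letters.\<close>

definition solution :: "'a superalg \<Rightarrow> (nat \<Rightarrow> 'v \<Rightarrow> 'a) \<Rightarrow> (nat \<times> 'v \<Rightarrow> 'a) \<Rightarrow> bool" where
  "solution R v Y \<longleftrightarrow> odd_eval R Y \<and> v \<in> power_points E0 E1 m R \<and>
     (\<forall>l. l \<notin> {..<m} \<times> E1 \<longrightarrow> Y l = \<zero>\<^bsub>R\<^esub>) \<and>
     (\<forall>i<m. \<forall>\<alpha>\<in>E1. v i \<alpha> = (\<Oplus>\<^bsub>R\<^esub>k\<in>{..<m}. v i (en k) \<otimes>\<^bsub>R\<^esub> Y (k, \<alpha>)))"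

lemma power_pointsD:
  assumes "v \<in> power_points E0 E1 m R" "i < m"
  shows "e \<in> E0 \<Longrightarrow> v i e \<in> even_part R" "e \<in> E1 \<Longrightarrow> v i e \<in> odd_part R"
  using assms by (auto simp: power_points_def affine_points_def PiE_iff)

lemma coord_simps [simp]:
  "i < m \<Longrightarrow> k < m \<Longrightarrow> coord E0 E1 m R v (i, en k) = v i (en k)"
  "i < m \<Longrightarrow> \<alpha> \<in> E1 \<Longrightarrow> coord E0 E1 m R v (i, \<alpha>) = v i \<alpha>"
  using en_in by (auto simp: coord_def)

lemma word_eval_coord:
  assumes "comm_superalgebra R" "v \<in> power_points E0 E1 m R"
  shows "word_eval R (coord E0 E1 m R v)"
proof -
  interpret comm_superalgebra R by fact
  show ?thesis
    by unfold_locales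
       (use power_pointsD[OF assms(2)] even_closed odd_closed in \<open>auto simp: coord_def\<close>)
qed

lemma frame_det_even:
  assumes "comm_superalgebra R" "v \<in> power_points E0 E1 m R"
  shows "frame_det R v \<in> even_part R"
  unfolding frame_det_def using assms power_pointsD[OF assms(2)] en_in
  by (intro comm_superalgebra.super_det_even) auto

abbreviation frame_word :: "(nat \<times> 'v) list \<Rightarrow>\<^sub>0 complex" where
  "frame_word \<equiv> alg_det m (\<lambda>i k. letter (i, en k))"

lemma eval_frame_word:
  assumes R: "comm_superalgebra R" and v: "v \<in> power_points E0 E1 m R"
  shows "alg_eval R (word_val R (coord E0 E1 m R v)) frame_word = frame_det R v"
proof -
  interpret word_eval R "coord E0 E1 m R v"
    by (rule word_eval_coord[OF R v])
  have "v i (en k) \<in> even_part R" if "i < m" "k < m" for i k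
    using power_pointsD[OF v] en_in that by auto
  then show ?thesis
    unfolding frame_det_def
    by (subst ev_alg_det) (auto simp: smult_one even_closed intro!: super_det_cong)
qed

text \<open>Cramer's rule for one column, with a formal \<open>\<Phi>\<close> that is the same for
  all super algebras. A list with a repetition gives a word with a repeated odd letter, and
  \<open>\<Phi>\<close> is then zero.\<close>

lemma extend_column_word:
  assumes \<alpha>: "\<alpha> \<in> E1" and ks: "set ks \<subseteq> {..<m}"
  shows "\<exists>\<Phi>. \<forall>(R :: 'a superalg) v Y. solution R v Y \<longrightarrow>
    alg_eval R (word_val R (coord E0 E1 m R v)) \<Phi> =
      frame_det R v \<otimes>\<^bsub>R\<^esub> word_val R Y (map (\<lambda>k. (k, \<alpha>)) ks)"
proof (cases "distinct ks")
  case True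
  let ?js = "filter (\<lambda>j. j \<notin> set ks) [0..<m]"
  \<comment> \<open>The left-hand side of \<open>super_cramer\<close> with letters for the entries;
    the scalar removes the factorial on its right-hand side.\<close>
  define \<Phi> :: "(nat \<times> 'v) list \<Rightarrow>\<^sub>0 complex" where
    "\<Phi> = const (1 / fact (length ks)) * (\<Sum>p | p permutes {..<m}. const (of_int (sign p)) *
       (prod_list (map (\<lambda>j. letter (p j, en j)) ?js) * prod_list (map (\<lambda>i. letter (p i, \<alpha>)) ks)))"
  have "alg_eval R (word_val R (coord E0 E1 m R v)) \<Phi> =
      frame_det R v \<otimes>\<^bsub>R\<^esub> word_val R Y (map (\<lambda>k. (k, \<alpha>)) ks)"
    if sol: "solution R v Y" for R :: "'a superalg" and v Y
  proof -
    have Y: "odd_eval R Y" and v: "v \<in> power_points E0 E1 m R"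
      and lin: "\<And>i. i < m \<Longrightarrow> v i \<alpha> = (\<Oplus>\<^bsub>R\<^esub>k\<in>{..<m}. v i (en k) \<otimes>\<^bsub>R\<^esub> Y (k, \<alpha>))"
      using sol \<alpha> by (auto simp: solution_def)
    interpret odd_eval R Y by (fact Y)
    interpret c: word_eval R "coord E0 E1 m R v"
      by (rule word_eval_coord[OF comm_superalgebra_axioms v])
    have Y': "odd_eval R (\<lambda>k. Y (k, \<alpha>))"
      by unfold_locales (rule letter_odd)
    have X: "v i (en k) \<in> even_part R" if "i < m" "k < m" for i k
      using power_pointsD[OF v] en_in that by auto
    have w: "word_val R (\<lambda>k. Y (k, \<alpha>)) ks = word_val R Y (map (\<lambda>k. (k, \<alpha>)) ks)"
      by (simp add: word_val_def o_def)
    have monomial: "c.ev (prod_list (map (\<lambda>j. letter (p j, en j)) ?js) * prod_list (map (\<lambda>i. letter (p i, \<alpha>)) ks)) =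
        mprod R (map (\<lambda>j. v (p j) (en j)) ?js) \<otimes>\<^bsub>R\<^esub> mprod R (map (\<lambda>i. v (p i) \<alpha>) ks)"
      if "p permutes {..<m}" for p
    proof -
      have pm: "p i < m" if "i < m" for i
        using that \<open>p permutes {..<m}\<close> permutes_in_image by fastforce
      have "map (\<lambda>j. c.ev (letter (p j, en j))) ?js = map (\<lambda>j. v (p j) (en j)) ?js"
        "map (\<lambda>i. c.ev (letter (p i, \<alpha>))) ks = map (\<lambda>i. v (p i) \<alpha>) ks"
        using pm ks \<alpha> by (auto simp: c.ev_letter simp del: c.ev_single)
      then show ?thesis
        by (simp only: c.ev_mult c.ev_prod_list map_map o_def)
    qed
    have "c.ev \<Phi> = (1 / fact (length ks)) \<odot>\<^bsub>R\<^esub> (\<Oplus>\<^bsub>R\<^esub>p\<in>{p. p permutes {..<m}}. of_int (sign p) \<odot>\<^bsub>R\<^esub>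
        (mprod R (map (\<lambda>j. v (p j) (en j)) ?js) \<otimes>\<^bsub>R\<^esub> mprod R (map (\<lambda>i. v (p i) \<alpha>) ks)))"
      unfolding \<Phi>_def c.ev_const_mult c.ev_sum
      by (intro arg_cong[of _ _ "\<lambda>x. _ \<odot>\<^bsub>R\<^esub> x"] finsum_cong')
         (auto simp: monomial[symmetric] simp del: c.ev_mult single_of_int intro!: smult_closed)
    also have "\<dots> = (1 / fact (length ks)) \<odot>\<^bsub>R\<^esub>
        (fact (length ks) \<odot>\<^bsub>R\<^esub> (frame_det R v \<otimes>\<^bsub>R\<^esub> word_val R (\<lambda>k. Y (k, \<alpha>)) ks))"
      unfolding frame_det_def
      using super_cramer[OF Y', of m "\<lambda>i k. v i (en k)" "\<lambda>i. v i \<alpha>" ks] X lin True ks by simp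
    also have "\<dots> = frame_det R v \<otimes>\<^bsub>R\<^esub> word_val R (\<lambda>k. Y (k, \<alpha>)) ks"
      using frame_det_even[OF comm_superalgebra_axioms v] even_closed w
      by (simp add: smult_one flip: smult_smult)
    finally show ?thesis
      by (simp add: w)
  qed
  then show ?thesis by blast
next
  case False
  have "alg_eval R (word_val R (coord E0 E1 m R v)) 0 =
      frame_det R v \<otimes>\<^bsub>R\<^esub> word_val R Y (map (\<lambda>k. (k, \<alpha>)) ks)"
    if sol: "solution R v Y" for R :: "'a superalg" and v Y
  proof -
    have Y: "odd_eval R Y" and v: "v \<in> power_points E0 E1 m R"
      using sol by (auto simp: solution_def)
    interpret odd_eval R Y by (fact Y)
    have "word_val R Y (map (\<lambda>k. (k, \<alpha>)) ks) = \<zero>\<^bsub>R\<^esub>"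
      using False by (intro word_val_not_distinct) (auto simp: distinct_map)
    then show ?thesis
      using frame_det_even[OF comm_superalgebra_axioms v] even_closed by (simp add: alg_eval_def)
  qed
  then show ?thesis by blast
qed

text \<open>Up to a sign the word is sorted by columns, and each column uses up one factor
  \<open>frame_det\<close>. A column that does not occur in \<open>u\<close> also takes its factor,
  so that the exponent is the same for all words.\<close>

lemma extend_word_columns:
  assumes "finite S" "S \<subseteq> E1" "set u \<subseteq> {..<m} \<times> S"
  shows "\<exists>\<Phi>. \<forall>(R :: 'a superalg) v Y. solution R v Y \<longrightarrow>
    alg_eval R (word_val R (coord E0 E1 m R v)) \<Phi> =
      frame_det R v [^]\<^bsub>R\<^esub> card S \<otimes>\<^bsub>R\<^esub> word_val R Y u"
  using assms
proof (induction S arbitrary: u)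
  case empty
  have "alg_eval R (word_val R (coord E0 E1 m R v)) 1 =
      frame_det R v [^]\<^bsub>R\<^esub> card ({} :: 'v set) \<otimes>\<^bsub>R\<^esub> word_val R Y u"
    if "solution R v Y" for R :: "'a superalg" and v Y
  proof -
    have Y: "odd_eval R Y" and v: "v \<in> power_points E0 E1 m R"
      using that by (auto simp: solution_def)
    interpret odd_eval R Y by (fact Y)
    interpret c: word_eval R "coord E0 E1 m R v"
      by (rule word_eval_coord[OF comm_superalgebra_axioms v])
    show ?thesis using empty by simp
  qed
  then show ?case by blast
next
  case (insert \<alpha> S)
  let ?P = "\<lambda>l. snd l = \<alpha>"
  let ?ks = "map fst (filter ?P u)" and ?u = "filter (\<lambda>l. \<not> ?P l) u"
  have ks: "map (\<lambda>k. (k, \<alpha>)) ?ks = filter ?P u"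
    by (induction u) auto
  obtain \<Phi> where \<Phi>: "alg_eval R (word_val R (coord E0 E1 m R v)) \<Phi> =
      frame_det R v \<otimes>\<^bsub>R\<^esub> word_val R Y (filter ?P u)"
    if "solution R v Y" for R :: "'a superalg" and v Y
    using extend_column_word[of \<alpha> ?ks] insert.prems unfolding ks by fastforce
  obtain \<Psi> where \<Psi>: "alg_eval R (word_val R (coord E0 E1 m R v)) \<Psi> =
      frame_det R v [^]\<^bsub>R\<^esub> card S \<otimes>\<^bsub>R\<^esub> word_val R Y ?u"
    if "solution R v Y" for R :: "'a superalg" and v Y
  proof -
    have "set ?u \<subseteq> {..<m} \<times> S"
      using insert.prems by auto
    then show ?thesis
      using that insert.IH[of ?u] insert.prems by auto
  qed
  obtain \<epsilon> where \<epsilon>: "word_val R Y u = \<epsilon> \<odot>\<^bsub>R\<^esub> (word_val R Y (filter ?P u) \<otimes>\<^bsub>R\<^esub> word_val R Y ?u)"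
    if "odd_eval R Y" for R :: "'a superalg" and Y
    using word_val_partition[of u ?P] by blast
  have "alg_eval R (word_val R (coord E0 E1 m R v)) (const \<epsilon> * (\<Phi> * \<Psi>)) =
      frame_det R v [^]\<^bsub>R\<^esub> card (insert \<alpha> S) \<otimes>\<^bsub>R\<^esub> word_val R Y u"
    if sol: "solution R v Y" for R :: "'a superalg" and v Y
  proof -
    have Y: "odd_eval R Y" and v: "v \<in> power_points E0 E1 m R"
      using sol by (auto simp: solution_def)
    interpret odd_eval R Y by (fact Y)
    interpret c: word_eval R "coord E0 E1 m R v"
      by (rule word_eval_coord[OF comm_superalgebra_axioms v])
    let ?d = "frame_det R v" and ?A = "word_val R Y (filter ?P u)" and ?B = "word_val R Y ?u"
    have d: "?d \<in> even_part R" "?d \<in> carrier R"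
      using frame_det_even[OF comm_superalgebra_axioms v] even_closed by auto
    have dk: "?d [^]\<^bsub>R\<^esub> k \<in> even_part R" for k :: nat
      using d by (induction k) (auto simp: one_even even_even)
    have "c.ev (const \<epsilon> * (\<Phi> * \<Psi>)) = \<epsilon> \<odot>\<^bsub>R\<^esub> (?d \<otimes>\<^bsub>R\<^esub> (?A \<otimes>\<^bsub>R\<^esub> ?d [^]\<^bsub>R\<^esub> card S) \<otimes>\<^bsub>R\<^esub> ?B)"
      unfolding c.ev_const_mult using d by (simp add: \<Phi>[OF sol] \<Psi>[OF sol] m_assoc)
    also have "?A \<otimes>\<^bsub>R\<^esub> ?d [^]\<^bsub>R\<^esub> card S = ?d [^]\<^bsub>R\<^esub> card S \<otimes>\<^bsub>R\<^esub> ?A"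
      using even_comm[OF dk] by simp
    also have "\<epsilon> \<odot>\<^bsub>R\<^esub> (?d \<otimes>\<^bsub>R\<^esub> (?d [^]\<^bsub>R\<^esub> card S \<otimes>\<^bsub>R\<^esub> ?A) \<otimes>\<^bsub>R\<^esub> ?B) =
        (?d [^]\<^bsub>R\<^esub> Suc (card S)) \<otimes>\<^bsub>R\<^esub> (\<epsilon> \<odot>\<^bsub>R\<^esub> (?A \<otimes>\<^bsub>R\<^esub> ?B))"
      unfolding nat_pow_Suc2[OF d(2)] using d by (simp add: smult_mult_right m_assoc)
    also have "\<epsilon> \<odot>\<^bsub>R\<^esub> (?A \<otimes>\<^bsub>R\<^esub> ?B) = word_val R Y u"
      using \<epsilon>[OF Y] by simp
    finally show ?thesis
      using insert.hyps by simp
  qed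
  then show ?case by blast
qed

text \<open>The exponent \<open>card E1\<close> is common to all words, so the previous result
  extends linearly. Words with a letter outside the index range have value zero.\<close>

lemma extend_words:
  "\<exists>\<Phi>. \<forall>(R :: 'a superalg) v Y. solution R v Y \<longrightarrow>
    alg_eval R (word_val R (coord E0 E1 m R v)) \<Phi> =
      frame_det R v [^]\<^bsub>R\<^esub> card E1 \<otimes>\<^bsub>R\<^esub> alg_eval R (word_val R Y) p"
proof (induction p rule: poly_mapping_add_induct)
  case zero
  have "alg_eval R (word_val R (coord E0 E1 m R v)) 0 =
      frame_det R v [^]\<^bsub>R\<^esub> card E1 \<otimes>\<^bsub>R\<^esub> alg_eval R (word_val R Y) 0"
    if "solution R v Y" for R :: "'a superalg" and v Y
  proof -
    have Y: "odd_eval R Y" and v: "v \<in> power_points E0 E1 m R"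
      using that by (auto simp: solution_def)
    interpret odd_eval R Y by (fact Y)
    show ?thesis
      using frame_det_even[OF comm_superalgebra_axioms v] even_closed by (simp add: alg_eval_def)
  qed
  then show ?case by blast
next
  case (add u c p)
  obtain \<Phi> where \<Phi>: "alg_eval R (word_val R (coord E0 E1 m R v)) \<Phi> =
      frame_det R v [^]\<^bsub>R\<^esub> card E1 \<otimes>\<^bsub>R\<^esub> alg_eval R (word_val R Y) p"
    if "solution R v Y" for R :: "'a superalg" and v Y
    using add.IH by blast
  obtain \<Psi> where \<Psi>: "alg_eval R (word_val R (coord E0 E1 m R v)) \<Psi> =
      frame_det R v [^]\<^bsub>R\<^esub> card E1 \<otimes>\<^bsub>R\<^esub> word_val R Y u"
    if "solution R v Y" for R :: "'a superalg" and v Y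
  proof (cases "set u \<subseteq> {..<m} \<times> E1")
    case True
    then show ?thesis
      using that extend_word_columns[OF finite_E1 subset_refl True] by blast
  next
    case False
    then obtain l where l: "l \<in> set u" "l \<notin> {..<m} \<times> E1"
      by blast
    have "alg_eval R (word_val R (coord E0 E1 m R v)) 0 =
        frame_det R v [^]\<^bsub>R\<^esub> card E1 \<otimes>\<^bsub>R\<^esub> word_val R Y u"
      if "solution R v Y" for R :: "'a superalg" and v Y
    proof -
      have Y: "odd_eval R Y" and v: "v \<in> power_points E0 E1 m R" and "Y l = \<zero>\<^bsub>R\<^esub>"
        using that l unfolding solution_def by blast+
      interpret odd_eval R Y by (fact Y)
      have "word_val R Y u = \<zero>\<^bsub>R\<^esub>"
        using \<open>Y l = \<zero>\<^bsub>R\<^esub>\<close> l(1) by (auto dest!: split_list)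
      then show ?thesis
        using frame_det_even[OF comm_superalgebra_axioms v] even_closed by (simp add: alg_eval_def)
    qed
    then show ?thesis using that by blast
  qed
  have "alg_eval R (word_val R (coord E0 E1 m R v)) (const c * \<Psi> + \<Phi>) =
      frame_det R v [^]\<^bsub>R\<^esub> card E1 \<otimes>\<^bsub>R\<^esub> alg_eval R (word_val R Y) (Poly_Mapping.single u c + p)"
    if sol: "solution R v Y" for R :: "'a superalg" and v Y
  proof -
    have Y: "odd_eval R Y" and v: "v \<in> power_points E0 E1 m R"
      using sol by (auto simp: solution_def)
    interpret odd_eval R Y by (fact Y)
    interpret c: word_eval R "coord E0 E1 m R v"
      by (rule word_eval_coord[OF comm_superalgebra_axioms v])
    show ?thesis
      using frame_det_even[OF comm_superalgebra_axioms v] even_closed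
      by (simp add: \<Phi>[OF sol] \<Psi>[OF sol] r_distr smult_mult_right smult_closed del: c.ev_mult)
  qed
  then show ?case by blast
qed

end

section \<open>Factorization of the Gram determinant\<close>

lemma (in comm_superalgebra) even_nil_finsum:
  "(\<And>x. x \<in> A \<Longrightarrow> f x \<in> even_nil) \<Longrightarrow> (\<Oplus>x\<in>A. f x) \<in> even_nil"
proof (induction A rule: infinite_finite_induct)
  case (insert x F)
  then show ?case
    by (subst finsum_insert) (auto intro!: even_nil_add even_closed even_nilD)
qed (auto simp: even_nil_zero)

text \<open>With \<theta> = X Y this is the identity \<theta> C \<theta>^T = X (Y C Y^T) X^T, where
  C has the entries \<open>c \<alpha> \<beta>\<close>. Only the even entries of X have to move past
  entries of Y.\<close>

lemma (in comm_superalgebra) bilinear_substitution: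
  fixes m :: nat and A :: "'b set"
  assumes X: "\<And>i k. i < m \<Longrightarrow> k < m \<Longrightarrow> X i k \<in> even_part R"
    and Y: "\<And>k \<alpha>. Y k \<alpha> \<in> carrier R"
    and \<theta>: "\<And>i \<alpha>. i < m \<Longrightarrow> \<alpha> \<in> A \<Longrightarrow> \<theta> i \<alpha> = (\<Oplus>k\<in>{..<m}. X i k \<otimes> Y k \<alpha>)"
    and ij: "i < m" "j < m"
  shows "(\<Oplus>\<alpha>\<in>A. \<Oplus>\<beta>\<in>A. c \<alpha> \<beta> \<odot> (\<theta> i \<alpha> \<otimes> \<theta> j \<beta>)) =
    (\<Oplus>k\<in>{..<m}. \<Oplus>l\<in>{..<m}. X i k \<otimes> (\<Oplus>\<alpha>\<in>A. \<Oplus>\<beta>\<in>A. c \<alpha> \<beta> \<odot> (Y k \<alpha> \<otimes> Y l \<beta>)) \<otimes> X j l)"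
proof -
  let ?x = "\<lambda>i k. letter (X i k)" and ?y = "\<lambda>k \<alpha>. letter (Y k \<alpha>)"
  have Xc: "X i k \<in> carrier R" if "i < m" "k < m" for i k
    using X[OF that] by (rule even_closed)
  have \<theta>_ev: "wev.ev (\<Sum>k<m. ?x i k * ?y k \<alpha>) = \<theta> i \<alpha>" if "i < m" "\<alpha> \<in> A" for i \<alpha>
    unfolding wev.ev_sum \<theta>[OF that] using Xc Y that by (intro finsum_cong') auto
  have \<theta>c: "\<theta> i \<alpha> \<in> carrier R" if "i < m" "\<alpha> \<in> A" for i \<alpha>
    unfolding \<theta>_ev[OF that, symmetric] by (rule wev.ev_closed)
  have "(\<Oplus>\<alpha>\<in>A. \<Oplus>\<beta>\<in>A. c \<alpha> \<beta> \<odot> (\<theta> i \<alpha> \<otimes> \<theta> j \<beta>)) =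
      wev.ev (\<Sum>\<alpha>\<in>A. \<Sum>\<beta>\<in>A. const (c \<alpha> \<beta>) * ((\<Sum>k<m. ?x i k * ?y k \<alpha>) * (\<Sum>l<m. ?x j l * ?y l \<beta>)))"
    unfolding wev.ev_sum[of _ A] wev.ev_const_mult wev.ev_mult[of "sum _ {..<m}" "sum _ {..<m}"]
    using \<theta>c ij by (intro finsum_cong') (auto simp: \<theta>_ev intro!: finsum_closed smult_closed)
  also have "(\<Sum>\<alpha>\<in>A. \<Sum>\<beta>\<in>A. const (c \<alpha> \<beta>) * ((\<Sum>k<m. ?x i k * ?y k \<alpha>) * (\<Sum>l<m. ?x j l * ?y l \<beta>))) =
      (\<Sum>\<alpha>\<in>A. \<Sum>\<beta>\<in>A. \<Sum>k<m. \<Sum>l<m. const (c \<alpha> \<beta>) * (?x i k * ?y k \<alpha> * (?x j l * ?y l \<beta>)))"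
    by (simp only: sum_product) (simp only: sum_distrib_left)
  also have "\<dots> = (\<Sum>k<m. \<Sum>l<m. \<Sum>\<alpha>\<in>A. \<Sum>\<beta>\<in>A. const (c \<alpha> \<beta>) * (?x i k * ?y k \<alpha> * (?x j l * ?y l \<beta>)))"
  proof -
    have swap3: "(\<Sum>\<beta>\<in>A. \<Sum>k<m. \<Sum>l<m. g \<beta> k l) = (\<Sum>k<m. \<Sum>l<m. \<Sum>\<beta>\<in>A. g \<beta> k l)"
      for g :: "'b \<Rightarrow> nat \<Rightarrow> nat \<Rightarrow> 'a list \<Rightarrow>\<^sub>0 complex"
      by (subst sum.swap) (intro sum.cong refl, rule sum.swap)
    show ?thesis
      by (simp only: swap3)
  qed
  also have "wev.ev \<dots> =
      (\<Oplus>k\<in>{..<m}. \<Oplus>l\<in>{..<m}. X i k \<otimes> (\<Oplus>\<alpha>\<in>A. \<Oplus>\<beta>\<in>A. c \<alpha> \<beta> \<odot> (Y k \<alpha> \<otimes> Y l \<beta>)) \<otimes> X j l)"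
    unfolding wev.ev_sum
  proof (intro finsum_cong' refl)
    fix k l assume kl: "k \<in> {..<m}" "l \<in> {..<m}"
    have entry: "wev.ev (const (c \<alpha> \<beta>) * (?x i k * ?y k \<alpha> * (?x j l * ?y l \<beta>))) =
        wev.ev (?x i k * (const (c \<alpha> \<beta>) * (?y k \<alpha> * ?y l \<beta>)) * ?x j l)" for \<alpha> \<beta>
    proof -
      have x: "X i k \<in> even_part R" "X j l \<in> even_part R"
        using X ij kl by auto
      have comm: "X j l \<otimes> Y l \<beta> = Y l \<beta> \<otimes> X j l"
        using even_comm[OF x(2) Y] .
      show ?thesis
        using x Y by (simp add: m_assoc even_closed smult_mult_left smult_mult_right smult_closed wev.ev_const
            comm)
    qed
    have "(\<Oplus>\<alpha>\<in>A. \<Oplus>\<beta>\<in>A. wev.ev (const (c \<alpha> \<beta>) * (?x i k * ?y k \<alpha> * (?x j l * ?y l \<beta>)))) =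
        wev.ev (?x i k * (\<Sum>\<alpha>\<in>A. \<Sum>\<beta>\<in>A. const (c \<alpha> \<beta>) * (?y k \<alpha> * ?y l \<beta>)) * ?x j l)"
      unfolding entry by (simp only: wev.ev_sum[symmetric] sum_distrib_left sum_distrib_right)
    also have "\<dots> = X i k \<otimes> (\<Oplus>\<alpha>\<in>A. \<Oplus>\<beta>\<in>A. c \<alpha> \<beta> \<odot> (Y k \<alpha> \<otimes> Y l \<beta>)) \<otimes> X j l"
      using Xc ij kl Y by (simp add: wev.ev_sum smult_mult_left wev.ev_const)
    finally show "(\<Oplus>\<alpha>\<in>A. \<Oplus>\<beta>\<in>A. wev.ev (const (c \<alpha> \<beta>) * (?x i k * ?y k \<alpha> * (?x j l * ?y l \<beta>)))) =
        X i k \<otimes> (\<Oplus>\<alpha>\<in>A. \<Oplus>\<beta>\<in>A. c \<alpha> \<beta> \<odot> (Y k \<alpha> \<otimes> Y l \<beta>)) \<otimes> X j l" .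
  qed (use Xc ij Y in \<open>auto intro!: finsum_closed m_closed smult_closed\<close>)
  finally show ?thesis .
qed

locale enumerated_form = enumerated_basis E0 E1 m en
  for E0 E1 :: "'v set" and m :: nat and en :: "nat \<Rightarrow> 'v" +
  fixes b :: "'v \<Rightarrow> 'v \<Rightarrow> complex"
  assumes cross: "e \<in> E0 \<Longrightarrow> f \<in> E1 \<Longrightarrow> b e f = 0" "e \<in> E0 \<Longrightarrow> f \<in> E1 \<Longrightarrow> b f e = 0"
begin

definition even_gram :: complex where
  "even_gram = det (mat m m (\<lambda>(k, l). b (en k) (en l)))"

text \<open>The mixed terms vanish because the even and odd basis vectors are orthogonal; what
  remains are the entries of X Q X^T and \<theta> J \<theta>^T.\<close>

lemma form_extension_split:
  assumes R: "comm_superalgebra R" and x: "x \<in> affine_points E0 E1 R" and y: "y \<in> affine_points E0 E1 R"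
  shows "form_extension E0 E1 b R x y =
    (\<Oplus>\<^bsub>R\<^esub>k\<in>{..<m}. \<Oplus>\<^bsub>R\<^esub>l\<in>{..<m}. x (en k) \<otimes>\<^bsub>R\<^esub> (b (en k) (en l) \<odot>\<^bsub>R\<^esub> \<one>\<^bsub>R\<^esub>) \<otimes>\<^bsub>R\<^esub> y (en l)) \<oplus>\<^bsub>R\<^esub>
    (\<Oplus>\<^bsub>R\<^esub>\<alpha>\<in>E1. \<Oplus>\<^bsub>R\<^esub>\<beta>\<in>E1. (- b \<alpha> \<beta>) \<odot>\<^bsub>R\<^esub> (x \<alpha> \<otimes>\<^bsub>R\<^esub> y \<beta>))"
proof -
  interpret comm_superalgebra R by (fact R)
  have c: "x e \<in> carrier R" "y e \<in> carrier R" if "e \<in> E0 \<union> E1" for e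
    using x y that by (auto simp: affine_points_def PiE_iff)
  have finE0: "finite E0"
    using enum bij_betw_finite by blast
  have inj: "inj_on en {..<m}" and img: "E0 = en ` {..<m}"
    using enum by (auto simp: bij_betw_def)
  let ?t = "\<lambda>e f. (if e \<in> E1 \<and> f \<in> E1 then - b e f else b e f) \<odot>\<^bsub>R\<^esub> (x e \<otimes>\<^bsub>R\<^esub> y f)"
  have t: "?t e f \<in> carrier R" if "e \<in> E0 \<union> E1" "f \<in> E0 \<union> E1" for e f
    using c that by (auto intro!: smult_closed)
  have t0: "?t e f = \<zero>\<^bsub>R\<^esub>" "?t f e = \<zero>\<^bsub>R\<^esub>" if "e \<in> E0" "f \<in> E1" for e f
    using cross[OF that] that disjoint c by (auto simp: smult_zero_left)
  have "form_extension E0 E1 b R x y = (\<Oplus>\<^bsub>R\<^esub>e\<in>E0. \<Oplus>\<^bsub>R\<^esub>f\<in>E0 \<union> E1. ?t e f) \<oplus>\<^bsub>R\<^esub> (\<Oplus>\<^bsub>R\<^esub>e\<in>E1. \<Oplus>\<^bsub>R\<^esub>f\<in>E0 \<union> E1. ?t e f)"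
    unfolding form_extension_def using finE0 finite_E1 disjoint t
    by (intro finsum_Un_disjoint) (auto intro!: finsum_closed)
  also have "(\<Oplus>\<^bsub>R\<^esub>e\<in>E0. \<Oplus>\<^bsub>R\<^esub>f\<in>E0 \<union> E1. ?t e f) = (\<Oplus>\<^bsub>R\<^esub>e\<in>E0. \<Oplus>\<^bsub>R\<^esub>f\<in>E0. b e f \<odot>\<^bsub>R\<^esub> (x e \<otimes>\<^bsub>R\<^esub> y f))"
  proof (rule finsum_cong'[OF refl])
    fix e assume e: "e \<in> E0"
    show "(\<Oplus>\<^bsub>R\<^esub>f\<in>E0 \<union> E1. ?t e f) = (\<Oplus>\<^bsub>R\<^esub>f\<in>E0. b e f \<odot>\<^bsub>R\<^esub> (x e \<otimes>\<^bsub>R\<^esub> y f))"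
      using t[of e] t0[OF e] e finE0 finite_E1 disjoint
      by (intro add.finprod_mono_neutral_cong_right) auto
  qed (use c in \<open>auto intro!: finsum_closed smult_closed\<close>)
  also have "(\<Oplus>\<^bsub>R\<^esub>e\<in>E1. \<Oplus>\<^bsub>R\<^esub>f\<in>E0 \<union> E1. ?t e f) = (\<Oplus>\<^bsub>R\<^esub>e\<in>E1. \<Oplus>\<^bsub>R\<^esub>f\<in>E1. (- b e f) \<odot>\<^bsub>R\<^esub> (x e \<otimes>\<^bsub>R\<^esub> y f))"
  proof (rule finsum_cong'[OF refl])
    fix e assume e: "e \<in> E1"
    show "(\<Oplus>\<^bsub>R\<^esub>f\<in>E0 \<union> E1. ?t e f) = (\<Oplus>\<^bsub>R\<^esub>f\<in>E1. (- b e f) \<odot>\<^bsub>R\<^esub> (x e \<otimes>\<^bsub>R\<^esub> y f))"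
      using t[of e] cross(2)[OF _ e] c e finE0 finite_E1 disjoint
      by (intro add.finprod_mono_neutral_cong_right) (auto simp: smult_zero_left)
  qed (use c in \<open>auto intro!: finsum_closed smult_closed\<close>)
  also have "(\<Oplus>\<^bsub>R\<^esub>e\<in>E0. \<Oplus>\<^bsub>R\<^esub>f\<in>E0. b e f \<odot>\<^bsub>R\<^esub> (x e \<otimes>\<^bsub>R\<^esub> y f)) =
      (\<Oplus>\<^bsub>R\<^esub>k\<in>{..<m}. \<Oplus>\<^bsub>R\<^esub>f\<in>E0. b (en k) f \<odot>\<^bsub>R\<^esub> (x (en k) \<otimes>\<^bsub>R\<^esub> y f))"
    using c inj by (subst img, subst add.finprod_reindex)
      (auto simp: img intro!: finsum_closed smult_closed)
  also have "\<dots> = (\<Oplus>\<^bsub>R\<^esub>k\<in>{..<m}. \<Oplus>\<^bsub>R\<^esub>l\<in>{..<m}. x (en k) \<otimes>\<^bsub>R\<^esub> (b (en k) (en l) \<odot>\<^bsub>R\<^esub> \<one>\<^bsub>R\<^esub>) \<otimes>\<^bsub>R\<^esub> y (en l))"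
  proof (rule finsum_cong'[OF refl])
    fix k assume k: "k \<in> {..<m}"
    then have "x (en k) \<in> carrier R"
      using c en_in by auto
    then show "(\<Oplus>\<^bsub>R\<^esub>f\<in>E0. b (en k) f \<odot>\<^bsub>R\<^esub> (x (en k) \<otimes>\<^bsub>R\<^esub> y f)) =
        (\<Oplus>\<^bsub>R\<^esub>l\<in>{..<m}. x (en k) \<otimes>\<^bsub>R\<^esub> (b (en k) (en l) \<odot>\<^bsub>R\<^esub> \<one>\<^bsub>R\<^esub>) \<otimes>\<^bsub>R\<^esub> y (en l))"
      using c inj by (subst img, subst add.finprod_reindex)
        (auto simp: img smult_mult_left smult_mult_right intro!: smult_closed finsum_cong')
  qed (use c en_in in \<open>auto intro!: finsum_closed smult_closed m_closed\<close>)
  finally show ?thesis .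
qed

text \<open>The entry \<open>(k, l)\<close> of Y J Y^T in formal letters; the minus sign is the one
  that \<open>form_extension\<close> attaches to two odd vectors.\<close>

abbreviation odd_gram_word :: "nat \<Rightarrow> nat \<Rightarrow> (nat \<times> 'v) list \<Rightarrow>\<^sub>0 complex" where
  "odd_gram_word k l \<equiv> (\<Sum>\<alpha>\<in>E1. \<Sum>\<beta>\<in>E1. const (- b \<alpha> \<beta>) * (letter (k, \<alpha>) * letter (l, \<beta>)))"

lemma power_points_affine: "v \<in> power_points E0 E1 m R \<Longrightarrow> i < m \<Longrightarrow> v i \<in> affine_points E0 E1 R"
  by (auto simp: power_points_def)

text \<open>The contribution of the odd coordinates to the Gram matrix is nilpotent, so
  invertibility of the Gram determinant passes to det X.\<close>

lemma solution_exists: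
  assumes R: "comm_superalgebra R" and v: "v \<in> power_points E0 E1 m R"
    and unit: "super_det R m (\<lambda>i j. form_extension E0 E1 b R (v i) (v j)) \<in> Units R"
  obtains Y where "solution R v Y"
proof -
  interpret comm_superalgebra R by (fact R)
  have X: "v i (en k) \<in> even_part R" if "i < m" "k < m" for i k
    using power_pointsD[OF v] en_in that by auto
  have \<theta>: "v i \<alpha> \<in> odd_part R" if "i < m" "\<alpha> \<in> E1" for i \<alpha>
    using power_pointsD[OF v] that by auto
  let ?N = "\<lambda>i j. \<Oplus>\<^bsub>R\<^esub>\<alpha>\<in>E1. \<Oplus>\<^bsub>R\<^esub>\<beta>\<in>E1. (- b \<alpha> \<beta>) \<odot>\<^bsub>R\<^esub> (v i \<alpha> \<otimes>\<^bsub>R\<^esub> v j \<beta>)"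
  let ?G0 = "\<lambda>i j. \<Oplus>\<^bsub>R\<^esub>k\<in>{..<m}. \<Oplus>\<^bsub>R\<^esub>l\<in>{..<m}. v i (en k) \<otimes>\<^bsub>R\<^esub> (b (en k) (en l) \<odot>\<^bsub>R\<^esub> \<one>\<^bsub>R\<^esub>) \<otimes>\<^bsub>R\<^esub> v j (en l)"
  have N: "?N i j \<in> even_nil" if "i < m" "j < m" for i j
    using \<theta> that by (intro even_nil_finsum even_nil_smult odd_odd_nil) auto
  have G0: "?G0 i j \<in> even_part R" if "i < m" "j < m" for i j
    using X that by (intro even_finsum Pi_I) (auto intro!: even_even smult_even one_even)
  have split: "form_extension E0 E1 b R (v i) (v j) = ?G0 i j \<oplus>\<^bsub>R\<^esub> ?N i j" if "i < m" "j < m" for i j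
    using that by (intro form_extension_split[OF R] power_points_affine[OF v])
  have "super_det R m (\<lambda>i j. form_extension E0 E1 b R (v i) (v j)) = super_det R m (\<lambda>i j. ?G0 i j \<oplus>\<^bsub>R\<^esub> ?N i j)"
    using even_add[OF G0 even_nilD[OF N]] by (intro super_det_cong) (simp_all add: split)
  then have unit': "super_det R m (\<lambda>i j. ?G0 i j \<oplus>\<^bsub>R\<^esub> ?N i j) \<in> Units R"
    using unit by simp
  obtain d where d: "d \<in> even_part R" "super_det R m (\<lambda>i k. v i (en k)) \<otimes>\<^bsub>R\<^esub> d = \<one>\<^bsub>R\<^esub>"
    by (rule super_det_coordinates_unit[of m "\<lambda>i k. v i (en k)" ?N "\<lambda>k l. b (en k) (en l)"])
       (assumption | rule X N unit' that)+
  obtain Z where Z: "Z i j \<in> even_part R"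
    and XZ: "i < m \<Longrightarrow> j < m \<Longrightarrow> (\<Oplus>\<^bsub>R\<^esub>k\<in>{..<m}. v i (en k) \<otimes>\<^bsub>R\<^esub> Z k j) = (if i = j then \<one>\<^bsub>R\<^esub> else \<zero>\<^bsub>R\<^esub>)" for i j
    by (rule super_det_inverse[of m "\<lambda>i k. v i (en k)" d]) (assumption | rule X d that)+
  \<comment> \<open>This is X^(-1) \<theta>, with \<open>Z\<close> as the inverse of X, extended by
    zero as \<open>solution\<close> demands.\<close>
  define Y where "Y = (\<lambda>(k, \<alpha>). if k < m \<and> \<alpha> \<in> E1 then \<Oplus>\<^bsub>R\<^esub>j\<in>{..<m}. Z k j \<otimes>\<^bsub>R\<^esub> v j \<alpha> else \<zero>\<^bsub>R\<^esub>)"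
  have "odd_eval R Y"
    by unfold_locales
       (use Z \<theta> odd_zero in \<open>auto simp: Y_def split: prod.splits intro!: odd_finsum even_odd\<close>)
  moreover have "v i \<alpha> = (\<Oplus>\<^bsub>R\<^esub>k\<in>{..<m}. v i (en k) \<otimes>\<^bsub>R\<^esub> Y (k, \<alpha>))" if i: "i < m" and \<alpha>: "\<alpha> \<in> E1" for i \<alpha>
  proof -
    let ?x = "\<lambda>k. letter (v i (en k))" and ?z = "\<lambda>k j. letter (Z k j)" and ?t = "\<lambda>j. letter (v j \<alpha>)"
    have "(\<Oplus>\<^bsub>R\<^esub>k\<in>{..<m}. v i (en k) \<otimes>\<^bsub>R\<^esub> Y (k, \<alpha>)) = wev.ev (\<Sum>k<m. ?x k * (\<Sum>j<m. ?z k j * ?t j))"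
      unfolding wev.ev_sum wev.ev_mult[of "letter _" "sum _ _"]
    proof (rule finsum_cong'[OF refl])
      fix k assume k: "k \<in> {..<m}"
      have "Y (k, \<alpha>) = wev.ev (\<Sum>j<m. ?z k j * ?t j)"
        using k \<alpha> Z \<theta> unfolding wev.ev_sum
        by (auto simp: Y_def even_closed odd_closed intro!: finsum_cong')
      then show "v i (en k) \<otimes>\<^bsub>R\<^esub> Y (k, \<alpha>) = wev.ev (?x k) \<otimes>\<^bsub>R\<^esub> (\<Oplus>\<^bsub>R\<^esub>j\<in>{..<m}. wev.ev (?z k j * ?t j))"
        using X[OF i, of k] k by (simp add: even_closed wev.ev_sum)
    qed (auto intro!: finsum_closed)
    also have "(\<Sum>k<m. ?x k * (\<Sum>j<m. ?z k j * ?t j)) = (\<Sum>j<m. (\<Sum>k<m. ?x k * ?z k j) * ?t j)"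
      unfolding sum_distrib_left sum_distrib_right mult.assoc by (rule sum.swap)
    also have "wev.ev \<dots> = (\<Oplus>\<^bsub>R\<^esub>j\<in>{..<m}. (if i = j then v i \<alpha> else \<zero>\<^bsub>R\<^esub>))"
      unfolding wev.ev_sum wev.ev_mult[of "sum _ _"]
    proof (rule finsum_cong'[OF refl])
      fix j assume j: "j \<in> {..<m}"
      have "(\<Oplus>\<^bsub>R\<^esub>k\<in>{..<m}. wev.ev (?x k * ?z k j)) = (\<Oplus>\<^bsub>R\<^esub>k\<in>{..<m}. v i (en k) \<otimes>\<^bsub>R\<^esub> Z k j)"
        using X[OF i] Z by (intro finsum_cong') (auto simp: even_closed)
      then show "(\<Oplus>\<^bsub>R\<^esub>k\<in>{..<m}. wev.ev (?x k * ?z k j)) \<otimes>\<^bsub>R\<^esub> wev.ev (?t j) = (if i = j then v i \<alpha> else \<zero>\<^bsub>R\<^esub>)"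
        using XZ[OF i, of j] j \<theta>[of j \<alpha>] \<alpha> by (auto simp: odd_closed)
    qed (use \<theta>[OF i \<alpha>] odd_closed in auto)
    also have "\<dots> = v i \<alpha>"
      using \<theta>[OF i \<alpha>] i by (subst add.finprod_singleton) (auto simp: odd_closed)
    finally show ?thesis by simp
  qed
  ultimately have "solution R v Y"
    using v by (auto simp: solution_def Y_def)
  then show ?thesis by (rule that)
qed

text \<open>The Gram matrix is X P X^T with P = Q + Y J Y^T, and the determinant of P is
  \<open>even_gram\<close> times the square of a formal \<open>s\<close>.\<close>

lemma gram_factorization:
  assumes "even_gram \<noteq> 0"
  obtains s where "Poly_Mapping.lookup s 0 = 1"
    and "\<And>(R :: 'a superalg) v Y. solution R v Y \<Longrightarrow>
      alg_eval R (word_val R Y) s \<in> even_part R \<and>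
      super_det R m (\<lambda>i j. form_extension E0 E1 b R (v i) (v j)) =
        frame_det R v \<otimes>\<^bsub>R\<^esub>
          (even_gram \<odot>\<^bsub>R\<^esub> (alg_eval R (word_val R Y) s \<otimes>\<^bsub>R\<^esub> alg_eval R (word_val R Y) s)) \<otimes>\<^bsub>R\<^esub>
          frame_det R v"
proof -
  define P where "P = (\<lambda>k l. const (b (en k) (en l)) + odd_gram_word k l)"
  \<comment> \<open>The constant term of \<open>alg_det m P\<close> is det Q, that is
    \<open>even_gram\<close>; after this normalization \<open>w\<close> has constant term zero, as
    \<open>word_sqrt\<close> requires.\<close>
  define w where "w = const (1 / even_gram) * alg_det m P - 1"
  have "Poly_Mapping.lookup (letter l) 0 = 0" for l :: "nat \<times> 'v"
    by (simp add: lookup_single when_def zero_list_def)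
  then have "Poly_Mapping.lookup (odd_gram_word k l) 0 = 0" for k l
    by (simp add: lookup_sum lookup_mult_Nil)
  then have "Poly_Mapping.lookup (P k l) 0 = b (en k) (en l)" for k l
    by (simp add: P_def lookup_add)
  then have w0: "Poly_Mapping.lookup w 0 = 0"
    using assms
    by (simp add: w_def lookup_minus lookup_mult_Nil lookup_alg_det_Nil lookup_one even_gram_def)
  obtain s where s: "Poly_Mapping.lookup s 0 = 1"
    and sq: "\<And>(R :: 'a superalg) \<rho>. odd_eval R \<rho> \<Longrightarrow> (\<And>l. l \<notin> {..<m} \<times> E1 \<Longrightarrow> \<rho> l = \<zero>\<^bsub>R\<^esub>) \<Longrightarrow>
      alg_eval R (word_val R \<rho>) w \<in> even_part R \<Longrightarrow>
      alg_eval R (word_val R \<rho>) s \<in> even_part R \<and>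
      alg_eval R (word_val R \<rho>) s \<otimes>\<^bsub>R\<^esub> alg_eval R (word_val R \<rho>) s =
        \<one>\<^bsub>R\<^esub> \<oplus>\<^bsub>R\<^esub> alg_eval R (word_val R \<rho>) w"
    using word_sqrt[OF w0, of "{..<m} \<times> E1"] finite_E1 by auto
  have "alg_eval R (word_val R Y) s \<in> even_part R \<and>
      super_det R m (\<lambda>i j. form_extension E0 E1 b R (v i) (v j)) =
        frame_det R v \<otimes>\<^bsub>R\<^esub>
          (even_gram \<odot>\<^bsub>R\<^esub> (alg_eval R (word_val R Y) s \<otimes>\<^bsub>R\<^esub> alg_eval R (word_val R Y) s)) \<otimes>\<^bsub>R\<^esub>
          frame_det R v"
    if sol: "solution R v Y" for R :: "'a superalg" and v Y
  proof -
    have Y: "odd_eval R Y" and v: "v \<in> power_points E0 E1 m R"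
      and Y0: "\<And>l. l \<notin> {..<m} \<times> E1 \<Longrightarrow> Y l = \<zero>\<^bsub>R\<^esub>"
      and lin: "\<And>i \<alpha>. i < m \<Longrightarrow> \<alpha> \<in> E1 \<Longrightarrow> v i \<alpha> = (\<Oplus>\<^bsub>R\<^esub>k\<in>{..<m}. v i (en k) \<otimes>\<^bsub>R\<^esub> Y (k, \<alpha>))"
      using sol unfolding solution_def by blast+
    interpret odd_eval R Y by (fact Y)
    have X: "v i (en k) \<in> even_part R" if "i < m" "k < m" for i k
      using power_pointsD[OF v] en_in that by auto
    let ?n = "\<lambda>k l. \<Oplus>\<^bsub>R\<^esub>\<alpha>\<in>E1. \<Oplus>\<^bsub>R\<^esub>\<beta>\<in>E1. (- b \<alpha> \<beta>) \<odot>\<^bsub>R\<^esub> (Y (k, \<alpha>) \<otimes>\<^bsub>R\<^esub> Y (l, \<beta>))"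
    have n_even: "?n k l \<in> even_part R" for k l
      using letter_odd by (intro even_finsum Pi_I smult_even odd_odd)
    have evP: "ev (P k l) = b (en k) (en l) \<odot>\<^bsub>R\<^esub> \<one>\<^bsub>R\<^esub> \<oplus>\<^bsub>R\<^esub> ?n k l" for k l
      unfolding P_def ev_add ev_sum ev_const_mult ev_const unfolding ev_mult ev_letter ..
    have evP_even: "ev (P k l) \<in> even_part R" for k l
      unfolding evP using n_even by (intro even_add smult_even one_even)
    have entry: "form_extension E0 E1 b R (v i) (v j) =
        (\<Oplus>\<^bsub>R\<^esub>k\<in>{..<m}. \<Oplus>\<^bsub>R\<^esub>l\<in>{..<m}. v i (en k) \<otimes>\<^bsub>R\<^esub> ev (P k l) \<otimes>\<^bsub>R\<^esub> v j (en l))"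
      if ij: "i < m" "j < m" for i j
    proof -
      let ?g = "\<lambda>k l. v i (en k) \<otimes>\<^bsub>R\<^esub> (b (en k) (en l) \<odot>\<^bsub>R\<^esub> \<one>\<^bsub>R\<^esub>) \<otimes>\<^bsub>R\<^esub> v j (en l)"
        and ?h = "\<lambda>k l. v i (en k) \<otimes>\<^bsub>R\<^esub> ?n k l \<otimes>\<^bsub>R\<^esub> v j (en l)"
      have gh: "?g k l \<in> carrier R" "?h k l \<in> carrier R" if "k < m" "l < m" for k l
        using X ij that n_even even_closed by (auto intro!: m_closed smult_closed)
      have "form_extension E0 E1 b R (v i) (v j) =
          (\<Oplus>\<^bsub>R\<^esub>k\<in>{..<m}. \<Oplus>\<^bsub>R\<^esub>l\<in>{..<m}. ?g k l) \<oplus>\<^bsub>R\<^esub>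
          (\<Oplus>\<^bsub>R\<^esub>\<alpha>\<in>E1. \<Oplus>\<^bsub>R\<^esub>\<beta>\<in>E1. (- b \<alpha> \<beta>) \<odot>\<^bsub>R\<^esub> (v i \<alpha> \<otimes>\<^bsub>R\<^esub> v j \<beta>))"
        using ij by (intro form_extension_split comm_superalgebra_axioms power_points_affine[OF v])
      also have "(\<Oplus>\<^bsub>R\<^esub>\<alpha>\<in>E1. \<Oplus>\<^bsub>R\<^esub>\<beta>\<in>E1. (- b \<alpha> \<beta>) \<odot>\<^bsub>R\<^esub> (v i \<alpha> \<otimes>\<^bsub>R\<^esub> v j \<beta>)) =
          (\<Oplus>\<^bsub>R\<^esub>k\<in>{..<m}. \<Oplus>\<^bsub>R\<^esub>l\<in>{..<m}. ?h k l)"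
        using X lin ij
        by (intro bilinear_substitution[where X = "\<lambda>i k. v i (en k)" and Y = "\<lambda>k \<alpha>. Y (k, \<alpha>)"]) auto
      also have "(\<Oplus>\<^bsub>R\<^esub>k\<in>{..<m}. \<Oplus>\<^bsub>R\<^esub>l\<in>{..<m}. ?g k l) \<oplus>\<^bsub>R\<^esub> (\<Oplus>\<^bsub>R\<^esub>k\<in>{..<m}. \<Oplus>\<^bsub>R\<^esub>l\<in>{..<m}. ?h k l) =
          (\<Oplus>\<^bsub>R\<^esub>k\<in>{..<m}. (\<Oplus>\<^bsub>R\<^esub>l\<in>{..<m}. ?g k l) \<oplus>\<^bsub>R\<^esub> (\<Oplus>\<^bsub>R\<^esub>l\<in>{..<m}. ?h k l))"
        using gh by (intro finsum_addf[symmetric]) (auto intro!: finsum_closed)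
      also have "\<dots> = (\<Oplus>\<^bsub>R\<^esub>k\<in>{..<m}. \<Oplus>\<^bsub>R\<^esub>l\<in>{..<m}. ?g k l \<oplus>\<^bsub>R\<^esub> ?h k l)"
        using gh by (intro finsum_cong' refl) (auto intro!: finsum_closed finsum_addf[symmetric])
      also have "\<dots> = (\<Oplus>\<^bsub>R\<^esub>k\<in>{..<m}. \<Oplus>\<^bsub>R\<^esub>l\<in>{..<m}. v i (en k) \<otimes>\<^bsub>R\<^esub> ev (P k l) \<otimes>\<^bsub>R\<^esub> v j (en l))"
      proof (intro finsum_cong' refl)
        fix k l assume "k \<in> {..<m}" "l \<in> {..<m}"
        then show "?g k l \<oplus>\<^bsub>R\<^esub> ?h k l = v i (en k) \<otimes>\<^bsub>R\<^esub> ev (P k l) \<otimes>\<^bsub>R\<^esub> v j (en l)"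
          unfolding evP using X ij n_even by (simp add: l_distr r_distr even_closed smult_closed)
      qed (use X ij even_closed in \<open>auto intro!: finsum_closed m_closed\<close>)
      finally show ?thesis .
    qed
    have "super_det R m (\<lambda>i j. form_extension E0 E1 b R (v i) (v j)) =
        super_det R m (\<lambda>i j. \<Oplus>\<^bsub>R\<^esub>k\<in>{..<m}. \<Oplus>\<^bsub>R\<^esub>l\<in>{..<m}. v i (en k) \<otimes>\<^bsub>R\<^esub> ev (P k l) \<otimes>\<^bsub>R\<^esub> v j (en l))"
      using X evP_even by (intro super_det_cong) (auto simp: entry intro!: even_finsum even_even)
    also have "\<dots> = frame_det R v \<otimes>\<^bsub>R\<^esub> super_det R m (\<lambda>k l. ev (P k l)) \<otimes>\<^bsub>R\<^esub> frame_det R v"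
      unfolding frame_det_def using X evP_even by (intro super_det_congruence)
    finally have D: "super_det R m (\<lambda>i j. form_extension E0 E1 b R (v i) (v j)) =
        frame_det R v \<otimes>\<^bsub>R\<^esub> super_det R m (\<lambda>k l. ev (P k l)) \<otimes>\<^bsub>R\<^esub> frame_det R v" .
    let ?p = "super_det R m (\<lambda>k l. ev (P k l))"
    have p: "?p \<in> even_part R"
      using evP_even by (intro super_det_even)
    have evw: "ev w = (1 / even_gram) \<odot>\<^bsub>R\<^esub> ?p \<ominus>\<^bsub>R\<^esub> \<one>\<^bsub>R\<^esub>"
      unfolding w_def ev_diff ev_const_mult ev_alg_det[OF evP_even] by simp
    have "ev w \<in> even_part R"
      unfolding evw a_minus_def using p by (intro even_add even_uminus smult_even one_even)
    from sq[OF Y Y0 this] have es: "ev s \<in> even_part R" "ev s \<otimes>\<^bsub>R\<^esub> ev s = \<one>\<^bsub>R\<^esub> \<oplus>\<^bsub>R\<^esub> ev w"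
      by auto
    have "ev s \<otimes>\<^bsub>R\<^esub> ev s = (1 / even_gram) \<odot>\<^bsub>R\<^esub> ?p"
      unfolding es(2) evw using p by (simp add: add_diff_cancel smult_closed even_closed)
    then have "even_gram \<odot>\<^bsub>R\<^esub> (ev s \<otimes>\<^bsub>R\<^esub> ev s) = ?p"
      using p assms by (simp add: smult_one even_closed flip: smult_smult)
    with D es(1) show ?thesis by simp
  qed
  with s show ?thesis by (rule that)
qed

end

section \<open>The volume form\<close>

text \<open>Polarization: put the sum of the two vectors into both slots and expand; the terms with
  equal vectors vanish.\<close>

lemma alternating_map_exchange:
  assumes vs: "super_vector_space scale V0 V1" and alt: "alternating_map scale V0 m vol"
    and f: "f \<in> {..<m} \<rightarrow>\<^sub>E V0" and ij: "i < m" "j < m" "i \<noteq> j"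
  shows "vol (f \<circ> Transposition.transpose i j) = - vol f"
proof -
  interpret super_vector_space scale V0 V1 by (fact vs)
  have add: "vol (v(i := x + y)) = vol (v(i := x)) + vol (v(i := y))"
    if "v \<in> {..<m} \<rightarrow>\<^sub>E V0" "i < m" "x \<in> V0" "y \<in> V0" for v i x y
    using alt that unfolding alternating_map_def by blast
  have zero: "vol v = 0" if "v \<in> {..<m} \<rightarrow>\<^sub>E V0" "i < m" "j < m" "i \<noteq> j" "v i = v j" for v i j
    using alt that unfolding alternating_map_def by blast
  define g where "g x y = f(i := x, j := y)" for x y
  let ?x = "f i" and ?y = "f j"
  have xy: "?x \<in> V0" "?y \<in> V0" "?x + ?y \<in> V0"
    using f ij subspace_add[OF subspace_V0] by auto
  have g: "g x y \<in> {..<m} \<rightarrow>\<^sub>E V0" if "x \<in> V0" "y \<in> V0" for x y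
    using f ij that by (auto simp: g_def PiE_iff extensional_def)
  have gi: "vol (g (x + x') y) = vol (g x y) + vol (g x' y)" if "x \<in> V0" "x' \<in> V0" "y \<in> V0" for x x' y
    using add[OF g[OF xy(1) that(3)] ij(1) that(1,2)] ij by (simp add: g_def fun_upd_twist)
  have gj: "vol (g x (y + y')) = vol (g x y) + vol (g x y')" if "x \<in> V0" "y \<in> V0" "y' \<in> V0" for x y y'
    using add[OF g[OF that(1) xy(1)] ij(2) that(2,3)] by (simp add: g_def)
  have diag: "vol (g x x) = 0" if "x \<in> V0" for x
    using zero[OF g[OF that that] ij] ij by (simp add: g_def)
  have "0 = vol (g (?x + ?y) (?x + ?y))"
    using diag xy by simp
  also have "\<dots> = vol (g ?x ?y) + vol (g ?y ?x)"
    using xy by (simp add: gi gj diag[OF xy(1)] diag[OF xy(2)])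
  finally have "vol (g ?y ?x) = - vol (g ?x ?y)"
    by (simp add: add_eq_0_iff2)
  moreover have "g ?x ?y = f" "g ?y ?x = f \<circ> Transposition.transpose i j"
    using ij by (auto simp: g_def fun_eq_iff Transposition.transpose_def)
  ultimately show ?thesis by simp
qed

lemma alternating_map_permute:
  assumes vs: "super_vector_space scale V0 V1" and alt: "alternating_map scale V0 m vol"
    and f: "f \<in> {..<m} \<rightarrow>\<^sub>E V0" and p: "p permutes {..<m}"
  shows "vol (f \<circ> p) = of_int (sign p) * vol f"
  using finite_lessThan p
proof (induction rule: permutes_rev_induct)
  case (swap a b p)
  have "f \<circ> p \<in> {..<m} \<rightarrow>\<^sub>E V0"
    using f swap.hyps(4) by (auto simp: PiE_iff extensional_def permutes_less_iff permutes_not_in)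
  then have "vol (f \<circ> p \<circ> Transposition.transpose a b) = - vol (f \<circ> p)"
    using swap.hyps by (intro alternating_map_exchange[OF vs alt]) auto
  moreover have "sign (p \<circ> Transposition.transpose a b) = - sign p"
    using swap.hyps
    by (subst sign_compose) (auto simp: sign_swap_id permutation_swap_id intro: permutes_imp_permutation)
  ultimately show ?case
    using swap.IH by (simp add: o_def)
qed simp

context enumerated_basis
begin

definition frame :: "nat \<Rightarrow> 'v" where
  "frame = restrict en {..<m}"

text \<open>Tuples of basis vectors with a repetition drop out, and the injective ones are
  \<open>frame \<circ> p\<close> for permutations \<open>p\<close>. What is left is the Leibniz
  formula.\<close>

lemma volume_extension_frame_det:
  assumes R: "comm_superalgebra R" and v: "v \<in> power_points E0 E1 m R"
    and sgn: "\<And>p. p permutes {..<m} \<Longrightarrow> vol (frame \<circ> p) = of_int (sign p) * vol frame"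
    and rep: "\<And>f. f \<in> {..<m} \<rightarrow>\<^sub>E E0 \<Longrightarrow> \<not> inj_on f {..<m} \<Longrightarrow> vol f = 0"
  shows "volume_extension E0 m vol R v = vol frame \<odot>\<^bsub>R\<^esub> frame_det R v"
proof -
  interpret comm_superalgebra R by (fact R)
  let ?P = "{p. p permutes {..<m}}"
  let ?t = "\<lambda>f. vol f \<odot>\<^bsub>R\<^esub> mprod R (map (\<lambda>i. v i (f i)) [0..<m])"
  have inj: "inj_on en {..<m}" and img: "en ` {..<m} = E0"
    using enum by (auto simp: bij_betw_def)
  have finE0: "finite E0"
    using img by (metis finite_imageI finite_lessThan)
  have frame: "frame \<in> {..<m} \<rightarrow>\<^sub>E E0"
    using en_in by (auto simp: frame_def)
  have v_even: "v i e \<in> even_part R" if "i < m" "e \<in> E0" for i e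
    using power_pointsD[OF v] that by auto
  have tc: "?t f \<in> carrier R" if "f \<in> {..<m} \<rightarrow>\<^sub>E E0" for f
    using that v_even even_closed by (auto intro!: smult_closed mprod_closed simp: PiE_iff)
  have frame_p: "frame \<circ> p \<in> {..<m} \<rightarrow>\<^sub>E E0" if "p permutes {..<m}" for p
    using frame that by (auto simp: PiE_iff extensional_def permutes_less_iff permutes_not_in)
  have pc: "mprod R (map (\<lambda>i. v i (en (p i))) [0..<m]) \<in> carrier R" if "p permutes {..<m}" for p
    using v_even[OF _ en_in] that even_closed by (auto simp: permutes_less_iff intro!: mprod_closed)
  have "volume_extension E0 m vol R v = (\<Oplus>\<^bsub>R\<^esub>f\<in>{..<m} \<rightarrow>\<^sub>E E0. ?t f)"
    unfolding volume_extension_def using tc v_even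
    by (intro finsum_cong') (auto simp: finprod_even_ring PiE_iff)
  also have "\<dots> = (\<Oplus>\<^bsub>R\<^esub>f\<in>(\<lambda>p. frame \<circ> p) ` ?P. ?t f)"
  proof (rule add.finprod_mono_neutral_cong_right)
    show "finite ({..<m} \<rightarrow>\<^sub>E E0)"
      using finE0 by (intro finite_PiE) auto
    show "(\<lambda>p. frame \<circ> p) ` ?P \<subseteq> {..<m} \<rightarrow>\<^sub>E E0"
      using frame_p by auto
    show "?t f = \<zero>\<^bsub>R\<^esub>" if f_diff: "f \<in> ({..<m} \<rightarrow>\<^sub>E E0) - (\<lambda>p. frame \<circ> p) ` ?P" for f
    proof -
      have f: "f \<in> {..<m} \<rightarrow>\<^sub>E E0" and notin: "f \<notin> (\<lambda>p. frame \<circ> p) ` ?P"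
        using f_diff by auto
      have "\<not> inj_on f {..<m}"
      proof
        assume inj_f: "inj_on f {..<m}"
        define p where "p i = (if i < m then inv_into {..<m} en (f i) else i)" for i
        have fi: "f i \<in> E0" if "i < m" for i
          using f that by auto
        have p_lt: "p i < m" if "i < m" for i
          using inv_into_into[of "f i" en "{..<m}"] fi[OF that] img that by (simp add: p_def)
        have en_p: "en (p i) = f i" if "i < m" for i
          using f_inv_into_f[of "f i" en "{..<m}"] fi[OF that] img that by (simp add: p_def)
        have "inj_on p {..<m}"
          using inj_f en_p by (metis inj_on_def lessThan_iff)
        moreover have "p ` {..<m} \<subseteq> {..<m}"
          using p_lt by auto
        ultimately have "bij_betw p {..<m} {..<m}"
          by (simp add: bij_betw_def endo_inj_surj)
        then have "p permutes {..<m}"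
          by (intro bij_imp_permutes) (auto simp: p_def)
        moreover have "f = frame \<circ> p"
        proof
          show "f i = (frame \<circ> p) i" for i
            using f p_lt[of i] en_p[of i] by (cases "i < m") (auto simp: frame_def p_def PiE_iff extensional_def)
        qed
        ultimately show False
          using notin by blast
      qed
      then have "vol f = 0"
        using rep[OF f] by simp
      then show ?thesis
        using f v_even even_closed by (auto intro!: smult_zero_left mprod_closed simp: PiE_iff)
    qed
  qed (use tc in auto)
  also have "\<dots> = (\<Oplus>\<^bsub>R\<^esub>p\<in>?P. ?t (frame \<circ> p))"
  proof (rule add.finprod_reindex)
    show "inj_on (\<lambda>p. frame \<circ> p) ?P"
    proof (rule inj_onI)
      fix p r assume pr: "p \<in> ?P" "r \<in> ?P" "frame \<circ> p = frame \<circ> r"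
      show "p = r"
      proof (rule ext)
        fix i
        show "p i = r i"
        proof (cases "i < m")
          case True
          then have "p i < m" "r i < m"
            using pr(1,2) permutes_in_image by fastforce+
          then show ?thesis
            using fun_cong[OF pr(3), of i] inj by (simp add: frame_def inj_on_def)
        qed (use pr(1,2) in \<open>simp add: permutes_not_in\<close>)
      qed
    qed
  qed (use tc frame_p in auto)
  also have "\<dots> = (\<Oplus>\<^bsub>R\<^esub>p\<in>?P. vol frame \<odot>\<^bsub>R\<^esub> (of_int (sign p) \<odot>\<^bsub>R\<^esub> mprod R (map (\<lambda>i. v i (en (p i))) [0..<m])))"
  proof (rule finsum_cong'[OF refl])
    fix p assume "p \<in> ?P"
    then have p: "p permutes {..<m}" by simp
    have pm: "p i < m" if "i < m" for i
      using that p permutes_in_image by fastforce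
    have "mprod R (map (\<lambda>i. v i ((frame \<circ> p) i)) [0..<m]) = mprod R (map (\<lambda>i. v i (en (p i))) [0..<m])"
      using pm by (intro arg_cong[of _ _ "mprod R"]) (auto simp: frame_def)
    then show "?t (frame \<circ> p) =
        vol frame \<odot>\<^bsub>R\<^esub> (of_int (sign p) \<odot>\<^bsub>R\<^esub> mprod R (map (\<lambda>i. v i (en (p i))) [0..<m]))"
      using sgn[OF p] pc[OF p] by (simp add: mult.commute flip: smult_smult)
  next
    show "(\<lambda>p. vol frame \<odot>\<^bsub>R\<^esub> (of_int (sign p) \<odot>\<^bsub>R\<^esub> mprod R (map (\<lambda>i. v i (en (p i))) [0..<m])))
        \<in> ?P \<rightarrow> carrier R"
      using pc by (auto intro!: smult_closed)
  qed
  also have "\<dots> = vol frame \<odot>\<^bsub>R\<^esub> (\<Oplus>\<^bsub>R\<^esub>p\<in>?P. of_int (sign p) \<odot>\<^bsub>R\<^esub> mprod R (map (\<lambda>i. v i (en (p i))) [0..<m]))"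
    using pc by (intro smult_finsum[symmetric]) (auto intro!: smult_closed)
  also have "(\<Oplus>\<^bsub>R\<^esub>p\<in>?P. of_int (sign p) \<odot>\<^bsub>R\<^esub> mprod R (map (\<lambda>i. v i (en (p i))) [0..<m])) = frame_det R v"
    unfolding frame_det_def using v_even en_in by (intro super_det_mprod[symmetric]) auto
  finally show ?thesis .
qed

end

text \<open>The volume is nonzero on some tuple v. If A holds the coordinates of v in the basis, the
  square of its volume is (det A)^2 det Q, so det Q, the square of the volume of the frame, is
  nonzero.\<close>

lemma normalized_volume_frame:
  assumes hb: "homogeneous_basis scale V0 V1 E0 E1" and en: "bij_betw en {..<m} E0"
    and b: "super_symmetric_form scale V0 V1 b" and vol: "normalized_volume scale V0 m b vol"
  shows "(vol (restrict en {..<m}))\<^sup>2 = det (mat m m (\<lambda>(k, l). b (en k) (en l)))"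
    and "vol (restrict en {..<m}) \<noteq> 0"
proof -
  interpret homogeneous_basis scale V0 V1 E0 E1 by (fact hb)
  let ?Q = "mat m m (\<lambda>(k, l). b (en k) (en l))"
  have inj: "inj_on en {..<m}" and img: "E0 = en ` {..<m}"
    using en by (auto simp: bij_betw_def)
  have "E0 \<subseteq> V0"
    using span_superset span_E0 by blast
  then have "restrict en {..<m} \<in> {..<m} \<rightarrow>\<^sub>E V0"
    using img by auto
  then have "(vol (restrict en {..<m}))\<^sup>2 = det (mat m m (\<lambda>(i, j). b (restrict en {..<m} i) (restrict en {..<m} j)))"
    using vol unfolding normalized_volume_def by blast
  also have "mat m m (\<lambda>(i, j). b (restrict en {..<m} i) (restrict en {..<m} j)) = ?Q"
    by (rule eq_matI) auto
  finally show sq: "(vol (restrict en {..<m}))\<^sup>2 = det ?Q" .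
  obtain v where v: "v \<in> {..<m} \<rightarrow>\<^sub>E V0" "vol v \<noteq> 0"
    using vol unfolding normalized_volume_def by blast
  have "\<exists>a. v i = (\<Sum>k<m. scale (a k) (en k))" if "i < m" for i
  proof -
    have "v i \<in> span E0"
      using v(1) that span_E0 by auto
    then obtain u where "v i = (\<Sum>e\<in>E0. scale (u e) e)"
      using span_finite[OF finite_E0] by auto
    also have "\<dots> = (\<Sum>k<m. scale (u (en k)) (en k))"
      unfolding img using inj by (subst sum.reindex) auto
    finally show ?thesis by (intro exI[of _ "\<lambda>k. u (en k)"])
  qed
  then obtain a where a: "v i = (\<Sum>k<m. scale (a i k) (en k))" if "i < m" for i
    by metis
  let ?A = "mat m m (\<lambda>(i, k). a i k)"
  have lin: "Vector_Spaces.linear scale (*) (b x)" "Vector_Spaces.linear scale (*) (\<lambda>x. b x y)" for x y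
    using b by (auto simp: super_symmetric_form_def)
  have b_right: "b x (\<Sum>k<m. scale (c k) (en k)) = (\<Sum>k<m. c k * b x (en k))" for x c
    using lin(1)[of x] by (simp add: linear_iff_module_hom module_hom.sum module_hom.scale)
  have b_left: "b (\<Sum>k<m. scale (c k) (en k)) y = (\<Sum>k<m. c k * b (en k) y)" for y c
    using module_hom.sum[OF lin(2)[unfolded linear_iff_module_hom], of "\<lambda>k. scale (c k) (en k)" "{..<m}"]
      module_hom.scale[OF lin(2)[unfolded linear_iff_module_hom]] by simp
  have "(?A * ?Q * transpose_mat ?A) $$ (i, j) = b (v i) (v j)" if "i < m" "j < m" for i j
  proof -
    have "(?A * ?Q * transpose_mat ?A) $$ (i, j) = (\<Sum>l<m. \<Sum>k<m. a i k * b (en k) (en l) * a j l)"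
      using that by (simp add: scalar_prod_def sum_distrib_right atLeast0LessThan)
    also have "\<dots> = b (v i) (v j)"
      using that by (simp add: a b_left b_right sum_distrib_left mult_ac)
    finally show ?thesis .
  qed
  then have "mat m m (\<lambda>(i, j). b (v i) (v j)) = ?A * ?Q * transpose_mat ?A"
    by (intro eq_matI) auto
  then have "(vol v)\<^sup>2 = det ?A * det ?Q * det ?A"
    using vol v(1) unfolding normalized_volume_def
    by (auto simp: det_mult[of _ m] det_transpose[of _ m] mult_carrier_mat[of _ m m])
  then show "vol (restrict en {..<m}) \<noteq> 0"
    using sq v(2) by auto
qed

section \<open>Extension of the odd power\<close>

lemma (in comm_superalgebra) smult_pow:
  "a \<in> carrier R \<Longrightarrow> (c \<odot> a) [^] (k :: nat) = c ^ k \<odot> a [^] k"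
proof (induction k)
  case (Suc k)
  then show ?case
    by (simp add: smult_mult_left smult_mult_right smult_closed mult.commute flip: smult_smult)
qed (simp add: smult_one)

section \<open>Naturality of coordinates and of the Gram determinant\<close>

lemma coord_natural:
  assumes "comm_superalgebra R" "comm_superalgebra S" "h \<in> superalg_hom R S"
  shows "coord E0 E1 m S (power_act E0 E1 m h v) = (\<lambda>l. h (coord E0 E1 m R v l))"
proof -
  interpret R: comm_superalgebra R by fact
  interpret S: comm_superalgebra S by fact
  interpret h: ring_hom_ring R S h
    using superalg_homD(1)[OF assms(3)] by (intro ring_hom_ringI2 R.ring_axioms S.ring_axioms)
  show ?thesis
    by (auto simp: coord_def power_act_def affine_act_def fun_eq_iff)
qed

lemma power_points_act:
  assumes "h \<in> superalg_hom R S" "v \<in> power_points E0 E1 m R"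
  shows "power_act E0 E1 m h v \<in> power_points E0 E1 m S"
proof -
  have "h a \<in> carrier S" if "a \<in> carrier R" for a
    using ring_hom_closed[OF superalg_homD(1)[OF assms(1)] that] .
  then show ?thesis
    using assms(2) superalg_homD(3,4)[OF assms(1)]
    by (auto simp: power_points_def power_act_def affine_act_def affine_points_def PiE_iff)
qed

lemma polar_natural:
  assumes R: "comm_superalgebra R" and S: "comm_superalgebra S" and h: "h \<in> superalg_hom R S"
    and q: "quadratic_form E0 E1 q" and x: "x \<in> affine_points E0 E1 R" and y: "y \<in> affine_points E0 E1 R"
  shows "polar E0 E1 q S (affine_act E0 E1 h x) (affine_act E0 E1 h y) = h (polar E0 E1 q R x y)"
    and "polar E0 E1 q R x y \<in> even_part R"
proof -
  interpret R: comm_superalgebra R by fact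
  interpret S: comm_superalgebra S by fact
  interpret h: ring_hom_ring R S h
    using superalg_homD(1)[OF h] by (intro ring_hom_ringI2 R.ring_axioms S.ring_axioms)
  have q_even: "q R x \<in> even_part R" if "x \<in> affine_points E0 E1 R" for x
    using q R that by (auto simp: quadratic_form_def even_function_def)
  have q_nat: "q S (affine_act E0 E1 h x) = h (q R x)" if "x \<in> affine_points E0 E1 R" for x
    using q R S h that by (auto simp: quadratic_form_def even_function_def superfunction_def)
  have add: "affine_add E0 E1 R x y \<in> affine_points E0 E1 R"
    using x y by (auto simp: affine_add_def affine_points_def PiE_iff R.even_add R.odd_add)
  have "affine_add E0 E1 S (affine_act E0 E1 h x) (affine_act E0 E1 h y) =
      affine_act E0 E1 h (affine_add E0 E1 R x y)"
    using x y by (auto simp: affine_add_def affine_act_def affine_points_def PiE_iff fun_eq_iff)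
  then show "polar E0 E1 q S (affine_act E0 E1 h x) (affine_act E0 E1 h y) = h (polar E0 E1 q R x y)"
    using q_nat x y add R.even_closed[OF q_even]
    by (simp add: polar_def R.minus_closed a_minus_def)
  show "polar E0 E1 q R x y \<in> even_part R"
    using q_even x y add by (simp add: polar_def a_minus_def R.even_add R.even_uminus)
qed

lemma gram_natural:
  assumes R: "comm_superalgebra R" and S: "comm_superalgebra S" and h: "h \<in> superalg_hom R S"
    and q: "quadratic_form E0 E1 q" and v: "v \<in> power_points E0 E1 m R"
  shows "gram E0 E1 m q S (power_act E0 E1 m h v) = h (gram E0 E1 m q R v)"
proof -
  interpret S: comm_superalgebra S by fact
  have vi: "v i \<in> affine_points E0 E1 R" if "i < m" for i
    using v that by (auto simp: power_points_def)
  note polar = polar_natural[OF R S h q vi vi]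
  have "gram E0 E1 m q S (power_act E0 E1 m h v) =
      super_det S m (\<lambda>i j. h (polar E0 E1 q R (v i) (v j)))"
    unfolding gram_def using polar superalg_homD(3)[OF h]
    by (intro S.super_det_cong) (auto simp: power_act_def)
  also have "\<dots> = h (gram E0 E1 m q R v)"
    unfolding gram_def using polar(2) by (intro super_det_natural[OF R S h, symmetric])
  finally show ?thesis .
qed

theorem theorem5p4:
  fixes scale :: "complex \<Rightarrow> 'v::ab_group_add \<Rightarrow> 'v"
    and V0 V1 E0 E1 :: "'v set"
    and m n :: nat
    and q :: "'a superalg \<Rightarrow> ('v \<Rightarrow> 'a) \<Rightarrow> 'a"
    and b :: "'v \<Rightarrow> 'v \<Rightarrow> complex"
    and vol :: "(nat \<Rightarrow> 'v) \<Rightarrow> complex"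
    and \<Delta> :: "'a superalg \<Rightarrow> (nat \<Rightarrow> 'v \<Rightarrow> 'a) \<Rightarrow> 'a"
  assumes "homogeneous_basis scale V0 V1 E0 E1"
    and "card E0 = m" and "card E1 = 2 * n"
    and "quadratic_form E0 E1 q"
    and "associated_form scale V0 V1 E0 E1 q b"
    and "self_duality scale b"
    and "normalized_volume scale V0 m b vol"
    and "root_of_gram E0 E1 m q vol \<Delta>"
  shows "\<exists>F. superfunction (power_points E0 E1 m) (power_act E0 E1 m) F \<and>
           (\<forall>R. comm_superalgebra R \<longrightarrow>
              (\<forall>v\<in>gram_open E0 E1 m q R. F R v = \<Delta> R v [^]\<^bsub>R\<^esub> (2 * n + 1)))"
proof -
  interpret hb: homogeneous_basis scale V0 V1 E0 E1 by fact
  have E0V: "E0 \<subseteq> V0" and E1V: "E1 \<subseteq> V1"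
    using hb.span_superset hb.span_E0 hb.span_E1 by blast+
  have "E0 \<inter> E1 = {}"
  proof -
    have "0 \<notin> E0"
      using hb.independent_E0 hb.dependent_zero by auto
    moreover have "E0 \<inter> E1 \<subseteq> {0}"
      using E0V E1V hb.V0_V1_inter by auto
    ultimately show ?thesis by auto
  qed
  obtain en where "bij_betw en {0..<m} E0"
    using ex_bij_betw_nat_finite[OF hb.finite_E0] assms(2) by blast
  then have en: "bij_betw en {..<m} E0"
    by (simp add: atLeast0LessThan)
  have b: "super_symmetric_form scale V0 V1 b"
    using assms(5) by (simp add: associated_form_def)
  have cross: "b e f = 0 \<and> b f e = 0" if "e \<in> E0" "f \<in> E1" for e f
    using b that E0V E1V by (auto simp: super_symmetric_form_def dest!: subsetD)
  interpret enumerated_form E0 E1 m en b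
    by unfold_locales (use en hb.finite_E1 \<open>E0 \<inter> E1 = {}\<close> cross in auto)
  \<comment> \<open>Its square is det Q; taking the value of \<open>vol\<close> rather than an
    arbitrary root of det Q makes the sign agree with that of \<Delta>.\<close>
  define c where "c = vol frame"
  have c: "c\<^sup>2 = even_gram" "c \<noteq> 0"
    using normalized_volume_frame[OF assms(1) en b assms(7)]
    by (simp_all add: c_def frame_def even_gram_def)
  then have "even_gram \<noteq> 0"
    by auto
  then obtain s where s0: "Poly_Mapping.lookup s 0 = 1"
    and s: "\<And>(R :: 'a superalg) v Y. solution R v Y \<Longrightarrow>
      alg_eval R (word_val R Y) s \<in> even_part R \<and>
      super_det R m (\<lambda>i j. form_extension E0 E1 b R (v i) (v j)) =
        frame_det R v \<otimes>\<^bsub>R\<^esub>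
          (even_gram \<odot>\<^bsub>R\<^esub> (alg_eval R (word_val R Y) s \<otimes>\<^bsub>R\<^esub> alg_eval R (word_val R Y) s)) \<otimes>\<^bsub>R\<^esub>
          frame_det R v"
    by (rule gram_factorization) blast
  obtain \<Phi> where \<Phi>: "\<And>(R :: 'a superalg) v Y. solution R v Y \<Longrightarrow>
      alg_eval R (word_val R (coord E0 E1 m R v)) \<Phi> =
        frame_det R v [^]\<^bsub>R\<^esub> (2 * n) \<otimes>\<^bsub>R\<^esub> alg_eval R (word_val R Y) (s ^ (2 * n + 1))"
    using extend_words[of "s ^ (2 * n + 1)"] unfolding assms(3) by blast
  \<comment> \<open>Of the 2n + 1 factors det X, 2n are absorbed in \<open>\<Phi>\<close> and the
    last one is \<open>frame_word\<close>. No entry of Y occurs, so the formula makes sense on all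
    of \<open>power_points\<close>.\<close>
  define F where "F R v = alg_eval R (word_val R (coord E0 E1 m R v))
      (const (c ^ (2 * n + 1)) * (frame_word * \<Phi>))" for R :: "'a superalg" and v
  have "superfunction (power_points E0 E1 m) (power_act E0 E1 m) F"
    unfolding superfunction_def
  proof (intro conjI allI impI ballI)
    fix R :: "'a superalg" and v
    assume "comm_superalgebra R" "v \<in> power_points E0 E1 m R"
    then interpret word_eval R "coord E0 E1 m R v"
      by (rule word_eval_coord)
    show "F R v \<in> carrier R"
      unfolding F_def by (rule ev_closed)
  next
    fix R S :: "'a superalg" and h v
    assume R: "comm_superalgebra R" and S: "comm_superalgebra S" and h: "h \<in> superalg_hom R S"
      and v: "v \<in> power_points E0 E1 m R"
    interpret word_eval R "coord E0 E1 m R v"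
      using R v by (rule word_eval_coord)
    show "F S (power_act E0 E1 m h v) = h (F R v)"
      unfolding F_def coord_natural[OF R S h]
      by (rule word_eval_natural[OF R S h letter_closed, symmetric])
  qed
  moreover have "F R v = \<Delta> R v [^]\<^bsub>R\<^esub> (2 * n + 1)"
    if R: "comm_superalgebra R" and v_open: "v \<in> gram_open E0 E1 m q R" for R :: "'a superalg" and v
  proof -
    interpret comm_superalgebra R by (fact R)
    have v: "v \<in> power_points E0 E1 m R" and unit: "gram E0 E1 m q R v \<in> Units R"
      using v_open by (auto simp: gram_open_def)
    note vi = power_points_affine[OF v]
    have "polar E0 E1 q R (v i) (v j) = form_extension E0 E1 b R (v i) (v j)" if "i < m" "j < m" for i j
      using assms(5) R vi that by (auto simp: associated_form_def)
    \<comment> \<open>Evenness of the polar form is stated in \<open>polar_natural\<close> next to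
      naturality, so some homomorphism has to be supplied; \<open>rep\<close> serves.\<close>
    then have gram: "gram E0 E1 m q R v = super_det R m (\<lambda>i j. form_extension E0 E1 b R (v i) (v j))"
      unfolding gram_def using polar_natural(2)[OF R comm_superalgebra_reduction rep_hom assms(4) vi vi]
      by (intro super_det_cong) auto
    obtain Y where sol: "solution R v Y"
      using solution_exists[OF R v] unit gram by metis
    interpret Y: odd_eval R Y
      using sol by (simp add: solution_def)
    interpret v: word_eval R "coord E0 E1 m R v"
      using R v by (rule word_eval_coord)
    let ?d = "frame_det R v" and ?s = "Y.ev s"
    have d: "?d \<in> even_part R" "?d \<in> carrier R"
      using frame_det_even[OF R v] even_closed by auto
    have se: "?s \<in> even_part R"
      using s[OF sol] by simp
    define y where "y = c \<odot>\<^bsub>R\<^esub> (?d \<otimes>\<^bsub>R\<^esub> ?s)"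
    have y: "y \<in> even_part R"
      using d se by (simp add: y_def smult_even even_even)
    have ds: "?s \<otimes>\<^bsub>R\<^esub> ?d = ?d \<otimes>\<^bsub>R\<^esub> ?s"
      using even_comm[OF se d(2)] .
    have "y \<otimes>\<^bsub>R\<^esub> y = gram E0 E1 m q R v"
    proof -
      have "y \<otimes>\<^bsub>R\<^esub> y = (c * c) \<odot>\<^bsub>R\<^esub> (?d \<otimes>\<^bsub>R\<^esub> (?s \<otimes>\<^bsub>R\<^esub> ?d) \<otimes>\<^bsub>R\<^esub> ?s)"
        using d by (simp add: y_def smult_mult_left smult_mult_right smult_closed smult_smult m_assoc)
      also have "?d \<otimes>\<^bsub>R\<^esub> (?s \<otimes>\<^bsub>R\<^esub> ?d) \<otimes>\<^bsub>R\<^esub> ?s = ?d \<otimes>\<^bsub>R\<^esub> (?s \<otimes>\<^bsub>R\<^esub> ?s) \<otimes>\<^bsub>R\<^esub> ?d"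
        using d by (simp add: m_assoc ds) (simp add: ds flip: m_assoc)
      finally show ?thesis
        using s[OF sol] gram d c(1)
        by (simp add: power2_eq_square smult_mult_left smult_mult_right)
    qed
    moreover have "\<Delta> R v \<otimes>\<^bsub>R\<^esub> \<Delta> R v = gram E0 E1 m q R v" "\<Delta> R v \<in> carrier R"
      using assms(8) R v_open by (auto simp: root_of_gram_def superfunction_def)
    ultimately have sq: "\<Delta> R v \<otimes>\<^bsub>R\<^esub> \<Delta> R v = y \<otimes>\<^bsub>R\<^esub> y" and \<Delta>c: "\<Delta> R v \<in> carrier R"
      by simp_all
    \<comment> \<open>Uniqueness of the root needs an even inverse of \<open>y\<close> itself,
      namely \<open>y\<close> times the inverse of the Gram determinant.\<close>
    obtain z where z: "z \<in> even_part R" "(y \<otimes>\<^bsub>R\<^esub> y) \<otimes>\<^bsub>R\<^esub> z = \<one>\<^bsub>R\<^esub>"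
      using even_inverse[OF even_even[OF y y]] unit \<open>y \<otimes>\<^bsub>R\<^esub> y = _\<close> by metis
    have yz: "y \<otimes>\<^bsub>R\<^esub> z \<in> even_part R" "y \<otimes>\<^bsub>R\<^esub> (y \<otimes>\<^bsub>R\<^esub> z) = \<one>\<^bsub>R\<^esub>"
      using y z by (auto simp: even_even m_assoc even_closed)
    have "\<Delta> R v \<ominus>\<^bsub>R\<^esub> y \<in> super_radical"
    proof -
      note hom = comm_superalgebra_axioms comm_superalgebra_reduction rep_hom
      interpret S: comm_superalgebra reduction by (rule comm_superalgebra_reduction)
      let ?v = "power_act E0 E1 m rep v"
      have v': "?v \<in> power_points E0 E1 m reduction"
        by (rule power_points_act[OF rep_hom v])
      have "rep (gram E0 E1 m q R v) \<in> Units reduction"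
      proof -
        obtain u where u: "u \<in> carrier R" "u \<otimes>\<^bsub>R\<^esub> gram E0 E1 m q R v = \<one>\<^bsub>R\<^esub>" "gram E0 E1 m q R v \<otimes>\<^bsub>R\<^esub> u = \<one>\<^bsub>R\<^esub>"
          and gc: "gram E0 E1 m q R v \<in> carrier R"
          using unit by (auto simp: Units_def)
        then have "rep u \<otimes>\<^bsub>reduction\<^esub> rep (gram E0 E1 m q R v) = \<one>\<^bsub>reduction\<^esub>"
          "rep (gram E0 E1 m q R v) \<otimes>\<^bsub>reduction\<^esub> rep u = \<one>\<^bsub>reduction\<^esub>"
          by (simp_all add: reduction_simps)
        then show ?thesis
          using u gc by (auto simp: Units_def reduction_simps(1))
      qed
      then have v'_open: "?v \<in> gram_open E0 E1 m q reduction"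
        using v' by (simp add: gram_open_def gram_natural[OF hom assms(4) v])
      \<comment> \<open>The odd part of \<open>reduction\<close> is zero, so every odd function
        vanishes at this point, which thus lies in U_rd.\<close>
      have "f reduction ?v = \<zero>\<^bsub>reduction\<^esub>"
        if "odd_function (gram_open E0 E1 m q) (power_act E0 E1 m) f" for f
        using that v'_open comm_superalgebra_reduction by (auto simp: odd_function_def reduction_simps)
      then have "?v \<in> rd_points (gram_open E0 E1 m q) (power_act E0 E1 m) reduction"
        using v'_open by (simp add: rd_points_def)
      then have "\<Delta> reduction ?v = volume_extension E0 m vol reduction ?v"
        using assms(8) comm_superalgebra_reduction by (auto simp: root_of_gram_def)
      also have "\<dots> = c \<odot>\<^bsub>reduction\<^esub> frame_det reduction ?v"
        unfolding c_def
      proof (rule volume_extension_frame_det[OF comm_superalgebra_reduction v'])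
        have alt: "alternating_map scale V0 m vol"
          using assms(7) by (simp add: normalized_volume_def)
        have "frame \<in> {..<m} \<rightarrow>\<^sub>E V0"
          using en_in E0V by (auto simp: frame_def)
        then show "vol (frame \<circ> p) = of_int (sign p) * vol frame" if "p permutes {..<m}" for p
          using that by (intro alternating_map_permute[OF hb.super_vector_space_axioms alt])
        show "vol f = 0" if f: "f \<in> {..<m} \<rightarrow>\<^sub>E E0" and "\<not> inj_on f {..<m}" for f
        proof -
          obtain i j where "i < m" "j < m" "i \<noteq> j" "f i = f j"
            using \<open>\<not> inj_on f {..<m}\<close> by (auto simp: inj_on_def)
          moreover have "f \<in> {..<m} \<rightarrow>\<^sub>E V0"
            using f E0V by (auto simp: PiE_iff)
          ultimately show ?thesis
            using alt unfolding alternating_map_def by blast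
        qed
      qed
      also have "frame_det reduction ?v = rep ?d"
      proof -
        have X: "v i (en k) \<in> even_part R" if "i < m" "k < m" for i k
          using power_pointsD(1)[OF v] en_in that by auto
        have "rep ?d = super_det reduction m (\<lambda>i k. rep (v i (en k)))"
          unfolding frame_det_def using X by (intro super_det_natural[OF hom])
        also have "\<dots> = frame_det reduction ?v"
          unfolding frame_det_def using X superalg_homD(3)[OF rep_hom] en_in
          by (intro S.super_det_cong) (auto simp: power_act_def affine_act_def)
        finally show ?thesis by simp
      qed
      also have "c \<odot>\<^bsub>reduction\<^esub> rep ?d = rep (c \<odot>\<^bsub>R\<^esub> ?d)"
        using d by (simp add: reduction_simps)
      also have "\<Delta> reduction ?v = rep (\<Delta> R v)"
        using assms(8) R comm_superalgebra_reduction rep_hom v_open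
        by (auto simp: root_of_gram_def superfunction_def)
      finally have "rep (\<Delta> R v) = rep (c \<odot>\<^bsub>R\<^esub> ?d)" .
      moreover have "rep y = rep (c \<odot>\<^bsub>R\<^esub> ?d)"
      proof -
        \<comment> \<open>\<open>s\<close> has constant term 1, and every nonempty word in the odd
          entries of Y lies in the radical.\<close>
        have "?s \<ominus>\<^bsub>R\<^esub> 1 \<odot>\<^bsub>R\<^esub> \<one>\<^bsub>R\<^esub> \<in> super_radical"
          using Y.ev_ideal[OF ideal_super_radical super_radical_smult, of s] Y.word_val_super_radical
          by (simp add: s0[unfolded zero_list_def] zero_list_def)
        then have "(c \<odot>\<^bsub>R\<^esub> ?d) \<otimes>\<^bsub>R\<^esub> (?s \<ominus>\<^bsub>R\<^esub> \<one>\<^bsub>R\<^esub>) \<in> super_radical"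
          using super_radical_mult(2) d by (simp add: smult_one smult_closed)
        moreover have "(c \<odot>\<^bsub>R\<^esub> ?d) \<otimes>\<^bsub>R\<^esub> (?s \<ominus>\<^bsub>R\<^esub> \<one>\<^bsub>R\<^esub>) = y \<ominus>\<^bsub>R\<^esub> c \<odot>\<^bsub>R\<^esub> ?d"
          using d by (simp add: y_def a_minus_def r_distr r_minus smult_closed smult_mult_left)
        ultimately show ?thesis
          using y d by (simp add: rep_eq_iff even_closed smult_closed)
      qed
      ultimately show ?thesis
        using \<Delta>c y rep_eq_iff[of "\<Delta> R v" y] by (simp add: even_closed)
    qed
    then have "\<Delta> R v = y"
      using sqrt_unique[OF \<Delta>c y yz sq] by simp
    moreover have "F R v = y [^]\<^bsub>R\<^esub> (2 * n + 1)"
    proof -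
      have "F R v = c ^ (2 * n + 1) \<odot>\<^bsub>R\<^esub> (?d \<otimes>\<^bsub>R\<^esub> (?d [^]\<^bsub>R\<^esub> (2 * n) \<otimes>\<^bsub>R\<^esub> ?s [^]\<^bsub>R\<^esub> (2 * n + 1)))"
        unfolding F_def v.ev_const_mult v.ev_mult[of frame_word]
          eval_frame_word[OF R v] \<Phi>[OF sol] Y.ev_power ..
      also have "?d \<otimes>\<^bsub>R\<^esub> (?d [^]\<^bsub>R\<^esub> (2 * n) \<otimes>\<^bsub>R\<^esub> ?s [^]\<^bsub>R\<^esub> (2 * n + 1)) = ?d [^]\<^bsub>R\<^esub> (2 * n + 1) \<otimes>\<^bsub>R\<^esub> ?s [^]\<^bsub>R\<^esub> (2 * n + 1)"
        using d nat_pow_Suc2[OF d(2), of "2 * n"] by (simp add: m_assoc)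
      also have "\<dots> = (?d \<otimes>\<^bsub>R\<^esub> ?s) [^]\<^bsub>R\<^esub> (2 * n + 1)"
        using ds d by (intro pow_mult_distrib[symmetric]) auto
      also have "c ^ (2 * n + 1) \<odot>\<^bsub>R\<^esub> \<dots> = y [^]\<^bsub>R\<^esub> (2 * n + 1)"
        unfolding y_def using d by (intro smult_pow[symmetric]) auto
      finally show ?thesis .
    qed
    ultimately show ?thesis by simp
  qed
  ultimately show ?thesis by blast
qed

end
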